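(* Let $d\ge1$, $H>0$, let $\{X(t):t\ge0\}$ be a non-deterministic $H$-selfsimilar additive process on $\mathbb{R}^d$, let $\mu$ be the distribution of $X(1)$, and let $C\in[0,\infty]$. Let $0<\alpha\le1$ and suppose that $f(x)$ is regularly varying as $x\to\infty$ and that the function $r\mapsto\exp\bigl(r^\alpha f(\log(r\vee1))\bigr)$ is increasing and submultiplicative on $[0,\infty)$. Then $$\limsup_{t\to\infty}\frac{|X(t)|}{t^H(\log_{(2)}t)^{1/\alpha}/f(\alpha^{-1}\log_{(3)}t)^{1/\alpha}}=C\quad\text{a.s.}$$ if and only if $$\liminf_{r\to\infty}\frac{-\log K(r)}{r^\alpha f(\log r)}=C^{-\alpha},$$ equivalently, if and only if $$\liminf_{r\to\infty}\frac{-\log\mu(|x|>r)}{r^\alpha f(\log r)}=C^{-\alpha}.$$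
   Context: $|x|$ is the Euclidean norm; $a\vee b=\max\{a,b\}$; $\log_{(n)}$ is the $n$-fold iteration of the logarithm; "increasing" and "decreasing" are in the wide sense; conventions $-\log0=\infty$, $0^{-\alpha}=\infty$, $\infty^{-\alpha}=0$. $\mu(|x|>r):=\mu(\{x:|x|>r\})$. An $\mathbb{R}^d$-valued process $\{X(t):t\ge0\}$ is an $H$-selfsimilar additive process ($H>0$) if: (1) $\{X(ct)\}\stackrel{d}{=}\{c^HX(t)\}$ (equality of finite-dimensional distributions) for every $c>0$; (2) it has independent increments (stationarity not assumed); (3) almost surely its paths are right-continuous with left limits. It is non-deterministic if it is not of the form $X(t)=t^Hc$ with $c\in\mathbb{R}^d$. The distribution $\mu$ of $X(1)$ is selfdecomposable, hence infinitely divisible; let $\nu$ be its Lévy measure. If $\nu\ne0$, then $\nu(B)=\int_{S^{d-1}}\sigma(d\xi)\int_0^\infty1_B(r\xi)k_\xi(r)r^{-1}dr$, where $\sigma$ is a finite non-zero measure on the unit sphere $S^{d-1}$ and $k_\xi(r)\ge0$ is measurable in $\xi$ and decreasing in $r>0$; put $K(r):=\int_{S^{d-1}}k_\xi(r)\sigma(d\xi)$ for $r>0$. If $\nu=0$, $K\equiv0$. A positive measurable function $h$ on $[0,\infty)$ is submultiplicative if there is $c>0$ with $h(x+y)\le c\,h(x)h(y)$ for all $x,y\ge0$. *)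

theory Defs
  imports "HOL-Probability.Probability"
begin

section \<open>Selfsimilar additive processes\<close>

text \<open>A process is indexed by all reals, but only its values at times \<open>t \<ge> 0\<close> are constrained
  or used.\<close>

definition fdd :: "'w measure \<Rightarrow> (real \<Rightarrow> 'w \<Rightarrow> 'a::euclidean_space) \<Rightarrow> real set \<Rightarrow> (real \<Rightarrow> 'a) measure"
  where "fdd M X J = distr M (\<Pi>\<^sub>M t\<in>J. borel) (\<lambda>\<omega>. \<lambda>t\<in>J. X t \<omega>)"

definition same_fdds :: "'w measure \<Rightarrow> (real \<Rightarrow> 'w \<Rightarrow> 'a::euclidean_space) \<Rightarrow> (real \<Rightarrow> 'w \<Rightarrow> 'a) \<Rightarrow> bool"
  where "same_fdds M X Y \<longleftrightarrow> (\<forall>J. finite J \<and> J \<subseteq> {0..} \<longrightarrow> fdd M X J = fdd M Y J)"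

definition independent_increments :: "'w measure \<Rightarrow> (real \<Rightarrow> 'w \<Rightarrow> 'a::euclidean_space) \<Rightarrow> bool"
  where "independent_increments M X \<longleftrightarrow>
    (\<forall>n. \<forall>t :: nat \<Rightarrow> real. 0 \<le> t 0 \<and> strict_mono_on {..n} t \<longrightarrow>
      prob_space.indep_vars M (\<lambda>_. borel) (\<lambda>i \<omega>. X (t (Suc i)) \<omega> - X (t i) \<omega>) {..<n})"

definition cadlag :: "(real \<Rightarrow> 'a::euclidean_space) \<Rightarrow> bool"
  where "cadlag x \<longleftrightarrow>
    (\<forall>t\<ge>0. continuous (at_right t) x) \<and> (\<forall>t>0. \<exists>l. (x \<longlongrightarrow> l) (at_left t))"

definition selfsimilar_additive_process ::
    "'w measure \<Rightarrow> real \<Rightarrow> (real \<Rightarrow> 'w \<Rightarrow> 'a::euclidean_space) \<Rightarrow> bool"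
  where "selfsimilar_additive_process M H X \<longleftrightarrow>
    prob_space M \<and> H > 0 \<and> (\<forall>t\<ge>0. X t \<in> borel_measurable M) \<and>
    (\<forall>c>0. same_fdds M (\<lambda>t. X (c * t)) (\<lambda>t \<omega>. (c powr H) *\<^sub>R X t \<omega>)) \<and>
    independent_increments M X \<and>
    (AE \<omega> in M. cadlag (\<lambda>t. X t \<omega>))"

definition deterministic_process :: "'w measure \<Rightarrow> real \<Rightarrow> (real \<Rightarrow> 'w \<Rightarrow> 'a::euclidean_space) \<Rightarrow> bool"
  where "deterministic_process M H X \<longleftrightarrow>
    (\<exists>c. AE \<omega> in M. \<forall>t\<ge>0. X t \<omega> = (t powr H) *\<^sub>R c)"

section \<open>Levy measures\<close>

text \<open>\<open>A\<close> is the Gaussian covariance operator, \<open>\<gamma>\<close> the drift for the centering function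
  \<open>1\<^bsub>{|x| \<le> 1}\<^esub>\<close>. The Levy measure does not depend on that choice.\<close>

definition levy_khintchine :: "'a::euclidean_space measure \<Rightarrow> ('a \<Rightarrow> 'a) \<Rightarrow> 'a measure \<Rightarrow> 'a \<Rightarrow> bool"
  where "levy_khintchine \<mu> A \<nu> \<gamma> \<longleftrightarrow>
    linear A \<and> (\<forall>x y. A x \<bullet> y = x \<bullet> A y) \<and> (\<forall>x. 0 \<le> x \<bullet> A x) \<and>
    sets \<nu> = sets borel \<and> emeasure \<nu> {0} = 0 \<and>
    (\<integral>\<^sup>+x. ennreal (min 1 ((norm x)\<^sup>2)) \<partial>\<nu>) < \<infinity> \<and>
    (\<forall>z. (CLINT x|\<mu>. iexp (z \<bullet> x)) =
      exp (complex_of_real (- (z \<bullet> A z) / 2) + \<i> * complex_of_real (\<gamma> \<bullet> z) +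
        (CLINT x|\<nu>. iexp (z \<bullet> x) - 1
           - \<i> * complex_of_real (z \<bullet> x) * indicator (cball 0 1) x)))"

definition levy_measure :: "'a::euclidean_space measure \<Rightarrow> 'a measure \<Rightarrow> bool"
  where "levy_measure \<mu> \<nu> \<longleftrightarrow> (\<exists>A \<gamma>. levy_khintchine \<mu> A \<nu> \<gamma>)"

text \<open>The representation of the Levy measure of a selfdecomposable distribution. The measure
  \<open>\<sigma>\<close> lives on the unit sphere itself, i.e. \<open>space \<sigma> = sphere 0 1\<close>.\<close>

definition selfdecomposable_representation ::
    "'a::euclidean_space measure \<Rightarrow> 'a measure \<Rightarrow> ('a \<Rightarrow> real \<Rightarrow> real) \<Rightarrow> bool"
  where "selfdecomposable_representation \<nu> \<sigma> k \<longleftrightarrow>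
    sets \<sigma> = sets (restrict_space borel (sphere 0 1)) \<and>
    finite_measure \<sigma> \<and> emeasure \<sigma> (sphere 0 1) \<noteq> 0 \<and>
    (\<forall>\<xi>\<in>sphere 0 1. \<forall>r>0. 0 \<le> k \<xi> r) \<and>
    (\<forall>r>0. (\<lambda>\<xi>. k \<xi> r) \<in> borel_measurable \<sigma>) \<and>
    (\<forall>\<xi>\<in>sphere 0 1. antimono_on {0<..} (k \<xi>)) \<and>
    (\<forall>B\<in>sets borel. emeasure \<nu> B =
      (\<integral>\<^sup>+\<xi>. (\<integral>\<^sup>+r\<in>{0<..}. indicator B (r *\<^sub>R \<xi>) * ennreal (k \<xi> r / r) \<partial>lborel) \<partial>\<sigma>))"

text \<open>For \<open>r > 0\<close> the integral is finite: \<open>K r * ln 2\<close> is at most the (finite) Levy measure of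
  \<open>{x. norm x > r / 2}\<close>, so the Bochner integral is the intended one.\<close>

definition radial_K ::
    "'a::euclidean_space measure \<Rightarrow> 'a measure \<Rightarrow> ('a \<Rightarrow> real \<Rightarrow> real) \<Rightarrow> real \<Rightarrow> real"
  where "radial_K \<nu> \<sigma> k r = (if emeasure \<nu> UNIV = 0 then 0 else (LINT \<xi>|\<sigma>. k \<xi> r))"

section \<open>Real functions and extended-real conventions\<close>

definition regularly_varying :: "(real \<Rightarrow> real) \<Rightarrow> bool"
  where "regularly_varying f \<longleftrightarrow>
    (\<exists>x0. f \<in> borel_measurable (restrict_space borel {x0..}) \<and> (\<forall>x\<ge>x0. 0 < f x)) \<and>
    (\<exists>\<rho>. \<forall>u>0. ((\<lambda>x. f (u * x) / f x) \<longlongrightarrow> u powr \<rho>) at_top)"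

definition submultiplicative :: "(real \<Rightarrow> real) \<Rightarrow> bool"
  where "submultiplicative h \<longleftrightarrow>
    h \<in> borel_measurable (restrict_space borel {0..}) \<and> (\<forall>x\<ge>0. 0 < h x) \<and>
    (\<exists>c>0. \<forall>x\<ge>0. \<forall>y\<ge>0. h (x + y) \<le> c * h x * h y)"

definition neg_log :: "real \<Rightarrow> ereal"
  where "neg_log x = (if x = 0 then \<infinity> else ereal (- ln x))"

definition powr_minus :: "ereal \<Rightarrow> real \<Rightarrow> ereal"
  where "powr_minus C \<alpha> =
    (if C = 0 then \<infinity> else if C = \<infinity> then 0 else ereal (real_of_ereal C powr (- \<alpha>)))"

end

theory Submission
  imports Defs "HOL-Real_Asymp.Real_Asymp"
begin

text \<open>
  Write \<open>g r = r\<^sup>\<alpha> f (log r)\<close>. Regular variation of \<open>f\<close> makes \<open>g\<close> regularly varying of index \<open>\<alpha>\<close>,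
  and the normalising function \<open>\<phi>\<close> satisfies \<open>g (a \<phi> s) \<sim> a\<^sup>\<alpha> log s\<close>.

  The limit superior and the tail of \<open>\<mu>\<close>: along \<open>t = exp s\<close>, Ottaviani's inequality on short
  intervals and the first Borel-Cantelli lemma give the upper bound. If the limit superior were too
  small with positive probability, the second Borel-Cantelli lemma would make the tail of
  \<open>\<xi> = q\<^sup>-\<^sup>H (X q - X 1)\<close> summable along \<open>\<phi>\<close>, hence exponentially small in \<open>g\<close>; iterating
  \<open>P(|X 1| > r) \<le> P(|\<xi>| > (1 - d) r) + P(|X 1| > r / d)\<close>, where \<open>q\<^sup>H = d\<^sup>-\<^sup>2\<close>, transfers this bound to \<open>\<mu>\<close>.

  The tails of \<open>\<mu>\<close> and \<open>\<nu>\<close> (the latter comparable to \<open>K\<close> because \<open>K\<close> is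
  decreasing): a finite net of directions reduces the comparison to the real projections of \<open>\<mu>\<close>. These are weak limits of laws of sums of independent, identically
  distributed jumps, for which submultiplicativity bounds \<open>E exp (\<kappa> g |S|)\<close> and a single big jump
  bounds the tail from below. Existence theorems for infinitely divisible laws are thus avoided.
\<close>

section \<open>Regular variation\<close>

text \<open>For eventually nonnegative \<open>T\<close>, the liminf of \<open>- ln T / g\<close> is
  the supremum of the \<kappa> with \<open>tail_le T \<kappa>\<close>. Each comparison may therefore
  lose an arbitrarily small part of the exponent, and by regular variation of \<open>g\<close> this
  loss pays for constant factors, shifts and dilations by factors near 1. Crude estimates then
  suffice. Nothing makes \<phi> monotone, but \<open>g\<close> is, so inequalities about \<phi> are
  obtained by comparing values of \<open>g\<close>. Increments are not stationary; over geometric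
  times selfsimilarity still makes them scaled copies of a single variable. In the jump sums, paying
  the constant of submultiplicativity once per summand would destroy every bound as the number of
  summands grows. Only jumps larger than 1 pay it; small jumps are collected in an exponential,
  which factorises without loss. The equivalences follow because the rate of decay alone determines
  an almost sure value of the limit superior.\<close>

lemma slowly_varying_uniform:
  fixes k :: "real \<Rightarrow> real" and y v :: "nat \<Rightarrow> real"
  assumes meas [measurable]: "k \<in> borel_measurable borel"
    and sv: "\<And>v. ((\<lambda>y. k (y + v) - k y) \<longlongrightarrow> 0) at_top"
    and y: "filterlim y at_top sequentially" and v: "v \<longlonglongrightarrow> 0"
  shows "(\<lambda>n. k (y n + v n) - k (y n)) \<longlonglongrightarrow> 0"
proof -
  \<comment> \<open>The unit window and the truncation at 1 make dominated convergence applicable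
    without any bound on the increments of \<open>k\<close>. Pointwise convergence thus gives
    convergence of averages along every sequence tending to infinity.\<close>
  define A where "A z w = indicator {0..1} w * min 1 \<bar>k (z + w) - k z\<bar>" for z w :: real
  have A_meas [measurable]: "A z \<in> borel_measurable borel" for z unfolding A_def by measurable
  have A_bound: "\<bar>A z w\<bar> \<le> indicator {0..1} w" for z w by (auto simp: A_def indicator_def)
  have int_ind: "integrable lborel (indicator {0..1::real} :: real \<Rightarrow> real)" by simp
  have A_int: "integrable lborel (A z)" for z
    by (rule Bochner_Integration.integrable_bound[OF int_ind]) (use A_bound in auto)
  have conv: "(\<lambda>n. LINT w|lborel. A (z n) w) \<longlonglongrightarrow> 0" if z: "filterlim z at_top sequentially" for z :: "nat \<Rightarrow> real"
  proof -
    have "(\<lambda>n. LINT w|lborel. A (z n) w) \<longlonglongrightarrow> (LINT w::real|lborel. (0::real))"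
    proof (rule integral_dominated_convergence[where w = "indicator {0..1::real}"])
      show "AE w in lborel. (\<lambda>n. A (z n) w) \<longlonglongrightarrow> 0"
      proof (rule AE_I2)
        fix w :: real
        have "(\<lambda>n. k (z n + w) - k (z n)) \<longlonglongrightarrow> 0"
          by (rule filterlim_compose[OF sv z])
        then have "(\<lambda>n. min 1 \<bar>k (z n + w) - k (z n)\<bar>) \<longlonglongrightarrow> min 1 0"
          by (intro tendsto_intros tendsto_rabs_zero)
        then show "(\<lambda>n. A (z n) w) \<longlonglongrightarrow> 0"
          unfolding A_def by (auto intro!: tendsto_mult_right_zero)
      qed
    qed (use A_bound in auto)
    then show ?thesis by simp
  qed
  define m where "m n = min 1 \<bar>k (y n + v n) - k (y n)\<bar>" for n
  have y': "filterlim (\<lambda>n. y n + v n) at_top sequentially"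
    using filterlim_tendsto_add_at_top[OF v y] by (simp add: add.commute)
  have lim0: "(\<lambda>n. (LINT w|lborel. A (y n) w) + (LINT w|lborel. A (y n + v n) w)) \<longlonglongrightarrow> 0"
    using tendsto_add[OF conv[OF y] conv[OF y']] by simp
  \<comment> \<open>For \<open>w\<close> in the overlap of the windows based at \<open>y n\<close>
    and \<open>y n + v n\<close>, which has length \<open>1 - \<bar>v n\<bar>\<close>, both
    increments end at \<open>y n + w\<close>. Their sum dominates the increment between the two base
    points, and integrating over the overlap bounds \<open>m n\<close> by two averages.\<close>
  have le: "(1 - \<bar>v n\<bar>) * m n \<le> (LINT w|lborel. A (y n) w) + (LINT w|lborel. A (y n + v n) w)"
    if "\<bar>v n\<bar> \<le> 1" for n
  proof -
    let ?B = "\<lambda>w. A (y n + v n) (- v n + 1 * w)"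
    have shift: "(LINT w|lborel. A (y n + v n) w) = (LINT w|lborel. ?B w)"
      using lborel_integral_real_affine[of 1 "A (y n + v n)" "- v n"] by simp
    have B_int: "integrable lborel ?B"
      by (rule lborel_integrable_real_affine) (auto simp: A_int)
    have "(1 - \<bar>v n\<bar>) * m n = (LINT w|lborel. indicator {max 0 (v n)..min 1 (1 + v n)} w * m n)"
      using that by (auto simp: max_def min_def)
    also have "\<dots> \<le> (LINT w|lborel. A (y n) w + ?B w)"
    proof (rule integral_mono)
      show "integrable lborel (\<lambda>w. indicator {max 0 (v n)..min 1 (1 + v n)} w * m n)"
        by (intro integrable_mult_left integrable_real_indicator) (auto simp: emeasure_lborel_Icc_eq)
      show "integrable lborel (\<lambda>w. A (y n) w + ?B w)" using A_int B_int by simp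
    next
      fix w :: real
      have e: "y n + v n + (- v n + 1 * w) = y n + w" by simp
      show "indicator {max 0 (v n)..min 1 (1 + v n)} w * m n \<le> A (y n) w + ?B w"
        unfolding A_def e m_def by (auto simp: indicator_def)
    qed
    also have "\<dots> = (LINT w|lborel. A (y n) w) + (LINT w|lborel. A (y n + v n) w)"
      unfolding shift using A_int B_int by simp
    finally show ?thesis .
  qed
  have ev: "\<forall>\<^sub>F n in sequentially. \<bar>v n\<bar> \<le> 1 / 2"
    using tendsto_rabs_zero[OF v] by (auto dest!: order_tendstoD(2)[where a = "1/2"] elim!: eventually_mono)
  have "m \<longlonglongrightarrow> 0"
  proof (rule tendsto_sandwich)
    show "\<forall>\<^sub>F n in sequentially. 0 \<le> m n" by (auto simp: m_def)
    show "\<forall>\<^sub>F n in sequentially. m n \<le> 2 * ((LINT w|lborel. A (y n) w) + (LINT w|lborel. A (y n + v n) w))"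
      using ev
    proof eventually_elim
      case (elim n)
      have "(1/2) * m n \<le> (1 - \<bar>v n\<bar>) * m n"
        using elim by (intro mult_right_mono) (auto simp: m_def)
      then show ?case using le[of n] elim by simp
    qed
    show "(\<lambda>n. 2 * ((LINT w|lborel. A (y n) w) + (LINT w|lborel. A (y n + v n) w))) \<longlonglongrightarrow> 0"
      by (rule tendsto_mult_right_zero[OF lim0])
  qed auto
  then have "\<forall>\<^sub>F n in sequentially. \<bar>k (y n + v n) - k (y n)\<bar> < e" if "e > 0" for e
    using that order_tendstoD(2)[of m 0 sequentially "min e 1"]
    by (auto simp: m_def min_less_iff_disj elim!: eventually_mono)
  then show ?thesis
    by (intro tendstoI) (auto simp: dist_real_def)
qed

text \<open>In logarithmic coordinates regular variation becomes additive: once the linear term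
  \<open>\<rho> * y\<close> is subtracted, the increments of \<open>ln (f (exp y))\<close> tend to
  0. The averaging argument makes this uniform over the shifts \<open>ln (u n)\<close>, which tend
  to 0.\<close>

lemma regularly_varying_uniform:
  fixes f :: "real \<Rightarrow> real" and x u :: "nat \<Rightarrow> real"
  assumes rv: "regularly_varying f"
    and x: "filterlim x at_top sequentially" and u: "u \<longlonglongrightarrow> 1"
  shows "(\<lambda>n. f (u n * x n) / f (x n)) \<longlonglongrightarrow> 1"
proof -
  obtain x0 \<rho> where fm: "f \<in> borel_measurable (restrict_space borel {x0..})"
    and fpos0: "\<And>x. x \<ge> x0 \<Longrightarrow> 0 < f x"
    and flim: "\<And>u. u > 0 \<Longrightarrow> ((\<lambda>x. f (u * x) / f x) \<longlongrightarrow> u powr \<rho>) at_top"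
    using rv unfolding regularly_varying_def by blast
  \<comment> \<open>Measurability and positivity of \<open>f\<close> are given only on
    \<open>{x0..}\<close>; the value 1 elsewhere yields a Borel function with a harmless
    logarithm.\<close>
  define F where "F x = (if x \<in> {x0..} then f x else 1)" for x
  have F_meas [measurable]: "F \<in> borel_measurable borel"
    unfolding F_def using measurable_restrict_space_iff[of "{x0..}" borel 1 borel f] fm by simp
  define k where "k y = ln (F (exp y)) - \<rho> * y" for y
  have k_meas: "k \<in> borel_measurable borel" unfolding k_def by measurable
  have F_ev: "\<forall>\<^sub>F y in at_top. exp y \<ge> x0" by real_asymp
  have sv: "((\<lambda>y. k (y + v) - k y) \<longlongrightarrow> 0) at_top" for v
  proof -
    have "((\<lambda>y. f (exp v * exp y) / f (exp y)) \<longlongrightarrow> exp v powr \<rho>) at_top"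
      by (rule filterlim_compose[OF flim exp_at_top]) simp
    then have "((\<lambda>y. ln (f (exp v * exp y) / f (exp y)) - \<rho> * v) \<longlongrightarrow> ln (exp v powr \<rho>) - \<rho> * v) at_top"
      by (intro tendsto_intros) auto
    moreover have "\<forall>\<^sub>F y in at_top. ln (f (exp v * exp y) / f (exp y)) - \<rho> * v = k (y + v) - k y"
    proof -
      have "\<forall>\<^sub>F y in at_top. exp v * exp y \<ge> x0" by real_asymp
      with F_ev show ?thesis
        by eventually_elim
          (auto simp: k_def F_def ln_div fpos0 exp_add algebra_simps less_imp_neq[OF fpos0, symmetric])
    qed
    ultimately show ?thesis by (auto simp: ln_powr intro: Lim_transform_eventually)
  qed
  have xpos: "\<forall>\<^sub>F n in sequentially. x n > max 1 x0 "
    using x unfolding filterlim_at_top_dense by blast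
  have upos: "\<forall>\<^sub>F n in sequentially. u n > 0"
    using u by (rule order_tendstoD) simp
  have lx: "filterlim (\<lambda>n. ln (x n)) at_top sequentially"
    by (rule filterlim_compose[OF ln_at_top x])
  have lu: "(\<lambda>n. ln (u n)) \<longlonglongrightarrow> 0"
    using tendsto_ln[OF u] by simp
  have uxat: "filterlim (\<lambda>n. u n * x n) at_top sequentially"
    by (rule filterlim_tendsto_pos_mult_at_top[OF u _ x]) simp
  have uxpos: "\<forall>\<^sub>F n in sequentially. u n * x n > max 1 x0"
    using uxat unfolding filterlim_at_top_dense by blast
  have "(\<lambda>n. exp ((k (ln (x n) + ln (u n)) - k (ln (x n))) + \<rho> * ln (u n))) \<longlonglongrightarrow> exp (0 + \<rho> * 0)"
    by (intro tendsto_intros slowly_varying_uniform[OF k_meas sv lx lu] lu)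
  moreover have "\<forall>\<^sub>F n in sequentially. exp ((k (ln (x n) + ln (u n)) - k (ln (x n))) + \<rho> * ln (u n)) = f (u n * x n) / f (x n)"
    using xpos upos uxpos
  proof eventually_elim
    case (elim n)
    have e: "ln (x n) + ln (u n) = ln (u n * x n)" using elim by (simp add: ln_mult)
    have "k (ln (x n) + ln (u n)) - k (ln (x n)) + \<rho> * ln (u n) = ln (f (u n * x n)) - ln (f (x n))"
      unfolding e k_def F_def using elim by (simp del: ln_mult_pos add: algebra_simps) (simp add: ln_mult algebra_simps)
    then show ?case using fpos0[of "x n"] fpos0[of "u n * x n"] elim by (simp add: exp_diff)
  qed
  ultimately show ?thesis by (auto intro: Lim_transform_eventually)
qed

lemma regularly_varying_comp:
  fixes f :: "real \<Rightarrow> real" and a b :: "real \<Rightarrow> real"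
  assumes rv: "regularly_varying f"
    and a: "filterlim a at_top at_top" and ab: "((\<lambda>s. b s / a s) \<longlongrightarrow> 1) at_top"
  shows "((\<lambda>s. f (b s) / f (a s)) \<longlongrightarrow> 1) at_top"
proof (rule tendsto_at_topI_sequentially)
  fix s :: "nat \<Rightarrow> real" assume s: "filterlim s at_top sequentially"
  have a': "filterlim (\<lambda>n. a (s n)) at_top sequentially" by (rule filterlim_compose[OF a s])
  have "(\<lambda>n. f (b (s n) / a (s n) * a (s n)) / f (a (s n))) \<longlonglongrightarrow> 1"
    by (rule regularly_varying_uniform[OF rv a' filterlim_compose[OF ab s]])
  moreover have "\<forall>\<^sub>F n in sequentially. a (s n) > 0"
    using a' unfolding filterlim_at_top_dense by blast
  ultimately show "(\<lambda>n. f (b (s n)) / f (a (s n))) \<longlonglongrightarrow> 1"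
    by (auto elim!: Lim_transform_eventually eventually_mono)
qed

text \<open>Makes \<open>f (ln r)\<close> negligible against every power of \<open>r\<close>. This
  gives the divergence of \<open>g\<close> and the leading term \<open>ln (ln s) / \<alpha>\<close>
  of \<open>ln (\<phi> s)\<close>.\<close>

lemma regularly_varying_ln_over:
  fixes f :: "real \<Rightarrow> real"
  assumes rv: "regularly_varying f"
  shows "((\<lambda>x. ln (f x) / x) \<longlongrightarrow> 0) at_top"
proof -
  obtain x0 where fpos0: "\<And>x. x \<ge> x0 \<Longrightarrow> 0 < f x"
    using rv unfolding regularly_varying_def by blast
  text \<open>Shifting by at most one unit changes \<open>ln f\<close> by less than \<open>\<epsilon>\<close>, so \<open>ln f\<close> grows by at most
    \<open>\<epsilon>\<close> per unit.\<close>
  have unif: "\<exists>N. \<forall>x\<ge>N. \<forall>h\<in>{0..1}. \<bar>ln (f (x + h)) - ln (f x)\<bar> < e" if "e > 0" for e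
  proof (rule ccontr)
    assume "\<not> ?thesis"
    then have "\<forall>n::nat. \<exists>x h. x \<ge> real n \<and> h \<in> {0..1} \<and> \<not> \<bar>ln (f (x + h)) - ln (f x)\<bar> < e"
      by blast
    then obtain x h where xh: "\<And>n::nat. x n \<ge> real n" "\<And>n. h n \<in> {0..1}"
      "\<And>n. \<not> \<bar>ln (f (x n + h n)) - ln (f (x n))\<bar> < e" by metis
    have x: "filterlim x at_top sequentially"
      by (rule filterlim_at_top_mono[OF filterlim_real_sequentially]) (use xh(1) in auto)
    have xpos: "\<forall>\<^sub>F n in sequentially. x n > max 1 x0"
      using x unfolding filterlim_at_top_dense by blast
    have "(\<lambda>n. h n / x n) \<longlonglongrightarrow> 0"
    proof (rule Lim_null_comparison)
      show "\<forall>\<^sub>F n in sequentially. norm (h n / x n) \<le> 1 / x n"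
        using xpos by eventually_elim (use xh(2) in \<open>auto simp: field_simps\<close>)
      show "(\<lambda>n. 1 / x n) \<longlonglongrightarrow> 0"
        using filterlim_compose[OF tendsto_inverse_0_at_top x] tendsto_inverse_0_at_top[OF x]
        by (simp add: inverse_eq_divide)
    qed
    then have "(\<lambda>n. 1 + h n / x n) \<longlonglongrightarrow> 1 + 0" by (intro tendsto_intros)
    then have "(\<lambda>n. ln (f ((1 + h n / x n) * x n) / f (x n))) \<longlonglongrightarrow> ln 1"
      by (intro tendsto_ln regularly_varying_uniform[OF rv x]) auto
    moreover have "\<forall>\<^sub>F n in sequentially. ln (f ((1 + h n / x n) * x n) / f (x n)) = ln (f (x n + h n)) - ln (f (x n))"
      using xpos
    proof eventually_elim
      case (elim n)
      have "(1 + h n / x n) * x n = x n + h n" using elim by (simp add: field_simps)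
      moreover have "f (x n) > 0" "f (x n + h n) > 0" using fpos0 elim xh(2)[of n] by auto
      ultimately show ?case by (simp add: ln_div)
    qed
    ultimately have "(\<lambda>n. ln (f (x n + h n)) - ln (f (x n))) \<longlonglongrightarrow> 0"
      by (simp add: Lim_transform_eventually)
    from tendsto_rabs_zero[OF this] have "\<forall>\<^sub>F n in sequentially. \<bar>ln (f (x n + h n)) - ln (f (x n))\<bar> < e"
      using that by (rule order_tendstoD)
    then show False using xh(3) by (auto simp: eventually_sequentially)
  qed
  show ?thesis
  proof (rule tendstoI)
    fix e :: real assume "e > 0"
    obtain N where N: "\<And>x h. x \<ge> N \<Longrightarrow> h \<in> {0..1} \<Longrightarrow> \<bar>ln (f (x + h)) - ln (f x)\<bar> < e / 2"
      using unif[of "e / 2"] \<open>e > 0\<close> by (metis half_gt_zero)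
    have step: "\<bar>ln (f (N + real n)) - ln (f N)\<bar> \<le> real n * (e / 2)" for n
    proof (induction n)
      case (Suc n)
      have "\<bar>ln (f (N + real n + 1)) - ln (f (N + real n))\<bar> < e / 2" using N[of "N + real n" 1] by simp
      moreover have "N + (1 + real n) = N + real n + 1" by simp
      ultimately show ?case using Suc by (simp only: of_nat_Suc distrib_right add.commute[of _ 1])
    qed simp
    have bnd: "\<bar>ln (f x)\<bar> \<le> \<bar>ln (f N)\<bar> + (x - N + 1) * (e / 2)" if "x \<ge> N" for x
    proof -
      let ?n = "nat \<lfloor>x - N\<rfloor>"
      have n: "real ?n \<le> x - N" "x - N < real ?n + 1" using that by linarith+
      have "\<bar>ln (f (N + real ?n + (x - N - real ?n))) - ln (f (N + real ?n))\<bar> < e / 2"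
        by (rule N) (simp, use n in \<open>simp only: atLeastAtMost_iff, linarith\<close>)
      moreover have "real ?n * (e / 2) \<le> (x - N) * (e / 2)" using n \<open>e > 0\<close> by (intro mult_right_mono) auto
      moreover have "N + real ?n + (x - N - real ?n) = x" by simp
      moreover have "(x - N + 1) * (e / 2) = (x - N) * (e / 2) + e / 2" by (simp add: distrib_right)
      ultimately show ?thesis using step[of ?n] by (simp only:) linarith
    qed
    have "\<forall>\<^sub>F x in at_top. (\<bar>ln (f N)\<bar> + (x - N + 1) * (e / 2)) / x < e"
      by (rule order_tendstoD(2)[of _ "e/2"]) (real_asymp, use \<open>e > 0\<close> in auto)
    then show "\<forall>\<^sub>F x in at_top. dist (ln (f x) / x) 0 < e"
      using eventually_ge_at_top[of N] eventually_gt_at_top[of 0]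
    proof eventually_elim
      case (elim x)
      have "\<bar>ln (f x)\<bar> / x \<le> (\<bar>ln (f N)\<bar> + (x - N + 1) * (e / 2)) / x"
        using bnd[of x] elim by (intro divide_right_mono) auto
      then show ?case using elim by (simp add: dist_real_def)
    qed
  qed
qed

section \<open>The growth function, its normaliser and exponential tail bounds\<close>

locale growth_scale =
  fixes \<alpha> :: real and f :: "real \<Rightarrow> real"
  assumes \<alpha>_pos: "0 < \<alpha>" and rv: "regularly_varying f"
    and exp_mono: "mono_on {0..} (\<lambda>r. exp (r powr \<alpha> * f (ln (max r 1))))"
begin

definition g :: "real \<Rightarrow> real" where "g r = r powr \<alpha> * f (ln (max r 1))"

text \<open>The variable is \<open>s = ln t\<close>: the normaliser of the theorem is
  \<open>t powr H * \<phi> (ln t)\<close>. Asymptotically \<phi> inverts \<open>g\<close> at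
  \<open>ln s\<close>.\<close>

definition \<phi> :: "real \<Rightarrow> real" where "\<phi> s = ln s powr (1 / \<alpha>) / f (ln (ln s) / \<alpha>) powr (1 / \<alpha>)"

text \<open>Stated with the exponential instead of \<open>- ln (T r)\<close>, so that zeros of
  \<open>T\<close> need no special treatment.\<close>

definition tail_le :: "(real \<Rightarrow> real) \<Rightarrow> real \<Rightarrow> bool"
  where "tail_le T \<kappa> \<longleftrightarrow> (\<forall>\<^sub>F r in at_top. T r \<le> exp (- \<kappa> * g r))"

lemma g_mono: "0 \<le> r \<Longrightarrow> r \<le> s \<Longrightarrow> g r \<le> g s"
  using exp_mono unfolding mono_on_def g_def by (force simp: Ball_def)

lemma g_nonneg: "0 \<le> r \<Longrightarrow> 0 \<le> g r"
  using g_mono[of 0 r] by (simp add: g_def)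

lemma f_pos_ev: "\<forall>\<^sub>F x in at_top. f x > 0"
  using rv unfolding regularly_varying_def eventually_at_top_linorder by blast

lemma g_pos_ev: "\<forall>\<^sub>F r in at_top. g r > 0"
proof -
  have "\<forall>\<^sub>F r in at_top. f (ln r) > 0"
    by (rule eventually_compose_filterlim[OF f_pos_ev ln_at_top])
  with eventually_ge_at_top[of 1] show ?thesis
    by eventually_elim (auto simp: g_def max_def)
qed

lemma g_ratio:
  assumes "c > 0" shows "((\<lambda>r. g (c * r) / g r) \<longlongrightarrow> c powr \<alpha>) at_top"
proof -
  have "((\<lambda>r. ln (c * r) / ln r) \<longlongrightarrow> 1) at_top" using assms by real_asymp
  then have "((\<lambda>r. c powr \<alpha> * (f (ln (c * r)) / f (ln r))) \<longlongrightarrow> c powr \<alpha> * 1) at_top"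
    by (intro tendsto_intros regularly_varying_comp[OF rv ln_at_top])
  moreover have "\<forall>\<^sub>F r in at_top. c powr \<alpha> * (f (ln (c * r)) / f (ln r)) = g (c * r) / g r"
    using eventually_ge_at_top[of 1] eventually_ge_at_top[of "1/c"]
  proof eventually_elim
    case (elim r)
    then have "c * r \<ge> 1" using assms by (simp add: field_simps)
    then show ?case using elim assms by (simp add: g_def max_def powr_mult)
  qed
  ultimately show ?thesis by (simp add: Lim_transform_eventually)
qed

lemma g_scale_ge:
  assumes "c > 0" "b < c powr \<alpha>" shows "\<forall>\<^sub>F r in at_top. b * g r \<le> g (c * r)"
  using order_tendstoD(1)[OF g_ratio[OF assms(1)] assms(2)] g_pos_ev
  by eventually_elim (simp add: field_simps)

lemma g_scale_le:
  assumes "c > 0" "b > c powr \<alpha>" shows "\<forall>\<^sub>F r in at_top. g (c * r) \<le> b * g r"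
  using order_tendstoD(2)[OF g_ratio[OF assms(1)] assms(2)] g_pos_ev
  by eventually_elim (simp add: field_simps)

lemma g_at_top: "filterlim g at_top at_top"
proof -
  have "((\<lambda>r. ln (f (ln r)) / ln r) \<longlongrightarrow> 0) at_top"
    by (rule filterlim_compose[OF regularly_varying_ln_over[OF rv] ln_at_top])
  then have "\<forall>\<^sub>F r in at_top. ln (f (ln r)) / ln r > - (\<alpha> / 2)"
    by (rule order_tendstoD) (use \<alpha>_pos in auto)
  then have "\<forall>\<^sub>F r in at_top. r powr (\<alpha> / 2) \<le> g r"
    using eventually_gt_at_top[of 1] eventually_compose_filterlim[OF f_pos_ev ln_at_top]
  proof eventually_elim
    case (elim r)
    have "- (\<alpha> / 2) * ln r \<le> ln (f (ln r))" using elim by (simp add: field_simps)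
    then have "exp (- (\<alpha> / 2) * ln r) \<le> f (ln r)" using elim by (metis exp_le_cancel_iff exp_ln)
    then have "r powr \<alpha> * r powr (- (\<alpha> / 2)) \<le> r powr \<alpha> * f (ln r)"
      using elim by (intro mult_left_mono) (auto simp: powr_def)
    then show ?case using elim by (simp add: powr_add[symmetric] g_def max_def)
  qed
  moreover have "filterlim (\<lambda>r::real. r powr (\<alpha> / 2)) at_top at_top" using \<alpha>_pos by real_asymp
  ultimately show ?thesis by (rule filterlim_at_top_mono[rotated])
qed

text \<open>With \<open>L s = ln (ln s) / \<alpha>\<close> the identity
  \<open>\<phi> s powr \<alpha> * f (L s) = ln s\<close> holds as soon as both factors are positive.
  Since \<open>ln (f (L s))\<close> is negligible against \<open>L s\<close>, also
  \<open>ln (a * \<phi> s)\<close> is asymptotic to \<open>L s\<close>, and regular variation lets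
  the two arguments of \<open>f\<close> be exchanged.\<close>

lemma phi_asymp:
  shows phi_pos_ev: "\<forall>\<^sub>F s in at_top. \<phi> s > 0"
    and phi_at_top: "filterlim \<phi> at_top at_top"
    and g_phi: "a > 0 \<Longrightarrow> ((\<lambda>s. g (a * \<phi> s) / ln s) \<longlongrightarrow> a powr \<alpha>) at_top"
proof -
  define L where "L s = ln (ln s) / \<alpha>" for s :: real
  have L: "filterlim L at_top at_top" unfolding L_def using \<alpha>_pos by real_asymp
  have fL: "\<forall>\<^sub>F s in at_top. f (L s) > 0" by (rule eventually_compose_filterlim[OF f_pos_ev L])
  have s1: "\<forall>\<^sub>F s in at_top. ln s > (0::real)" by real_asymp
  show pos: "\<forall>\<^sub>F s in at_top. \<phi> s > 0"
    using fL s1 by eventually_elim (auto simp: \<phi>_def L_def)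
  have lnphi: "\<forall>\<^sub>F s in at_top. ln (\<phi> s) = L s - ln (f (L s)) / \<alpha>"
    using fL s1
  proof eventually_elim
    case (elim s)
    then show ?case by (simp add: \<phi>_def ln_div L_def[symmetric] ln_powr)
  qed
  have small: "((\<lambda>s. ln (f (L s)) / L s) \<longlongrightarrow> 0) at_top"
    by (rule filterlim_compose[OF regularly_varying_ln_over[OF rv] L])
  have Lpos: "\<forall>\<^sub>F s in at_top. L s > 0"
    using L unfolding filterlim_at_top_dense by blast
  have ratio: "((\<lambda>s. ln (a * \<phi> s) / L s) \<longlongrightarrow> 1) at_top" if "a > 0" for a
  proof -
    have "((\<lambda>s. ln a / L s + (1 - ln (f (L s)) / L s / \<alpha>)) \<longlongrightarrow> 0 + (1 - 0 / \<alpha>)) at_top"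
      using \<alpha>_pos by (intro tendsto_intros small tendsto_divide_0[OF tendsto_const filterlim_at_top_imp_at_infinity[OF L]]) auto
    moreover have "\<forall>\<^sub>F s in at_top. ln a / L s + (1 - ln (f (L s)) / L s / \<alpha>) = ln (a * \<phi> s) / L s"
      using lnphi Lpos pos
    proof eventually_elim
      case (elim s)
      have "ln (a * \<phi> s) = ln a + (L s - ln (f (L s)) / \<alpha>)" using elim that by (simp add: ln_mult)
      then show ?case using elim by (simp add: add_divide_distrib diff_divide_distrib)
    qed
    ultimately show ?thesis by (simp add: Lim_transform_eventually)
  qed
  have lnat: "filterlim (\<lambda>s. ln (a * \<phi> s)) at_top at_top" if "a > 0" for a
  proof -
    have "filterlim (\<lambda>s. (ln (a * \<phi> s) / L s) * L s) at_top at_top"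
      by (rule filterlim_tendsto_pos_mult_at_top[OF ratio[OF that] _ L]) simp
    then show ?thesis
      by (rule filterlim_cong[THEN iffD1, OF refl refl, rotated]) (rule eventually_mono[OF Lpos], simp)
  qed
  show "filterlim \<phi> at_top at_top"
  proof (rule filterlim_cong[THEN iffD1, OF refl refl _ filterlim_compose[OF exp_at_top lnat[of 1]]])
    show "\<forall>\<^sub>F s in at_top. exp (ln (1 * \<phi> s)) = \<phi> s" using pos by eventually_elim simp
  qed simp
  show "((\<lambda>s. g (a * \<phi> s) / ln s) \<longlongrightarrow> a powr \<alpha>) at_top" if a: "a > 0"
  proof -
    have "((\<lambda>s. a powr \<alpha> * (f (ln (a * \<phi> s)) / f (L s))) \<longlongrightarrow> a powr \<alpha> * 1) at_top"
      by (intro tendsto_intros regularly_varying_comp[OF rv L] ratio a)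
    moreover have "\<forall>\<^sub>F s in at_top. ln (a * \<phi> s) > 0"
      using lnat[OF a] unfolding filterlim_at_top_dense by blast
    then have "\<forall>\<^sub>F s in at_top. a powr \<alpha> * (f (ln (a * \<phi> s)) / f (L s)) = g (a * \<phi> s) / ln s"
      using pos fL s1
    proof eventually_elim
      case (elim s)
      have "a * \<phi> s > 0" using a elim by simp
      then have "a * \<phi> s > 1" using elim(1) by (simp add: ln_gt_zero_iff)
      moreover have "\<phi> s powr \<alpha> = ln s / f (L s)"
        using elim \<alpha>_pos by (simp add: \<phi>_def powr_divide powr_powr L_def)
      ultimately show ?case
        using elim a by (simp add: g_def max_def powr_mult)
    qed
    ultimately show ?thesis by (simp add: Lim_transform_eventually)
  qed
qed

text \<open>Along \<open>q ^ j * r\<close> the function \<open>g\<close> grows at least like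
  \<open>\<beta> ^ j\<close> with \<beta> > 1. Bernoulli's inequality weakens this to linear growth
  in \<open>j\<close>, so the sum is dominated by a geometric series, whose ratio \<open>x\<close>
  is at most 1/2 once \<open>g r\<close> is large.\<close>

lemma geometric_tail_sum:
  assumes "\<kappa> > 0" "q > 1"
  shows "\<forall>\<^sub>F r in at_top. \<forall>J. (\<Sum>j<J. exp (- \<kappa> * g (q ^ j * r))) \<le> 2 * exp (- \<kappa> * g r)"
proof -
  \<comment> \<open>Any number strictly between 1 and \<open>q powr \<alpha>\<close>, the limit of
    \<open>g (q * r) / g r\<close>, would do.\<close>
  define \<beta> where "\<beta> = q powr (\<alpha> / 2)"
  have \<beta>: "\<beta> > 1" "\<beta> < q powr \<alpha>" using assms \<alpha>_pos by (auto simp: \<beta>_def)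
  obtain R where R: "\<And>r. r \<ge> R \<Longrightarrow> \<beta> * g r \<le> g (q * r)"
    using g_scale_ge[of q \<beta>] \<beta> assms(2) unfolding eventually_at_top_linorder by auto
  have "\<forall>\<^sub>F r in at_top. g r > ln 2 / (\<kappa> * (\<beta> - 1))"
    using g_at_top unfolding filterlim_at_top_dense by blast
  then show ?thesis
    using eventually_ge_at_top[of R] eventually_gt_at_top[of 0]
  proof eventually_elim
    case (elim r)
    have grow: "\<beta> ^ j * g r \<le> g (q ^ j * r)" for j
    proof (induction j)
      case (Suc j)
      have "1 * r \<le> q ^ j * r" using assms elim by (intro mult_right_mono) auto
      then have "\<beta> * g (q ^ j * r) \<le> g (q * (q ^ j * r))" using elim \<open>1 * r \<le> q ^ j * r\<close> by (intro R) linarith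
      moreover have "\<beta> * (\<beta> ^ j * g r) \<le> \<beta> * g (q ^ j * r)" using Suc \<beta> by simp
      ultimately show ?case by (simp add: mult.assoc)
    qed simp
    define x where "x = exp (- \<kappa> * (\<beta> - 1) * g r)"
    have "\<kappa> * (\<beta> - 1) * g r \<ge> ln 2" using elim assms \<beta> by (simp add: field_simps)
    then have "x \<le> exp (- ln 2)" unfolding x_def by (subst exp_le_cancel_iff) simp
    then have x: "0 < x" "x \<le> 1 / 2" by (auto simp: x_def exp_minus inverse_eq_divide)
    have g0: "g r \<ge> 0" using elim by (intro g_nonneg) auto
    have summand: "exp (- \<kappa> * g (q ^ j * r)) \<le> exp (- \<kappa> * g r) * x ^ j" for j
    proof -
      have "1 + real j * (\<beta> - 1) \<le> \<beta> ^ j" using Bernoulli_inequality[of "\<beta> - 1" j] \<beta> by simp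
      then have "(1 + real j * (\<beta> - 1)) * g r \<le> g (q ^ j * r)"
        using grow[of j] g0 by (meson mult_right_mono order_trans)
      then have "\<kappa> * ((1 + real j * (\<beta> - 1)) * g r) \<le> \<kappa> * g (q ^ j * r)" using assms by simp
      then show ?thesis
        unfolding x_def exp_of_nat_mult[symmetric] exp_add[symmetric]
        by (subst exp_le_cancel_iff) (simp add: algebra_simps)
    qed
    show ?case
    proof
      fix J
      have "(\<Sum>j<J. exp (- \<kappa> * g (q ^ j * r))) \<le> exp (- \<kappa> * g r) * (\<Sum>j<J. x ^ j)"
        unfolding sum_distrib_left by (intro sum_mono summand)
      also have "(\<Sum>j<J. x ^ j) \<le> 2"
      proof -
        have "(\<Sum>j<J. x ^ j) \<le> (\<Sum>j<J. (1/2) ^ j)" using x by (intro sum_mono power_mono) auto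
        also have "\<dots> \<le> (\<Sum>j. (1/2::real) ^ j)" by (intro sum_le_suminf) auto
        also have "\<dots> = 2" by (simp add: suminf_geometric)
        finally show ?thesis .
      qed
      finally show "(\<Sum>j<J. exp (- \<kappa> * g (q ^ j * r))) \<le> 2 * exp (- \<kappa> * g r)" by simp
    qed
  qed
qed

text \<open>The constant \<open>A\<close>, the rescaling \<open>b\<close> and the shift \<open>z\<close> are all absorbed by an arbitrarily
  small loss in the exponent.\<close>
lemma tail_le_transfer:
  assumes T: "tail_le T \<kappa>" and "0 < \<kappa>" "0 < b" and \<kappa>': "\<kappa>' < \<kappa> * b powr \<alpha>" and A: "A \<ge> 0"
    and le: "\<forall>\<^sub>F r in at_top. T' r \<le> A * T (b * r - z)"
  shows "tail_le T' \<kappa>'"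
proof -
  \<comment> \<open>Two margins are taken: \<open>b'\<close> below \<open>b\<close> makes room for
    the shift \<open>z\<close>, and \<open>\<kappa>2\<close> above \<kappa>' makes room for the
    factor \<open>A\<close>.\<close>
  obtain b' where b': "0 < b'" "b' < b" "\<kappa>' < \<kappa> * b' powr \<alpha>"
  proof -
    have "((\<lambda>x. \<kappa> * x powr \<alpha>) \<longlongrightarrow> \<kappa> * b powr \<alpha>) (at_left b)"
      using assms by (intro tendsto_intros) auto
    then have "\<forall>\<^sub>F x in at_left b. \<kappa> * x powr \<alpha> > \<kappa>'" using \<kappa>' by (rule order_tendstoD)
    moreover have "\<forall>\<^sub>F x in at_left b. 0 < x \<and> x < b"
      using assms by (auto simp: eventually_at_left_field)
    ultimately have "\<forall>\<^sub>F x in at_left b. \<kappa> * x powr \<alpha> > \<kappa>' \<and> 0 < x \<and> x < b" by eventually_elim simp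
    then obtain x where "\<kappa> * x powr \<alpha> > \<kappa>' \<and> 0 < x \<and> x < b"
      using eventually_happens'[OF trivial_limit_at_left_real] by blast
    then show ?thesis using that by blast
  qed
  obtain \<kappa>2 where \<kappa>2: "\<kappa>' < \<kappa>2" "\<kappa>2 < \<kappa> * b' powr \<alpha>" using b' dense by blast
  have shift: "filterlim (\<lambda>r. b * r - z) at_top at_top" using \<open>0 < b\<close> by real_asymp
  have 1: "\<forall>\<^sub>F r in at_top. T (b * r - z) \<le> exp (- \<kappa> * g (b * r - z))"
    using eventually_compose_filterlim[OF T[unfolded tail_le_def] shift] .
  have 2: "\<forall>\<^sub>F r in at_top. b' * r \<le> b * r - z"
    using eventually_ge_at_top[of "z / (b - b')"]
    by eventually_elim (use b' in \<open>simp add: field_simps\<close>)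
  have 3: "\<forall>\<^sub>F r in at_top. (\<kappa>2 / \<kappa>) * g r \<le> g (b' * r)"
    using b' \<kappa>2 assms by (intro g_scale_ge) (auto simp: field_simps)
  have 4: "\<forall>\<^sub>F r in at_top. g r > ln (A + 1) / (\<kappa>2 - \<kappa>')"
    using g_at_top unfolding filterlim_at_top_dense by blast
  show ?thesis unfolding tail_le_def
    using le 1 2 3 4 eventually_gt_at_top[of 0]
  proof eventually_elim
    case (elim r)
    have "g (b' * r) \<le> g (b * r - z)" using elim b' by (intro g_mono) auto
    then have "\<kappa>2 / \<kappa> * g r \<le> g (b * r - z)" using elim by simp
    then have "\<kappa>2 * g r \<le> \<kappa> * g (b * r - z)" using \<open>0 < \<kappa>\<close> by (simp add: field_simps)
    then have "exp (- \<kappa> * g (b * r - z)) \<le> exp (- \<kappa>2 * g r)" by simp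
    then have "T' r \<le> A * exp (- \<kappa>2 * g r)" using elim A by (meson mult_left_mono order_trans)
    also have "\<dots> \<le> exp (ln (A + 1)) * exp (- \<kappa>2 * g r)" using A by (intro mult_right_mono) auto
    also have "\<dots> = exp (ln (A + 1) - \<kappa>2 * g r)" by (simp add: exp_diff exp_minus field_simps)
    also have "ln (A + 1) - \<kappa>2 * g r \<le> - \<kappa>' * g r"
      using elim \<kappa>2 by (simp add: field_simps)
    finally show ?case by simp
  qed
qed

text \<open>Converts a given loss of exponent into an admissible dilation. The factor
  \<open>b\<close> then serves as precision of a net of directions or as inverse ratio of
  shells.\<close>

lemma shrink_factor:
  assumes "0 < \<kappa>'" "\<kappa>' < \<kappa>"
  obtains b where "0 < b" "b < 1" "\<kappa>' < \<kappa> * b powr \<alpha>"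
proof -
  define t where "t = (\<kappa>' / \<kappa> + 1) / 2"
  have t: "0 < t" "t < 1" "\<kappa>' < \<kappa> * t" using assms by (auto simp: t_def field_simps)
  show ?thesis
  proof (rule that[of "t powr (1 / \<alpha>)"])
    show "0 < t powr (1 / \<alpha>)" using t by simp
    show "t powr (1 / \<alpha>) < 1" using t \<alpha>_pos powr_less_mono2[of "1/\<alpha>" t 1] by simp
    show "\<kappa>' < \<kappa> * (t powr (1 / \<alpha>)) powr \<alpha>" using t \<alpha>_pos by (simp add: powr_powr)
  qed
qed

end

section \<open>Sums of independent jumps\<close>

text \<open>The measure \<open>a M + b N\<close>, from which the jump intensities and the laws of
  single summands are built. Coefficients enter through \<open>ennreal\<close>, so a negative one
  counts as 0; this is why the integral formula asks for signs.\<close>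

definition comb_measure :: "real \<Rightarrow> 'a measure \<Rightarrow> real \<Rightarrow> 'a measure \<Rightarrow> 'a measure"
  where "comb_measure a M b N =
    measure_of (space M) (sets M) (\<lambda>A. ennreal a * emeasure M A + ennreal b * emeasure N A)"

lemma space_comb_measure [simp]: "space (comb_measure a M b N) = space M"
  and sets_comb_measure [simp, measurable_cong]: "sets (comb_measure a M b N) = sets M"
  by (simp_all add: comb_measure_def)

lemma emeasure_comb_measure:
  assumes [simp]: "sets N = sets M"
  shows "emeasure (comb_measure a M b N) A = ennreal a * emeasure M A + ennreal b * emeasure N A"
proof (cases "A \<in> sets M")
  case True
  show ?thesis unfolding comb_measure_def
  proof (rule emeasure_measure_of_sigma[OF sets.sigma_algebra_axioms _ _ True])
    show "positive (sets M) (\<lambda>A. ennreal a * emeasure M A + ennreal b * emeasure N A)"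
      by (simp add: positive_def)
    show "countably_additive (sets M) (\<lambda>A. ennreal a * emeasure M A + ennreal b * emeasure N A)"
    proof (rule countably_additiveI)
      fix F :: "nat \<Rightarrow> 'a set" assume F: "range F \<subseteq> sets M" "disjoint_family F" "\<Union> (range F) \<in> sets M"
      have "(\<Sum>i. ennreal a * emeasure M (F i) + ennreal b * emeasure N (F i))
          = (\<Sum>i. ennreal a * emeasure M (F i)) + (\<Sum>i. ennreal b * emeasure N (F i))"
        by (rule suminf_add[symmetric]) auto
      also have "\<dots> = ennreal a * emeasure M (\<Union> (range F)) + ennreal b * emeasure N (\<Union> (range F))"
        using F by (simp add: suminf_emeasure)
      finally show "(\<Sum>i. ennreal a * emeasure M (F i) + ennreal b * emeasure N (F i))
          = ennreal a * emeasure M (\<Union> (range F)) + ennreal b * emeasure N (\<Union> (range F))" .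
    qed
  qed
qed (simp add: emeasure_notin_sets)

lemma nn_integral_comb_measure:
  assumes [simp]: "sets N = sets M" and "f \<in> borel_measurable M"
  shows "(\<integral>\<^sup>+x. f x \<partial>comb_measure a M b N) = ennreal a * (\<integral>\<^sup>+x. f x \<partial>M) + ennreal b * (\<integral>\<^sup>+x. f x \<partial>N)"
  using assms(2)
proof (induction rule: borel_measurable_induct)
  case (cong f g)
  have sp: "space N = space M" by (rule sets_eq_imp_space_eq) simp
  have "(\<integral>\<^sup>+x. f x \<partial>K) = (\<integral>\<^sup>+x. g x \<partial>K)" if "space K = space M" for K :: "'a measure"
    using cong(3) that by (intro nn_integral_cong) auto
  from this[of M] this[of N] this[of "comb_measure a M b N"] show ?case using cong(4) sp by simp
next
  case (set A)
  then show ?case by (simp add: emeasure_comb_measure)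
next
  case (mult u c)
  have [measurable]: "u \<in> borel_measurable M" "u \<in> borel_measurable N" "u \<in> borel_measurable (comb_measure a M b N)"
    using mult(2) by (simp_all cong: measurable_cong_sets)
  show ?case using mult by (simp add: nn_integral_cmult distrib_left mult.left_commute)
next
  case (add u v)
  have [measurable]: "u \<in> borel_measurable N" "u \<in> borel_measurable (comb_measure a M b N)"
    "v \<in> borel_measurable N" "v \<in> borel_measurable (comb_measure a M b N)"
    using add.hyps by (simp_all cong: measurable_cong_sets)
  show ?case using add by (simp add: nn_integral_add distrib_left ac_simps)
next
  case (seq U)
  have [measurable]: "U i \<in> borel_measurable N" "U i \<in> borel_measurable (comb_measure a M b N)" for i
    using seq(1)[of i] by (simp_all cong: measurable_cong_sets)
  have incU: "incseq U" using seq by blast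
  have conv: "(\<lambda>i. \<integral>\<^sup>+x. U i x \<partial>K) \<longlonglongrightarrow> (\<integral>\<^sup>+x. (SUP i. U i) x \<partial>K)" if K: "sets K = sets M" for K :: "'a measure"
  proof -
    have [measurable]: "U i \<in> borel_measurable K" for i using seq(1)[of i] K by (simp cong: measurable_cong_sets)
    have inc: "incseq (\<lambda>i. \<integral>\<^sup>+x. U i x \<partial>K)"
      using incU by (auto simp: incseq_def le_fun_def intro!: nn_integral_mono)
    have "(\<integral>\<^sup>+x. (SUP i. U i) x \<partial>K) = (SUP i. \<integral>\<^sup>+x. U i x \<partial>K)"
      unfolding SUP_apply using incU by (intro nn_integral_monotone_convergence_SUP) auto
    with LIMSEQ_SUP[OF inc] show ?thesis by simp
  qed
  have "(\<lambda>i. ennreal a * (\<integral>\<^sup>+x. U i x \<partial>M) + ennreal b * (\<integral>\<^sup>+x. U i x \<partial>N)) \<longlonglongrightarrow>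
     ennreal a * (\<integral>\<^sup>+x. (SUP i. U i) x \<partial>M) + ennreal b * (\<integral>\<^sup>+x. (SUP i. U i) x \<partial>N)"
    by (intro tendsto_add ennreal_tendsto_cmult conv) auto
  moreover have "(\<lambda>i. ennreal a * (\<integral>\<^sup>+x. U i x \<partial>M) + ennreal b * (\<integral>\<^sup>+x. U i x \<partial>N)) \<longlonglongrightarrow>
      (\<integral>\<^sup>+x. (SUP i. U i) x \<partial>comb_measure a M b N)"
    using conv[of "comb_measure a M b N"] seq.IH by simp
  ultimately show ?case using LIMSEQ_unique by blast
qed

lemma
  fixes f :: "'a \<Rightarrow> 'b::{banach, second_countable_topology}"
  assumes [simp]: "sets N = sets M" and f: "integrable M f" "integrable N f" and ab: "a \<ge> 0" "b \<ge> 0"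
  shows integrable_comb_measure: "integrable (comb_measure a M b N) f"
    and integral_comb_measure: "integral\<^sup>L (comb_measure a M b N) f = a *\<^sub>R integral\<^sup>L M f + b *\<^sub>R integral\<^sup>L N f"
proof -
  have int: "integrable (comb_measure a M b N) f"
    if "integrable M f" "integrable N f" "a \<ge> 0" "b \<ge> 0" for f :: "'a \<Rightarrow> 'b" and a b
  proof -
    have [measurable]: "f \<in> borel_measurable M" using that by auto
    then have "f \<in> borel_measurable (comb_measure a M b N)" by (simp cong: measurable_cong_sets)
    then show ?thesis using that
      by (auto simp: integrable_iff_bounded nn_integral_comb_measure ennreal_mult_less_top)
  qed
  \<comment> \<open>The induction for the integral formula runs over the combination with both
    coefficients 1: integrability there is equivalent to integrability under \<open>M\<close> and
    under \<open>N\<close>, which would fail for \<open>a = 0\<close> or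
    \<open>b = 0\<close>.\<close>
  have iff: "integrable (comb_measure 1 M 1 N) f \<longleftrightarrow> integrable M f \<and> integrable N f" for f :: "'a \<Rightarrow> 'b"
  proof
    assume h: "integrable (comb_measure 1 M 1 N) f"
    then have m: "f \<in> borel_measurable (comb_measure 1 M 1 N)" by auto
    then have m1: "f \<in> borel_measurable M" and m2: "f \<in> borel_measurable N" by (simp_all cong: measurable_cong_sets)
    then show "integrable M f \<and> integrable N f" using h m
      by (auto simp: integrable_iff_bounded nn_integral_comb_measure)
  qed (use int in auto)
  show "integrable (comb_measure a M b N) f" by (rule int) fact+
  have sp: "space N = space M" by (rule sets_eq_imp_space_eq) simp
  have "integrable (comb_measure 1 M 1 N) f" using f iff by simp
  then show "integral\<^sup>L (comb_measure a M b N) f = a *\<^sub>R integral\<^sup>L M f + b *\<^sub>R integral\<^sup>L N f"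
  proof (induction rule: integrable_induct)
    case (base A c)
    then have fin: "emeasure M A < \<infinity>" "emeasure N A < \<infinity>"
      by (auto simp: emeasure_comb_measure)
    then have "measure (comb_measure a M b N) A = a * measure M A + b * measure N A"
      using ab by (simp add: measure_def emeasure_comb_measure enn2real_plus ennreal_mult_less_top enn2real_mult)
    then show ?case using base fin sp ab
      by (simp add: emeasure_comb_measure ennreal_mult_less_top scaleR_add_left)
  next
    case (add f g)
    have fg: "integrable M f" "integrable N f" "integrable M g" "integrable N g" using add iff by blast+
    moreover note int[OF fg(1,2) ab] int[OF fg(3,4) ab]
    ultimately show ?case using add(3,4) by (simp add: scaleR_add_right)
  next
    case (lim f s)
    have fi: "integrable M f" "integrable N f" using lim iff by blast+
    have si: "integrable M (s i)" "integrable N (s i)" for i using lim(1)[of i] iff by blast+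
    have conv: "(\<lambda>i. integral\<^sup>L K (s i)) \<longlonglongrightarrow> integral\<^sup>L K f"
      if K: "sets K = sets M" "integrable K f" "\<And>i. integrable K (s i)" for K :: "'a measure"
    proof (rule integral_dominated_convergence[where w = "\<lambda>x. 2 * norm (f x)"])
      have "space K = space M" using K(1) by (rule sets_eq_imp_space_eq)
      with lim(2,3) show "AE x in K. (\<lambda>i. s i x) \<longlonglongrightarrow> f x" "\<And>i. AE x in K. norm (s i x) \<le> 2 * norm (f x)"
        by (auto intro!: AE_I2)
    qed (use K in auto)
    have "(\<lambda>i. a *\<^sub>R integral\<^sup>L M (s i) + b *\<^sub>R integral\<^sup>L N (s i)) \<longlonglongrightarrow> a *\<^sub>R integral\<^sup>L M f + b *\<^sub>R integral\<^sup>L N f"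
      using fi si by (intro tendsto_intros conv) auto
    moreover have "(\<lambda>i. a *\<^sub>R integral\<^sup>L M (s i) + b *\<^sub>R integral\<^sup>L N (s i)) \<longlonglongrightarrow> integral\<^sup>L (comb_measure a M b N) f"
      using conv[of "comb_measure a M b N"] int[OF fi ab] int[OF si ab] lim(5) by simp
    ultimately show ?case using LIMSEQ_unique by blast
  qed
qed

section \<open>Submultiplicative moments of sums of independent variables\<close>

lemma submultiplicative_sum:
  fixes H :: "real \<Rightarrow> real"
  assumes H0: "H 0 = 1" and Hpos: "\<And>x. x \<ge> 0 \<Longrightarrow> H x \<ge> 0" and c: "c \<ge> 0"
    and sub: "\<And>x y. x \<ge> 0 \<Longrightarrow> y \<ge> 0 \<Longrightarrow> H (x + y) \<le> c * H x * H y"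
    and "finite I" "\<And>i. i \<in> I \<Longrightarrow> y i \<ge> 0"
  shows "H (\<Sum>i\<in>I. y i) \<le> (\<Prod>i\<in>I. c * H (y i))"
  using assms(5,6)
proof (induction rule: finite_induct)
  case (insert i I)
  have "H (y i + sum y I) \<le> c * H (y i) * H (sum y I)"
    using insert by (intro sub sum_nonneg) auto
  also have "\<dots> \<le> c * H (y i) * (\<Prod>i\<in>I. c * H (y i))"
    using insert c Hpos by (intro mult_left_mono) auto
  finally show ?case using insert by simp
qed (simp add: H0)

text \<open>\<open>s = 1\<close> and \<open>s = -1\<close> select the two exponentials that together dominate \<open>exp (\<beta> * \<bar>x\<bar>)\<close>.\<close>
definition step_weight :: "(real \<Rightarrow> real) \<Rightarrow> real \<Rightarrow> real \<Rightarrow> real \<Rightarrow> real \<Rightarrow> real"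
  where "step_weight H c \<beta> s x = (if \<bar>x\<bar> \<le> 1 then exp (s * \<beta> * x) else c * H \<bar>x\<bar>)"

text \<open>Using submultiplicativity on all summands would cost \<open>c\<close> to the power of
  their number. The summands of size at most 1 are therefore added up first and their total is
  treated by the exponential bound on \<open>H\<close>, which turns sums into products; only the
  larger ones contribute a factor \<open>c\<close>. In particular a summand 0 has weight 1.\<close>

lemma submultiplicative_sum_split:
  fixes H :: "real \<Rightarrow> real"
  assumes H0: "H 0 = 1" and Hmono: "\<And>x y. 0 \<le> x \<Longrightarrow> x \<le> y \<Longrightarrow> H x \<le> H y" and c: "c \<ge> 0"
    and sub: "\<And>x y. x \<ge> 0 \<Longrightarrow> y \<ge> 0 \<Longrightarrow> H (x + y) \<le> c * H x * H y"
    and C: "C \<ge> 0" and \<beta>: "\<beta> \<ge> 0" and exp_bound: "\<And>x. x \<ge> 0 \<Longrightarrow> H x \<le> C * exp (\<beta> * x)"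
    and I: "finite I"
  shows "H \<bar>b + (\<Sum>i\<in>I. x i)\<bar> \<le> c * C * (exp (\<beta> * b) * (\<Prod>i\<in>I. step_weight H c \<beta> 1 (x i))
                                + exp (- \<beta> * b) * (\<Prod>i\<in>I. step_weight H c \<beta> (-1) (x i)))"
proof -
  have Hpos: "H x \<ge> 0" if "x \<ge> 0" for x using Hmono[of 0 x] H0 that by simp
  define S where "S = {i\<in>I. \<bar>x i\<bar> \<le> 1}"
  define B where "B = {i\<in>I. \<not> \<bar>x i\<bar> \<le> 1}"
  define s where "s = b + (\<Sum>i\<in>S. x i)"
  have fin: "finite S" "finite B" and disj: "S \<inter> B = {}" and un: "S \<union> B = I" using I by (auto simp: S_def B_def)
  have sumI: "(\<Sum>i\<in>I. x i) = (\<Sum>i\<in>S. x i) + (\<Sum>i\<in>B. x i)"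
    using sum.union_disjoint[OF fin disj, of x] un by simp
  have prodI: "exp (t * \<beta> * b) * (\<Prod>i\<in>I. step_weight H c \<beta> t (x i))
      = exp (t * \<beta> * s) * (\<Prod>i\<in>B. c * H \<bar>x i\<bar>)" for t
  proof -
    have "(\<Prod>i\<in>I. step_weight H c \<beta> t (x i)) = (\<Prod>i\<in>S. step_weight H c \<beta> t (x i)) * (\<Prod>i\<in>B. step_weight H c \<beta> t (x i))"
      using prod.union_disjoint[OF fin disj, of "\<lambda>i. step_weight H c \<beta> t (x i)"] un by simp
    also have "(\<Prod>i\<in>S. step_weight H c \<beta> t (x i)) = (\<Prod>i\<in>S. exp (t * \<beta> * x i))"
      by (intro prod.cong) (auto simp: S_def step_weight_def)
    also have "\<dots> = exp (t * \<beta> * (\<Sum>i\<in>S. x i))" using fin by (simp add: exp_sum sum_distrib_left)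
    also have "(\<Prod>i\<in>B. step_weight H c \<beta> t (x i)) = (\<Prod>i\<in>B. c * H \<bar>x i\<bar>)"
      by (intro prod.cong) (auto simp: B_def step_weight_def)
    finally show ?thesis by (simp add: s_def distrib_left exp_add)
  qed
  let ?P = "\<Prod>i\<in>B. c * H \<bar>x i\<bar>"
  have P0: "?P \<ge> 0" by (intro prod_nonneg) (use c Hpos in auto)
  have "\<bar>b + (\<Sum>i\<in>I. x i)\<bar> \<le> \<bar>s\<bar> + (\<Sum>i\<in>B. \<bar>x i\<bar>)"
    unfolding sumI s_def using sum_abs[of x B] by linarith
  then have "H \<bar>b + (\<Sum>i\<in>I. x i)\<bar> \<le> H (\<bar>s\<bar> + (\<Sum>i\<in>B. \<bar>x i\<bar>))" by (intro Hmono) auto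
  also have "\<dots> \<le> c * H \<bar>s\<bar> * H (\<Sum>i\<in>B. \<bar>x i\<bar>)" by (intro sub) (auto intro: sum_nonneg)
  also have "\<dots> \<le> c * H \<bar>s\<bar> * ?P"
    using c Hpos by (intro mult_left_mono submultiplicative_sum[of H c] sub fin H0) auto
  also have "\<dots> \<le> c * (C * (exp (\<beta> * s) + exp (- \<beta> * s))) * ?P"
  proof (intro mult_right_mono mult_left_mono P0 c)
    have "H \<bar>s\<bar> \<le> C * exp (\<beta> * \<bar>s\<bar>)" by (rule exp_bound) simp
    also have "exp (\<beta> * \<bar>s\<bar>) \<le> exp (\<beta> * s) + exp (- \<beta> * s)" by (cases "s \<ge> 0") auto
    finally show "H \<bar>s\<bar> \<le> C * (exp (\<beta> * s) + exp (- \<beta> * s))" using C by (simp add: mult_left_mono)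
  qed
  also have "\<dots> = c * C * (exp (1 * \<beta> * s) * ?P + exp (- 1 * \<beta> * s) * ?P)" by (simp add: algebra_simps)
  also have "\<dots> = c * C * (exp (1 * \<beta> * b) * (\<Prod>i\<in>I. step_weight H c \<beta> 1 (x i))
                                + exp (- 1 * \<beta> * b) * (\<Prod>i\<in>I. step_weight H c \<beta> (-1) (x i)))"
    unfolding prodI ..
  finally show ?thesis by simp
qed

lemma (in prob_space) char_iid_sum:
  fixes X :: "'i \<Rightarrow> 'a \<Rightarrow> real"
  assumes ind: "indep_vars (\<lambda>_. borel) X J" and law: "\<And>i. i \<in> J \<Longrightarrow> distr M borel (X i) = p"
  shows "char (distr M borel (\<lambda>\<omega>. b + (\<Sum>i\<in>J. X i \<omega>))) t = iexp (t * b) * char p t ^ card J"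
proof -
  have [measurable]: "\<And>i. i \<in> J \<Longrightarrow> X i \<in> borel_measurable M"
    using ind by (auto simp: indep_vars_def)
  have "char (distr M borel (\<lambda>\<omega>. b + (\<Sum>i\<in>J. X i \<omega>))) t = (CLINT \<omega>|M. iexp (t * b) * iexp (t * (\<Sum>i\<in>J. X i \<omega>)))"
    by (subst char_def, subst integral_distr) (auto simp: distrib_left exp_add)
  also have "\<dots> = iexp (t * b) * (CLINT \<omega>|M. iexp (t * (\<Sum>i\<in>J. X i \<omega>)))" by simp
  also have "(CLINT \<omega>|M. iexp (t * (\<Sum>i\<in>J. X i \<omega>))) = char (distr M borel (\<lambda>\<omega>. \<Sum>i\<in>J. X i \<omega>)) t"
    by (subst char_def, subst integral_distr) auto
  also have "\<dots> = (\<Prod>i\<in>J. char (distr M borel (X i)) t)" by (rule char_distr_sum[OF ind])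
  also have "\<dots> = char p t ^ card J" using law by simp
  finally show ?thesis .
qed

definition array_law :: "real measure \<Rightarrow> real \<Rightarrow> nat \<Rightarrow> real measure"
  where "array_law p b n = distr (\<Pi>\<^sub>M i\<in>{..<n}. p) borel (\<lambda>x. b + (\<Sum>i<n. x i))"

context real_distribution
begin

lemma array_measurable:
  assumes "i \<in> I" shows "(\<lambda>x. x i) \<in> borel_measurable (\<Pi>\<^sub>M i\<in>I. M)"
  using measurable_component_singleton[OF assms, of "\<lambda>_. M"] by (simp cong: measurable_cong_sets)

lemma array_space: "prob_space (\<Pi>\<^sub>M i\<in>I. M)"
  by (rule prob_space_PiM) (rule prob_space_axioms)

lemma array_component:
  assumes "i \<in> I" shows "distr (\<Pi>\<^sub>M i\<in>I. M) borel (\<lambda>x. x i) = M"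
proof -
  have "distr (\<Pi>\<^sub>M i\<in>I. M) borel (\<lambda>x. x i) = distr (\<Pi>\<^sub>M i\<in>I. M) M (\<lambda>x. x i)"
    by (rule distr_cong) auto
  also have "\<dots> = M" using assms by (intro distr_PiM_component prob_space_axioms)
  finally show ?thesis .
qed

lemma array_indep: "prob_space.indep_vars (\<Pi>\<^sub>M i\<in>I. M) (\<lambda>_. borel) (\<lambda>i x. x i) I"
proof (cases "I = {}")
  case False
  interpret P: prob_space "\<Pi>\<^sub>M i\<in>I. M" by (rule array_space)
  have "distr (\<Pi>\<^sub>M i\<in>I. M) (\<Pi>\<^sub>M i\<in>I. borel) (\<lambda>x. \<lambda>i\<in>I. x i) = distr (\<Pi>\<^sub>M i\<in>I. M) (\<Pi>\<^sub>M i\<in>I. M) (\<lambda>x. x)"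
    by (rule distr_cong) (auto simp: space_PiM PiE_restrict cong: sets_PiM_cong)
  also have "\<dots> = (\<Pi>\<^sub>M i\<in>I. M)" by simp
  also have "\<dots> = (\<Pi>\<^sub>M i\<in>I. distr (\<Pi>\<^sub>M i\<in>I. M) borel (\<lambda>x. x i))"
    by (rule PiM_cong) (auto simp: array_component)
  finally show ?thesis
    using False by (subst P.indep_vars_iff_distr_eq_PiM') (auto simp: array_measurable)
qed (simp add: prob_space.indep_vars_def[OF array_space] prob_space.indep_sets_def[OF array_space])

lemma real_distribution_array_law: "real_distribution (array_law M b n)"
proof -
  interpret P: prob_space "\<Pi>\<^sub>M i\<in>{..<n}. M" by (rule array_space)
  show ?thesis unfolding array_law_def
    by (rule P.real_distribution_distr)
      (auto intro!: borel_measurable_add borel_measurable_sum array_measurable)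
qed

lemma char_array_law: "char (array_law M b n) t = iexp (t * b) * char M t ^ n"
  unfolding array_law_def
  by (subst prob_space.char_iid_sum[OF array_space array_indep array_component]) auto

text \<open>Independence turns the expectation of the product of weights into a product of
  \<open>n\<close> equal factors. Bounding each by \<open>exp (E s / real n)\<close> makes the
  number of summands cancel, so the resulting bound can be uniform along an array.\<close>

lemma nn_integral_array_law_le:
  fixes H :: "real \<Rightarrow> real"
  assumes H0: "H 0 = 1" and Hmono: "\<And>x y. 0 \<le> x \<Longrightarrow> x \<le> y \<Longrightarrow> H x \<le> H y" and c: "c \<ge> 0"
    and sub: "\<And>x y. x \<ge> 0 \<Longrightarrow> y \<ge> 0 \<Longrightarrow> H (x + y) \<le> c * H x * H y"
    and C: "C \<ge> 0" and \<beta>: "\<beta> \<ge> 0" and exp_bound: "\<And>x. x \<ge> 0 \<Longrightarrow> H x \<le> C * exp (\<beta> * x)"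
    and w_bound: "\<And>s. s \<in> {1, -1} \<Longrightarrow> (\<integral>\<^sup>+x. ennreal (step_weight H c \<beta> s x) \<partial>M) \<le> ennreal (exp (E s / real n))"
    and n: "n > 0"
  shows "(\<integral>\<^sup>+x. ennreal (H \<bar>x\<bar>) \<partial>array_law M b n) \<le> ennreal (c * C * (exp (\<beta> * b + E 1) + exp (- \<beta> * b + E (-1))))"
proof -
  have Hpos: "H x \<ge> 0" if "x \<ge> 0" for x using Hmono[of 0 x] H0 that by simp
  \<comment> \<open>Monotonicity of \<open>H\<close> is given on the nonnegative half-line only;
    precomposed with \<open>max 0\<close> it is monotone everywhere, hence Borel.\<close>
  have "mono (\<lambda>x. H (max 0 x))" by (auto simp: mono_def intro!: Hmono)
  then have [measurable]: "(\<lambda>x. H (max 0 x)) \<in> borel_measurable borel" by (rule borel_measurable_mono)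
  have "(\<lambda>x. H (max 0 \<bar>x\<bar>)) \<in> borel_measurable borel" by measurable
  then have H_meas [measurable]: "(\<lambda>x. H \<bar>x\<bar>) \<in> borel_measurable borel" by simp
  have w_meas [measurable]: "step_weight H c \<beta> s \<in> borel_measurable borel" for s
    unfolding step_weight_def by measurable
  have w_pos: "step_weight H c \<beta> s x \<ge> 0" for s x using c Hpos by (auto simp: step_weight_def)
  interpret P: product_sigma_finite "\<lambda>_::nat. M" by standard
  let ?Pi = "\<Pi>\<^sub>M i\<in>{..<n}. M"
  note [measurable] = array_measurable
  have prod_int: "(\<integral>\<^sup>+x. ennreal (\<Prod>i<n. step_weight H c \<beta> s (x i)) \<partial>?Pi) \<le> ennreal (exp (E s))" if "s \<in> {1, -1}" for s
  proof -
    have "(\<integral>\<^sup>+x. ennreal (\<Prod>i<n. step_weight H c \<beta> s (x i)) \<partial>?Pi) = (\<integral>\<^sup>+x. (\<Prod>i<n. ennreal (step_weight H c \<beta> s (x i))) \<partial>?Pi)"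
      using w_pos by (intro nn_integral_cong prod_ennreal[symmetric]) auto
    also have "\<dots> = (\<Prod>i<n. \<integral>\<^sup>+x. ennreal (step_weight H c \<beta> s x) \<partial>M)"
      by (subst P.product_nn_integral_prod) auto
    also have "\<dots> \<le> (\<Prod>i<n. ennreal (exp (E s / real n)))"
      by (intro prod_mono_ennreal w_bound that)
    also have "\<dots> = ennreal (exp (E s / real n) ^ n)" by (simp add: ennreal_power)
    also have "exp (E s / real n) ^ n = exp (E s)" using n by (simp add: exp_of_nat_mult[symmetric])
    finally show ?thesis .
  qed
  have "(\<integral>\<^sup>+x. ennreal (H \<bar>x\<bar>) \<partial>array_law M b n) = (\<integral>\<^sup>+x. ennreal (H \<bar>b + (\<Sum>i<n. x i)\<bar>) \<partial>?Pi)"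
    unfolding array_law_def by (subst nn_integral_distr) auto
  also have "\<dots> \<le> (\<integral>\<^sup>+x. ennreal (c * C * exp (\<beta> * b)) * ennreal (\<Prod>i<n. step_weight H c \<beta> 1 (x i))
                       + ennreal (c * C * exp (- \<beta> * b)) * ennreal (\<Prod>i<n. step_weight H c \<beta> (-1) (x i)) \<partial>?Pi)"
  proof (intro nn_integral_mono)
    fix x :: "nat \<Rightarrow> real"
    have "H \<bar>b + (\<Sum>i<n. x i)\<bar> \<le> c * C * (exp (\<beta> * b) * (\<Prod>i<n. step_weight H c \<beta> 1 (x i))
                                + exp (- \<beta> * b) * (\<Prod>i<n. step_weight H c \<beta> (-1) (x i)))"
      by (rule submultiplicative_sum_split) (use assms in auto)
    then show "ennreal (H \<bar>b + (\<Sum>i<n. x i)\<bar>) \<le> ennreal (c * C * exp (\<beta> * b)) * ennreal (\<Prod>i<n. step_weight H c \<beta> 1 (x i))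
                       + ennreal (c * C * exp (- \<beta> * b)) * ennreal (\<Prod>i<n. step_weight H c \<beta> (-1) (x i))"
      using c C w_pos
      by (subst (1 2) ennreal_mult[symmetric], simp, simp add: prod_nonneg, simp, simp add: prod_nonneg,
          subst ennreal_plus[symmetric]) (auto intro!: mult_nonneg_nonneg prod_nonneg ennreal_leI simp: algebra_simps)
  qed
  also have "\<dots> = ennreal (c * C * exp (\<beta> * b)) * (\<integral>\<^sup>+x. ennreal (\<Prod>i<n. step_weight H c \<beta> 1 (x i)) \<partial>?Pi)
      + ennreal (c * C * exp (- \<beta> * b)) * (\<integral>\<^sup>+x. ennreal (\<Prod>i<n. step_weight H c \<beta> (-1) (x i)) \<partial>?Pi)"
    by (subst nn_integral_add) (auto simp: nn_integral_cmult)
  also have "\<dots> \<le> ennreal (c * C * exp (\<beta> * b)) * ennreal (exp (E 1)) + ennreal (c * C * exp (- \<beta> * b)) * ennreal (exp (E (-1)))"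
    by (intro add_mono mult_left_mono prod_int) auto
  also have "\<dots> = ennreal (c * C * (exp (\<beta> * b + E 1) + exp (- \<beta> * b + E (-1))))"
    using c C by (simp add: ennreal_mult[symmetric] ennreal_plus[symmetric] distrib_left mult.assoc mult_exp_exp del: ennreal_plus)
  finally show ?thesis .
qed

end

section \<open>Tails produced by a single large summand\<close>

text \<open>These are the first two Bonferroni terms for the events "summand \<open>i\<close>
  exceeds \<open>R\<close> and the rest is at most \<open>y\<close>". If two summands are large, the
  pairs already outweigh the first sum; otherwise at most one of the events occurs, and it forces
  the total above \<open>R - y\<close>, hence above \<open>r\<close>.\<close>

lemma one_big_jump_pointwise:
  fixes x :: "'i \<Rightarrow> real"
  assumes I: "finite I" and R: "r + y \<le> R"
  shows "(\<Sum>i\<in>I. of_bool (\<bar>x i\<bar> > R \<and> \<bar>b + (\<Sum>j\<in>I - {i}. x j)\<bar> \<le> y))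
      - (\<Sum>i\<in>I. \<Sum>j\<in>I - {i}. of_bool (\<bar>x i\<bar> > R \<and> \<bar>x j\<bar> > R))
    \<le> (of_bool (\<bar>b + (\<Sum>i\<in>I. x i)\<bar> > r) :: real)"
proof (cases "\<exists>i\<in>I. \<exists>j\<in>I. i \<noteq> j \<and> \<bar>x i\<bar> > R \<and> \<bar>x j\<bar> > R")
  case True
  then obtain k l where kl: "k \<in> I" "l \<in> I" "k \<noteq> l" "\<bar>x k\<bar> > R" "\<bar>x l\<bar> > R" by blast
  have "of_bool (\<bar>x i\<bar> > R \<and> \<bar>b + (\<Sum>j\<in>I - {i}. x j)\<bar> \<le> y) \<le> (\<Sum>j\<in>I - {i}. of_bool (\<bar>x i\<bar> > R \<and> \<bar>x j\<bar> > R) :: real)"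
    if "i \<in> I" for i
  proof (cases "\<bar>x i\<bar> > R")
    case True
    obtain m where m: "m \<in> I - {i}" "\<bar>x m\<bar> > R" using kl by (cases "i = k") auto
    have "(1::real) = of_bool (\<bar>x i\<bar> > R \<and> \<bar>x m\<bar> > R)" using m True by simp
    also have "\<dots> \<le> (\<Sum>j\<in>I - {i}. of_bool (\<bar>x i\<bar> > R \<and> \<bar>x j\<bar> > R))"
      using I m by (intro member_le_sum) auto
    finally show ?thesis by (rule order_trans[rotated]) simp
  qed (simp add: sum_nonneg)
  then have "(\<Sum>i\<in>I. of_bool (\<bar>x i\<bar> > R \<and> \<bar>b + (\<Sum>j\<in>I - {i}. x j)\<bar> \<le> y))
     \<le> (\<Sum>i\<in>I. \<Sum>j\<in>I - {i}. of_bool (\<bar>x i\<bar> > R \<and> \<bar>x j\<bar> > R) :: real)"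
    by (intro sum_mono)
  moreover have "(0::real) \<le> of_bool (\<bar>b + (\<Sum>i\<in>I. x i)\<bar> > r)" by simp
  ultimately show ?thesis by linarith
next
  case False
  have nonneg: "(0::real) \<le> (\<Sum>i\<in>I. \<Sum>j\<in>I - {i}. of_bool (\<bar>x i\<bar> > R \<and> \<bar>x j\<bar> > R))"
    by (intro sum_nonneg) auto
  show ?thesis
  proof (cases "\<exists>i\<in>I. \<bar>x i\<bar> > R \<and> \<bar>b + (\<Sum>j\<in>I - {i}. x j)\<bar> \<le> y")
    case True
    then obtain i where i: "i \<in> I" "\<bar>x i\<bar> > R" "\<bar>b + (\<Sum>j\<in>I - {i}. x j)\<bar> \<le> y" by blast
    have "(\<Sum>i\<in>I. x i) = x i + (\<Sum>j\<in>I - {i}. x j)" using I i by (simp add: sum.remove)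
    then have "\<bar>b + (\<Sum>i\<in>I. x i)\<bar> > r" using i R by linarith
    moreover have "(\<Sum>k\<in>I. of_bool (\<bar>x k\<bar> > R \<and> \<bar>b + (\<Sum>j\<in>I - {k}. x j)\<bar> \<le> y)) \<le> (\<Sum>k\<in>I. of_bool (k = i) :: real)"
      using False i by (intro sum_mono) (auto simp: of_bool_def)
    moreover have "(\<Sum>k\<in>I. of_bool (k = i) :: real) = 1" using I i by (simp add: of_bool_def sum.delta)
    ultimately show ?thesis using nonneg by simp
  next
    case False
    then have "(\<Sum>i\<in>I. of_bool (\<bar>x i\<bar> > R \<and> \<bar>b + (\<Sum>j\<in>I - {i}. x j)\<bar> \<le> y)) = (0::real)"
      by (intro sum.neutral) auto
    then show ?thesis using nonneg by simp
  qed
qed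

text \<open>Expectation of the pointwise inequality. By independence and equality of laws all
  \<open>Suc k\<close> first-order terms agree, and so do the \<open>Suc k * k\<close> pair terms,
  each being the square of the single tail.\<close>

lemma (in real_distribution) one_big_jump:
  assumes R: "r + y \<le> R"
  shows "measure (array_law M b (Suc k)) {x. \<bar>x\<bar> > r} \<ge>
    real (Suc k) * prob {x. \<bar>x\<bar> > R} * (measure (array_law M b k) {x. \<bar>x\<bar> \<le> y} - real k * prob {x. \<bar>x\<bar> > R})"
proof -
  define I where "I = {..<Suc k}"
  let ?Pi = "\<Pi>\<^sub>M i\<in>I. M"
  interpret P: prob_space ?Pi by (rule array_space)
  have coord_meas: "(\<lambda>x. x i) \<in> borel_measurable ?Pi" if "i \<in> I" for i
    by (rule array_measurable[OF that])
  have sum_meas: "(\<lambda>x. b + (\<Sum>j\<in>J. x j)) \<in> borel_measurable ?Pi" if "J \<subseteq> I" for J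
    using that by (intro borel_measurable_add borel_measurable_sum borel_measurable_const array_measurable) auto
  have [measurable]: "(\<lambda>x. b + (\<Sum>j\<in>I. x j)) \<in> borel_measurable ?Pi" by (rule sum_meas) simp
  have I: "finite I" "card I = Suc k" by (auto simp: I_def)
  define Q where "Q = prob {x. \<bar>x\<bar> > R}"
  have X_law: "P.prob {x\<in>space ?Pi. x i \<in> A} = prob A" if "i \<in> I" "A \<in> sets borel" for i A
  proof -
    have "prob A = measure (distr ?Pi borel (\<lambda>x. x i)) A" using array_component[OF that(1)] by simp
    also have "\<dots> = P.prob {x\<in>space ?Pi. x i \<in> A}"
      using that coord_meas[OF that(1)] by (subst measure_distr) (auto simp: vimage_def Int_def conj_commute)
    finally show ?thesis by simp
  qed
  have S_law: "P.prob {x\<in>space ?Pi. \<bar>b + (\<Sum>j\<in>I - {i}. x j)\<bar> \<le> y} = measure (array_law M b k) {x. \<bar>x\<bar> \<le> y}"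
    if i: "i \<in> I" for i
  proof -
    have [measurable]: "(\<lambda>x. b + (\<Sum>j\<in>I - {i}. x j)) \<in> borel_measurable ?Pi" by (rule sum_meas) auto
    \<comment> \<open>The remaining indices do not form an initial segment; comparing characteristic
      functions, which depend only on their number, replaces a reindexing of the product
      space.\<close>
    have "distr ?Pi borel (\<lambda>x. b + (\<Sum>j\<in>I - {i}. x j)) = array_law M b k"
    proof (rule Levy_uniqueness[OF _ real_distribution_array_law])
      show "real_distribution (distr ?Pi borel (\<lambda>x. b + (\<Sum>j\<in>I - {i}. x j)))"
        by (rule P.real_distribution_distr) measurable
      have ind: "P.indep_vars (\<lambda>_. borel) (\<lambda>i x. x i) (I - {i})"
        by (rule P.indep_vars_subset[OF array_indep]) auto
      have "card (I - {i}) = k" using I i by simp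
      then show "char (distr ?Pi borel (\<lambda>x. b + (\<Sum>j\<in>I - {i}. x j))) = char (array_law M b k)"
        by (intro ext, subst P.char_iid_sum[OF ind array_component]) (auto simp: char_array_law)
    qed
    then have "measure (array_law M b k) {x. \<bar>x\<bar> \<le> y} = measure (distr ?Pi borel (\<lambda>x. b + (\<Sum>j\<in>I - {i}. x j))) {x. \<bar>x\<bar> \<le> y}"
      by simp
    also have "\<dots> = P.prob {x\<in>space ?Pi. \<bar>b + (\<Sum>j\<in>I - {i}. x j)\<bar> \<le> y}"
      by (subst measure_distr) (auto simp: vimage_def Int_def conj_commute)
    finally show ?thesis by simp
  qed
  have A: "P.prob {x\<in>space ?Pi. \<bar>x i\<bar> > R \<and> \<bar>b + (\<Sum>j\<in>I - {i}. x j)\<bar> \<le> y} = Q * measure (array_law M b k) {x. \<bar>x\<bar> \<le> y}"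
    if i: "i \<in> I" for i
  proof -
    have "P.indep_var borel (\<lambda>x. x i) borel (\<lambda>x. \<Sum>j\<in>I - {i}. x j)"
      using I i by (intro P.indep_vars_sum) (auto simp: insert_absorb array_indep)
    from P.indep_varD[OF this, of "{x. \<bar>x\<bar> > R}" "{x. \<bar>b + x\<bar> \<le> y}"]
    have "P.prob ((\<lambda>x. (x i, \<Sum>j\<in>I - {i}. x j)) -` ({x. \<bar>x\<bar> > R} \<times> {x. \<bar>b + x\<bar> \<le> y}) \<inter> space ?Pi)
      = P.prob ((\<lambda>x. x i) -` {x. \<bar>x\<bar> > R} \<inter> space ?Pi) * P.prob ((\<lambda>x. \<Sum>j\<in>I - {i}. x j) -` {x. \<bar>b + x\<bar> \<le> y} \<inter> space ?Pi)"
      by simp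
    then show ?thesis using S_law[OF i] X_law[OF i, of "{x. \<bar>x\<bar> > R}"]
      by (simp add: vimage_def Int_def conj_commute Q_def)
  qed
  have B: "P.prob {x\<in>space ?Pi. \<bar>x i\<bar> > R \<and> \<bar>x j\<bar> > R} = Q * Q" if ij: "i \<in> I" "j \<in> I - {i}" for i j
  proof -
    have "P.indep_vars (\<lambda>_. borel) (\<lambda>i x. x i) {i, j}"
      by (rule P.indep_vars_subset[OF array_indep]) (use ij in auto)
    then have "P.indep_var borel (\<lambda>x. x i) borel (\<lambda>x. \<Sum>j\<in>{j}. x j)"
      using ij by (intro P.indep_vars_sum) auto
    from P.indep_varD[OF this, of "{x. \<bar>x\<bar> > R}" "{x. \<bar>x\<bar> > R}"]
    have "P.prob ((\<lambda>x. (x i, x j)) -` ({x. \<bar>x\<bar> > R} \<times> {x. \<bar>x\<bar> > R}) \<inter> space ?Pi)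
      = P.prob ((\<lambda>x. x i) -` {x. \<bar>x\<bar> > R} \<inter> space ?Pi) * P.prob ((\<lambda>x. x j) -` {x. \<bar>x\<bar> > R} \<inter> space ?Pi)"
      by simp
    then show ?thesis using X_law[OF ij(1), of "{x. \<bar>x\<bar> > R}"] X_law[of j "{x. \<bar>x\<bar> > R}"] ij
      by (simp add: vimage_def Int_def conj_commute Q_def)
  qed
  have E: "P.expectation (\<lambda>x. of_bool (\<Phi> x)) = P.prob {x\<in>space ?Pi. \<Phi> x}"
    and Ei: "integrable ?Pi (\<lambda>x. of_bool (\<Phi> x) :: real)"
    if [measurable]: "Measurable.pred ?Pi \<Phi>" for \<Phi>
  proof -
    have "P.expectation (\<lambda>x. of_bool (\<Phi> x)) = P.expectation (indicator {x\<in>space ?Pi. \<Phi> x})"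
      by (intro Bochner_Integration.integral_cong) (auto simp: indicator_def)
    also have "\<dots> = P.prob ({x\<in>space ?Pi. \<Phi> x} \<inter> space ?Pi)" by (rule Bochner_Integration.integral_indicator)
    also have "{x\<in>space ?Pi. \<Phi> x} \<inter> space ?Pi = {x\<in>space ?Pi. \<Phi> x}" by auto
    finally show "P.expectation (\<lambda>x. of_bool (\<Phi> x)) = P.prob {x\<in>space ?Pi. \<Phi> x}" .
    have "integrable ?Pi (\<lambda>x. of_bool (\<Phi> x) :: real) \<longleftrightarrow> integrable ?Pi (indicator {x\<in>space ?Pi. \<Phi> x} :: _ \<Rightarrow> real)"
      by (intro Bochner_Integration.integrable_cong) (auto simp: indicator_def)
    moreover have "integrable ?Pi (indicator {x\<in>space ?Pi. \<Phi> x} :: _ \<Rightarrow> real)"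
      by (rule P.integrable_const_bound[where B = 1]) (auto simp: indicator_def)
    ultimately show "integrable ?Pi (\<lambda>x. of_bool (\<Phi> x) :: real)" by blast
  qed
  let ?a = "\<lambda>i x. \<bar>x i\<bar> > R \<and> \<bar>b + (\<Sum>j\<in>I - {i}. x j)\<bar> \<le> y"
  let ?d = "\<lambda>i j x. \<bar>x i\<bar> > R \<and> \<bar>x j\<bar> > R"
  have ma: "Measurable.pred ?Pi (?a i)" if i: "i \<in> I" for i
  proof -
    have [measurable]: "(\<lambda>x. x i) \<in> borel_measurable ?Pi" by (rule coord_meas[OF i])
    have [measurable]: "(\<lambda>x. b + (\<Sum>j\<in>I - {i}. x j)) \<in> borel_measurable ?Pi" by (rule sum_meas) auto
    show ?thesis by measurable
  qed
  have md: "Measurable.pred ?Pi (?d i j)" if ij: "i \<in> I" "j \<in> I - {i}" for i j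
  proof -
    have [measurable]: "(\<lambda>x. x i) \<in> borel_measurable ?Pi" "(\<lambda>x. x j) \<in> borel_measurable ?Pi"
      using ij by (auto intro: coord_meas)
    show ?thesis by measurable
  qed
  let ?A = "\<lambda>x. \<Sum>i\<in>I. of_bool (?a i x) :: real" and ?D = "\<lambda>x. \<Sum>i\<in>I. \<Sum>j\<in>I - {i}. of_bool (?d i j x) :: real"
  have iA: "integrable ?Pi ?A" by (intro Bochner_Integration.integrable_sum Ei ma)
  have iD: "integrable ?Pi ?D" by (intro Bochner_Integration.integrable_sum Ei md)
  have eA: "P.expectation ?A = (\<Sum>i\<in>I. P.expectation (\<lambda>x. of_bool (?a i x)))"
    by (intro Bochner_Integration.integral_sum Ei ma)
  have "P.expectation ?D = (\<Sum>i\<in>I. P.expectation (\<lambda>x. \<Sum>j\<in>I - {i}. of_bool (?d i j x)))"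
    by (intro Bochner_Integration.integral_sum Bochner_Integration.integrable_sum Ei md)
  also have "\<dots> = (\<Sum>i\<in>I. \<Sum>j\<in>I - {i}. P.expectation (\<lambda>x. of_bool (?d i j x)))"
    by (intro sum.cong refl Bochner_Integration.integral_sum Ei md)
  finally have eD: "P.expectation ?D = \<dots>" .
  have "(\<Sum>i\<in>I. Q * measure (array_law M b k) {x. \<bar>x\<bar> \<le> y}) - (\<Sum>i\<in>I. \<Sum>j\<in>I - {i}. Q * Q)
     = (\<Sum>i\<in>I. P.expectation (\<lambda>x. of_bool (?a i x))) - (\<Sum>i\<in>I. \<Sum>j\<in>I - {i}. P.expectation (\<lambda>x. of_bool (?d i j x)))"
    by (intro arg_cong2[where f = "(-)"] sum.cong refl) (simp_all only: E ma md A B)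
  also have "\<dots> = P.expectation (\<lambda>x. ?A x - ?D x)"
    unfolding Bochner_Integration.integral_diff[OF iA iD] eA eD ..
  also have "\<dots> \<le> P.expectation (\<lambda>x. of_bool (\<bar>b + (\<Sum>i\<in>I. x i)\<bar> > r))"
  proof (rule integral_mono)
    show "integrable ?Pi (\<lambda>x. ?A x - ?D x)" by (intro Bochner_Integration.integrable_diff iA iD)
    show "integrable ?Pi (\<lambda>x. of_bool (\<bar>b + (\<Sum>i\<in>I. x i)\<bar> > r) :: real)" by (rule Ei) measurable
    show "?A x - ?D x \<le> of_bool (\<bar>b + (\<Sum>i\<in>I. x i)\<bar> > r)" for x
      by (rule one_big_jump_pointwise[OF I(1) R])
  qed
  also have "\<dots> = P.prob {x\<in>space ?Pi. \<bar>b + (\<Sum>i\<in>I. x i)\<bar> > r}" by (rule E) measurable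
  also have "\<dots> = measure (array_law M b (Suc k)) {x. \<bar>x\<bar> > r}"
    unfolding array_law_def I_def[symmetric]
    by (subst measure_distr) (auto simp: vimage_def Int_def conj_commute)
  finally show ?thesis
    using I unfolding Q_def[symmetric] by (simp add: algebra_simps card_Diff_singleton)
qed

section \<open>Approximation of an infinitely divisible law\<close>

text \<open>The continuous ramp \<open>h\<close> from 0 at \<open>\<bar>x\<bar> = r\<close> to 1 at
  \<open>\<bar>x\<bar> = r + 1\<close> lies between the two tail indicators. The resulting shift by
  1 disappears later in an arbitrarily small loss of exponent.\<close>

lemma weak_conv_tails:
  assumes D: "\<And>n::nat. real_distribution (D n)" and \<mu>: "real_distribution \<mu>" and conv: "weak_conv_m D \<mu>"
  shows weak_conv_tail_less: "measure \<mu> {x. \<bar>x\<bar> > r} < c \<Longrightarrow> \<forall>\<^sub>F n in sequentially. measure (D n) {x. \<bar>x\<bar> > r + 1} < c"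
    and weak_conv_tail_le: "\<forall>\<^sub>F n in sequentially. measure (D n) {x. \<bar>x\<bar> > r} \<le> c \<Longrightarrow> measure \<mu> {x. \<bar>x\<bar> > r + 1} \<le> c"
proof -
  define h where "h x = max 0 (min 1 (\<bar>x\<bar> - r))" for x :: real
  have [measurable]: "h \<in> borel_measurable borel" unfolding h_def by measurable
  have lim: "(\<lambda>n. integral\<^sup>L (D n) h) \<longlonglongrightarrow> integral\<^sup>L \<mu> h"
    using D \<mu> conv
  proof (rule weak_conv_imp_integral_bdd_continuous_conv)
    show "isCont h x" for x unfolding h_def by (intro continuous_intros)
    show "norm (h x) \<le> 1" for x by (auto simp: h_def)
  qed
  have bounds: "measure P {x. \<bar>x\<bar> > r + 1} \<le> integral\<^sup>L P h" "integral\<^sup>L P h \<le> measure P {x. \<bar>x\<bar> > r}"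
    if P: "real_distribution P" for P
  proof -
    interpret P: real_distribution P by (rule P)
    have hi: "integrable P h" by (rule P.integrable_const_bound[where B = 1]) (auto simp: h_def)
    have ii: "integrable P (indicator {x. \<bar>x\<bar> > s} :: real \<Rightarrow> real)" for s
      by (rule P.integrable_const_bound[where B = 1]) (auto simp: indicator_def)
    have sp: "space P = UNIV" using sets_eq_imp_space_eq[OF P.events_eq_borel] by simp
    have "measure P {x. \<bar>x\<bar> > r + 1} = integral\<^sup>L P (indicator {x. \<bar>x\<bar> > r + 1})" using sp by simp
    also have "\<dots> \<le> integral\<^sup>L P h"
      by (intro integral_mono hi ii) (auto simp: indicator_def h_def)
    finally show "measure P {x. \<bar>x\<bar> > r + 1} \<le> integral\<^sup>L P h" .
    have "integral\<^sup>L P h \<le> integral\<^sup>L P (indicator {x. \<bar>x\<bar> > r})"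
      by (intro integral_mono hi ii) (auto simp: indicator_def h_def)
    also have "\<dots> = measure P {x. \<bar>x\<bar> > r}" using sp by simp
    finally show "integral\<^sup>L P h \<le> measure P {x. \<bar>x\<bar> > r}" .
  qed
  show "\<forall>\<^sub>F n in sequentially. measure (D n) {x. \<bar>x\<bar> > r + 1} < c" if "measure \<mu> {x. \<bar>x\<bar> > r} < c"
  proof -
    have "integral\<^sup>L \<mu> h < c" using bounds(2)[OF \<mu>] that by simp
    from order_tendstoD(2)[OF lim this] show ?thesis
      by eventually_elim (use bounds(1)[OF D] in \<open>auto intro: le_less_trans\<close>)
  qed
  show "measure \<mu> {x. \<bar>x\<bar> > r + 1} \<le> c" if ev: "\<forall>\<^sub>F n in sequentially. measure (D n) {x. \<bar>x\<bar> > r} \<le> c"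
  proof -
    have "\<forall>\<^sub>F n in sequentially. integral\<^sup>L (D n) h \<le> c"
      using ev by eventually_elim (use bounds(2)[OF D] in \<open>auto intro: order_trans\<close>)
    with lim have "integral\<^sup>L \<mu> h \<le> c" by (rule tendsto_upperbound) simp
    then show ?thesis using bounds(1)[OF \<mu>] by simp
  qed
qed

lemma exp_remainder_le:
  fixes u :: real
  assumes "\<bar>u\<bar> \<le> \<beta>" shows "exp u - 1 - u \<le> u\<^sup>2 * exp \<beta>"
proof -
  have "\<bar>exp u - (\<Sum>k\<le>1. u ^ k / fact k)\<bar> \<le> exp \<bar>u\<bar> * \<bar>u\<bar> ^ Suc 1 / fact 1"
    using Taylor_exp[of "complex_of_real u" 1]
    by (simp add: norm_of_real[symmetric, where 'a = complex] exp_of_real del: norm_of_real)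
  then have "exp u - 1 - u \<le> exp \<bar>u\<bar> * u\<^sup>2" by (simp add: power2_eq_square abs_mult[symmetric] flip: abs_mult)
  also have "\<dots> \<le> exp \<beta> * u\<^sup>2" using assms by (intro mult_right_mono) auto
  finally show ?thesis by (simp add: mult.commute)
qed

lemma iexp_remainder_le:
  "cmod (iexp u - 1 - \<i> * complex_of_real u) \<le> u\<^sup>2"
proof -
  have "cmod (iexp u - (\<Sum>k\<le>1. (\<i> * u) ^ k / fact k)) \<le> \<bar>u\<bar> ^ Suc 1 / fact (Suc 1)" by (rule iexp_approx1)
  then have "cmod (iexp u - 1 - \<i> * complex_of_real u) \<le> u\<^sup>2 / 2" by (simp add: power2_eq_square diff_diff_eq)
  also have "\<dots> \<le> u\<^sup>2" by simp
  finally show ?thesis .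
qed

text \<open>Both \<open>1 + z / m\<close> and \<open>exp (z / m)\<close> lie in the closed unit
  disc, so their \<open>m\<close>-th powers differ by at most \<open>m\<close> times the difference
  of the bases, which is of second order in \<open>z / m\<close>. The constant 3 bounds
  \<open>exp 1\<close>.\<close>

lemma norm_exp_sub_power_le:
  fixes z :: complex
  assumes z: "Re z \<le> 0" "norm z \<le> l" and m: "0 < m" "l \<le> real m" and le1: "norm (1 + z / of_nat m) \<le> 1"
  shows "norm ((1 + z / of_nat m) ^ m - exp z) \<le> 3 * l\<^sup>2 / real m"
proof -
  let ?w = "z / of_nat m"
  have nw: "norm ?w \<le> l / real m" using z m by (simp add: norm_divide divide_right_mono)
  have nw1: "norm ?w \<le> 1" using nw m by (simp add: norm_divide field_simps)
  have re: "Re ?w \<le> 0" using z m by (simp add: divide_nonpos_pos)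
  have "exp z = exp ?w ^ m" using m by (simp add: exp_of_nat_mult[symmetric])
  then have "norm ((1 + ?w) ^ m - exp z) = norm ((1 + ?w) ^ m - exp ?w ^ m)" by simp
  also have "\<dots> \<le> m * norm (1 + ?w - exp ?w)"
    by (rule norm_power_diff[OF le1]) (use re in simp)
  also have "norm (1 + ?w - exp ?w) \<le> 3 * (norm ?w)\<^sup>2"
  proof -
    have "norm (exp ?w - (\<Sum>k\<le>1. ?w ^ k / fact k)) \<le> exp \<bar>Re ?w\<bar> * norm ?w ^ Suc 1 / fact 1"
      by (rule Taylor_exp)
    then have "norm (1 + ?w - exp ?w) \<le> exp \<bar>Re ?w\<bar> * (norm ?w)\<^sup>2"
      by (simp add: norm_minus_commute power2_eq_square)
    also have "exp \<bar>Re ?w\<bar> \<le> exp 1" using abs_Re_le_cmod[of ?w] nw1 by simp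
    also have "exp 1 \<le> (3::real)" by (rule exp_le)
    finally show ?thesis by (simp add: mult_right_mono)
  qed
  also have "real m * (3 * (norm ?w)\<^sup>2) \<le> real m * (3 * (l / real m)\<^sup>2)"
    using nw by (intro mult_left_mono power_mono) auto
  also have "\<dots> = 3 * l\<^sup>2 / real m" using m by (simp add: power2_eq_square)
  finally show ?thesis using m by (simp add: mult_left_mono)
qed

lemma levy_khintchine_levy_measureD:
  assumes "levy_khintchine \<mu> A \<nu> \<gamma>"
  shows "sets \<nu> = sets borel" "emeasure \<nu> {0} = 0" "integrable \<nu> (\<lambda>x. min 1 ((norm x)\<^sup>2))"
    "\<And>d. d > 0 \<Longrightarrow> emeasure \<nu> {x. norm x > d} < \<infinity>"
proof -
  show s: "sets \<nu> = sets borel" and "emeasure \<nu> {0} = 0" using assms by (auto simp: levy_khintchine_def)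
  have fin: "(\<integral>\<^sup>+x. ennreal (min 1 ((norm x)\<^sup>2)) \<partial>\<nu>) < \<infinity>" using assms by (auto simp: levy_khintchine_def)
  have "(\<lambda>x::'a. min 1 ((norm x)\<^sup>2)) \<in> borel_measurable borel" by measurable
  then have [measurable]: "(\<lambda>x::'a. min 1 ((norm x)\<^sup>2)) \<in> borel_measurable \<nu>" using s by (simp cong: measurable_cong_sets)
  show int: "integrable \<nu> (\<lambda>x. min 1 ((norm x)\<^sup>2))"
    by (rule integrableI_nonneg) (use fin in auto)
  fix d :: real assume d: "d > 0"
  have "{x. norm x > d} \<in> sets borel" by measurable
  then have m: "{x. norm x > d} \<in> sets \<nu>" by (simp add: s)
  have "ennreal (min 1 (d\<^sup>2)) * emeasure \<nu> {x. norm x > d} = (\<integral>\<^sup>+x. ennreal (min 1 (d\<^sup>2)) * indicator {x. norm x > d} x \<partial>\<nu>)"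
    using m by (simp add: nn_integral_cmult_indicator)
  also have "\<dots> \<le> (\<integral>\<^sup>+x. ennreal (min 1 ((norm x)\<^sup>2)) \<partial>\<nu>)"
  proof (intro nn_integral_mono)
    fix x :: 'a
    have "d\<^sup>2 \<le> (norm x)\<^sup>2" if "norm x > d" using that d by (intro power_mono) auto
    then show "ennreal (min 1 (d\<^sup>2)) * indicator {x. norm x > d} x \<le> ennreal (min 1 ((norm x)\<^sup>2))"
      by (auto simp: indicator_def intro!: ennreal_leI)
  qed
  also note fin
  finally have "ennreal (min 1 (d\<^sup>2)) * emeasure \<nu> {x. norm x > d} < \<infinity>" .
  moreover have "min 1 (d\<^sup>2) > 0" using d by simp
  ultimately show "emeasure \<nu> {x. norm x > d} < \<infinity>" using d
    by (auto simp: ennreal_mult_less_top ennreal_mult_eq_top_iff less_top)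
qed

section \<open>A triangular array converging to a one-dimensional projection\<close>

locale levy_projection = prob_space \<mu> for \<mu> :: "'a::euclidean_space measure" +
  fixes A :: "'a \<Rightarrow> 'a" and \<nu> :: "'a measure" and \<gamma> e :: 'a
  assumes sets_\<mu>: "sets \<mu> = sets borel" and lk: "levy_khintchine \<mu> A \<nu> \<gamma>" and norm_e: "norm e \<le> 1"
begin

lemmas sets_\<nu> = levy_khintchine_levy_measureD(1)[OF lk]
lemmas int_min = levy_khintchine_levy_measureD(3)[OF lk]

lemma meas_\<nu>: "f \<in> borel_measurable borel \<Longrightarrow> f \<in> borel_measurable \<nu>"
  using sets_\<nu> by (simp cong: measurable_cong_sets)

lemma space_\<nu>: "space \<nu> = UNIV" using sets_eq_imp_space_eq[OF sets_\<nu>] by simp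

definition \<delta> :: "nat \<Rightarrow> real" where "\<delta> n = 1 / (real n + 1)"

lemma \<delta>_bounds: "0 < \<delta> n" "\<delta> n \<le> 1" by (auto simp: \<delta>_def)

definition gauss :: real where "gauss = e \<bullet> A e"

lemma gauss_nonneg: "gauss \<ge> 0" using lk by (simp add: gauss_def levy_khintchine_def)

lemma inner_le: "\<bar>e \<bullet> x\<bar> \<le> norm x"
  using Cauchy_Schwarz_ineq2[of e x] norm_e mult_right_mono[OF norm_e norm_ge_zero[of x]] by simp

text \<open>The jumps of size at most \<open>\<delta> n\<close> are discarded; the Gaussian part is imitated by jumps
  \<open>\<plusminus>\<delta> n\<close> of total variance \<open>gauss\<close>.\<close>
definition N :: "nat \<Rightarrow> real measure" where
  "N n = comb_measure 1 (distr (density \<nu> (\<lambda>x. ennreal (indicator {x. norm x > \<delta> n} x))) borel (\<lambda>x. e \<bullet> x))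
     (gauss / (2 * (\<delta> n)\<^sup>2)) (comb_measure 1 (return borel (\<delta> n)) 1 (return borel (- \<delta> n)))"

lemma sets_N [simp, measurable_cong]: "sets (N n) = sets borel" by (simp add: N_def)

lemma space_N [simp]: "space (N n) = UNIV" by (simp add: N_def)

lemma
  fixes F :: "real \<Rightarrow> 'b::{banach, second_countable_topology}"
  assumes [measurable]: "F \<in> borel_measurable borel"
    and int: "integrable \<nu> (\<lambda>x. indicator {x. norm x > \<delta> n} x *\<^sub>R F (e \<bullet> x))"
  shows integrable_N: "integrable (N n) F"
    and integral_N: "integral\<^sup>L (N n) F = (LINT x|\<nu>. indicator {x. norm x > \<delta> n} x *\<^sub>R F (e \<bullet> x))
        + (gauss / (2 * (\<delta> n)\<^sup>2)) *\<^sub>R (F (\<delta> n) + F (- \<delta> n))"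
proof -
  have [measurable]: "(\<lambda>x. F (e \<bullet> x)) \<in> borel_measurable \<nu>" "(\<lambda>x. e \<bullet> x) \<in> borel_measurable \<nu>"
    "(\<lambda>x. indicator {x. norm x > \<delta> n} x :: real) \<in> borel_measurable \<nu>"
    by (rule meas_\<nu>, measurable)+
  have em: "(\<lambda>x. e \<bullet> x) \<in> measurable (density \<nu> (\<lambda>x. ennreal (indicator {x. norm x > \<delta> n} x))) borel" by simp
  let ?D = "distr (density \<nu> (\<lambda>x. ennreal (indicator {x. norm x > \<delta> n} x))) borel (\<lambda>x. e \<bullet> x)"
  have i1: "integrable ?D F"
    by (subst integrable_distr_eq[OF em]) (auto simp: integrable_density int)
  have e1: "integral\<^sup>L ?D F = (LINT x|\<nu>. indicator {x. norm x > \<delta> n} x *\<^sub>R F (e \<bullet> x))"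
    by (subst integral_distr[OF em]) (auto simp: integral_density)
  have ir: "integrable (return borel z) F" for z :: real
    by (auto simp: integrable_iff_bounded nn_integral_return)
  have er: "integral\<^sup>L (return borel z) F = F z" for z :: real
    by (rule integral_return) auto
  let ?C = "comb_measure 1 (return borel (\<delta> n)) 1 (return borel (- \<delta> n))"
  have i2: "integrable ?C F" by (rule integrable_comb_measure) (auto simp: ir)
  have e2: "integral\<^sup>L ?C F = F (\<delta> n) + F (- \<delta> n)" by (subst integral_comb_measure) (auto simp: ir er)
  show "integrable (N n) F" unfolding N_def
    by (rule integrable_comb_measure) (auto simp: i1 i2 gauss_nonneg)
  show "integral\<^sup>L (N n) F = (LINT x|\<nu>. indicator {x. norm x > \<delta> n} x *\<^sub>R F (e \<bullet> x))
        + (gauss / (2 * (\<delta> n)\<^sup>2)) *\<^sub>R (F (\<delta> n) + F (- \<delta> n))"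
    unfolding N_def by (subst integral_comb_measure) (auto simp: i1 i2 e1 e2 gauss_nonneg)
qed

lemma integrable_\<nu>_bound:
  fixes F :: "'a \<Rightarrow> 'b::{banach, second_countable_topology}"
  assumes "F \<in> borel_measurable borel" and "\<And>x. norm (F x) \<le> K * min 1 ((norm x)\<^sup>2)"
  shows "integrable \<nu> F"
  by (rule Bochner_Integration.integrable_bound[OF integrable_mult_right[OF int_min, of K]])
    (use assms meas_\<nu> in \<open>auto intro: order_trans[OF assms(2) abs_ge_self]\<close>)

lemma integrable_truncated_drift:
  "integrable \<nu> (\<lambda>x. indicator {x. norm x > \<delta> n} x *\<^sub>R (indicator (cball 0 1) x * (e \<bullet> x)))"
proof (rule integrable_\<nu>_bound[where K = "1 / (\<delta> n)\<^sup>2"])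
  have [measurable]: "cball (0::'a) 1 \<in> sets borel" by simp
  show "(\<lambda>x. indicator {x. norm x > \<delta> n} x *\<^sub>R (indicator (cball 0 1) x * (e \<bullet> x))) \<in> borel_measurable borel"
    by measurable
  fix x :: 'a
  show "norm (indicator {x. norm x > \<delta> n} x *\<^sub>R (indicator (cball 0 1) x * (e \<bullet> x))) \<le> 1 / (\<delta> n)\<^sup>2 * min 1 ((norm x)\<^sup>2)"
  proof (cases "norm x > \<delta> n \<and> norm x \<le> 1")
    case True
    then have "(\<delta> n)\<^sup>2 \<le> min 1 ((norm x)\<^sup>2)" using \<delta>_bounds[of n] by (auto intro!: power_mono power_le_one)
    then have "1 \<le> 1 / (\<delta> n)\<^sup>2 * min 1 ((norm x)\<^sup>2)" using \<delta>_bounds[of n] by (simp add: field_simps)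
    then show ?thesis using True inner_le[of x] by simp
  qed (auto simp: indicator_def)
qed

lemma integrable_N_bounded:
  fixes F :: "real \<Rightarrow> 'b::{banach, second_countable_topology}"
  assumes [measurable]: "F \<in> borel_measurable borel" and "\<And>x. norm (F x) \<le> K"
  shows "integrable \<nu> (\<lambda>x. indicator {x. norm x > \<delta> n} x *\<^sub>R F (e \<bullet> x))"
proof (rule integrable_\<nu>_bound)
  show "(\<lambda>x. indicator {x. norm x > \<delta> n} x *\<^sub>R F (e \<bullet> x)) \<in> borel_measurable borel" by measurable
  fix x :: 'a
  have K: "K \<ge> 0" using assms(2)[of 0] norm_ge_zero order_trans by blast
  show "norm (indicator {x. norm x > \<delta> n} x *\<^sub>R F (e \<bullet> x)) \<le> K / (\<delta> n)\<^sup>2 * min 1 ((norm x)\<^sup>2)"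
  proof (cases "norm x > \<delta> n")
    case True
    then have "(\<delta> n)\<^sup>2 \<le> min 1 ((norm x)\<^sup>2)" using \<delta>_bounds[of n] by (auto intro!: power_mono power_le_one)
    then have "K * (\<delta> n)\<^sup>2 \<le> K * min 1 ((norm x)\<^sup>2)" using K by (rule mult_left_mono)
    then have "K \<le> K * min 1 ((norm x)\<^sup>2) / (\<delta> n)\<^sup>2" using \<delta>_bounds[of n] by (simp add: field_simps)
    then show ?thesis using True assms(2)[of "e \<bullet> x"] by simp
  qed (use K in simp)
qed

lemma finite_measure_N: "finite_measure (N n)"
proof
  have "integrable (N n) (\<lambda>_. 1::real)"
    by (intro integrable_N integrable_N_bounded[where K = 1]) auto
  then have "integrable (N n) (indicator (space (N n)) :: _ \<Rightarrow> real)"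
    by simp
  then show "emeasure (N n) (space (N n)) \<noteq> \<infinity>"
    by (subst (asm) integrable_indicator_iff) auto
qed

definition \<Lambda> :: "nat \<Rightarrow> real" where "\<Lambda> n = measure (N n) UNIV"

text \<open>Since \<open>norm (\<Psi> n t)\<close> is at most \<open>2 * \<Lambda> n\<close>,
  replacing \<open>exp (\<Psi> n t)\<close> by the power of the characteristic function costs at
  most \<open>12 * (\<Lambda> n)\<^sup>2 / Suc (k n)\<close>. As \<open>\<Lambda> n\<close> may grow
  at any speed, \<open>k n\<close> is taken proportional to its square with an extra factor
  \<open>n + 1\<close>.\<close>

definition k :: "nat \<Rightarrow> nat" where "k n = nat \<lceil>(real n + 1) * (\<Lambda> n + 1)\<^sup>2\<rceil>"

lemma \<Lambda>_nonneg: "\<Lambda> n \<ge> 0" by (simp add: \<Lambda>_def)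

lemma k_ge: "real (k n) \<ge> (real n + 1) * (\<Lambda> n + 1)\<^sup>2"
  unfolding k_def by (rule real_nat_ceiling_ge)

lemma k_ge2: "2 * \<Lambda> n \<le> real (Suc (k n))" 
proof -
  have "2 * \<Lambda> n \<le> 1 * (\<Lambda> n + 1)\<^sup>2" using \<Lambda>_nonneg[of n] by (simp add: power2_eq_square algebra_simps)
  also have "\<dots> \<le> (real n + 1) * (\<Lambda> n + 1)\<^sup>2" by (intro mult_right_mono) auto
  also have "\<dots> \<le> real (Suc (k n))" using k_ge[of n] by simp
  finally show ?thesis .
qed

text \<open>The law of one summand: no jump, or with probability
  \<open>\<Lambda> n / Suc (k n)\<close> a jump distributed according to the normalised
  \<open>N n\<close>. Rows have \<open>Suc (k n)\<close> summands so that \<open>k n\<close> remain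
  when the big jump is removed.\<close>

definition p :: "nat \<Rightarrow> real measure" where
  "p n = comb_measure (1 - \<Lambda> n / real (Suc (k n))) (return borel 0) (1 / real (Suc (k n))) (N n)"

lemma p_coeff: "1 - \<Lambda> n / real (Suc (k n)) \<ge> 0"
  using k_ge2[of n] \<Lambda>_nonneg[of n] by (simp add: field_simps)

lemma sets_p [simp, measurable_cong]: "sets (p n) = sets borel" by (simp add: p_def)

lemma real_distribution_p: "real_distribution (p n)"
proof (intro real_distribution.intro prob_spaceI real_distribution_axioms.intro)
  interpret finite_measure "N n" by (rule finite_measure_N)
  have "emeasure (p n) (space (p n)) = ennreal (1 - \<Lambda> n / real (Suc (k n))) * 1 + ennreal (1 / real (Suc (k n))) * ennreal (\<Lambda> n)"
    unfolding p_def by (subst emeasure_comb_measure) (auto simp: emeasure_eq_measure \<Lambda>_def)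
  also have "\<dots> = ennreal ((1 - \<Lambda> n / real (Suc (k n))) + 1 / real (Suc (k n)) * \<Lambda> n)"
    using p_coeff[of n] \<Lambda>_nonneg[of n] by (simp add: ennreal_mult[symmetric] ennreal_plus[symmetric] del: ennreal_plus)
  finally show "emeasure (p n) (space (p n)) = 1" by simp
qed simp

lemma integral_p:
  fixes F :: "real \<Rightarrow> 'b::{banach, second_countable_topology}"
  assumes [measurable]: "F \<in> borel_measurable borel" and F: "integrable (N n) F"
  shows "integral\<^sup>L (p n) F = F 0 + (1 / real (Suc (k n))) *\<^sub>R (LINT x|N n. F x - F 0)"
proof -
  interpret finite_measure "N n" by (rule finite_measure_N)
  have ir: "integrable (return borel 0) F" by (auto simp: integrable_iff_bounded nn_integral_return)
  have "(LINT x|N n. F x - F 0) = integral\<^sup>L (N n) F - \<Lambda> n *\<^sub>R F 0"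
    using F by (simp add: \<Lambda>_def)
  moreover have "integral\<^sup>L (p n) F = (1 - \<Lambda> n / real (Suc (k n))) *\<^sub>R F 0 + (1 / real (Suc (k n))) *\<^sub>R integral\<^sup>L (N n) F"
    unfolding p_def using p_coeff[of n] F ir
    by (subst integral_comb_measure) (auto simp: integral_return)
  ultimately show ?thesis by (simp add: scaleR_diff_left scaleR_diff_right)
qed

text \<open>The Levy exponent of the compound Poisson law with intensity \<open>N n\<close>, which
  the rows of the array imitate.\<close>

definition \<Psi> :: "nat \<Rightarrow> real \<Rightarrow> complex" where "\<Psi> n t = (CLINT x|N n. iexp (t * x) - 1)"

text \<open>The Levy-Khintchine drift with the compensator of the retained jumps of norm at most 1
  moved into it, since \<open>\<Psi> n\<close> is not compensated.\<close>

definition b :: "nat \<Rightarrow> real" where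
  "b n = e \<bullet> \<gamma> - (LINT x|\<nu>. indicator {x. norm x > \<delta> n} x *\<^sub>R (indicator (cball 0 1) x * (e \<bullet> x)))"

lemma integrable_N_iexp: "integrable (N n) (\<lambda>x. iexp (t * x))"
  by (rule integrable_N[where F = "\<lambda>x. iexp (t * x)", OF _ integrable_N_bounded[where K = 1 and F = "\<lambda>x. iexp (t * x)"]]) auto

lemma char_p: "char (p n) t = 1 + \<Psi> n t / of_nat (Suc (k n))"
  using integral_p[where F = "\<lambda>x. iexp (t * x)", OF _ integrable_N_iexp]
  by (simp add: char_def \<Psi>_def scaleR_conv_of_real)

lemma \<Psi>_bounds: "norm (\<Psi> n t) \<le> 2 * \<Lambda> n" "Re (\<Psi> n t) \<le> 0"
proof -
  interpret finite_measure "N n" by (rule finite_measure_N)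
  have int: "integrable (N n) (\<lambda>x. iexp (t * x) - 1)" using integrable_N_iexp by auto
  have "norm (\<Psi> n t) \<le> (LINT x|N n. norm (iexp (t * x) - 1))" unfolding \<Psi>_def by (rule integral_norm_bound)
  also have "\<dots> \<le> (LINT x|N n. 2)"
    using int
    by (intro integral_mono) (auto intro: order_trans[OF norm_triangle_ineq4])
  finally show "norm (\<Psi> n t) \<le> 2 * \<Lambda> n" by (simp add: \<Lambda>_def)
  have "Re (\<Psi> n t) = (LINT x|N n. Re (iexp (t * x) - 1))" unfolding \<Psi>_def by (rule integral_Re[OF int, symmetric])
  also have "\<dots> \<le> (LINT x|N n. 0)"
  proof (rule integral_mono[OF integrable_Re[OF int]])
    show "Re (iexp (t * x) - 1) \<le> 0" for x
      using complex_Re_le_cmod[of "iexp (t * x)"] by (simp del: of_real_mult)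
  qed simp
  finally show "Re (\<Psi> n t) \<le> 0" by simp
qed

text \<open>Uncompensated jump integrals and drifts may diverge separately. Together they give the
  integral of the compensated integrand \<open>G\<close> over the jumps above
  \<open>\<delta> n\<close>; \<open>G\<close> is dominated by a multiple of
  \<open>min 1 ((norm x)\<^sup>2)\<close>, so dominated convergence applies. The symmetric jumps
  contribute the cosine term, whose limit is the Gaussian one.\<close>

lemma exponent_limit:
  "(\<lambda>n. \<i> * complex_of_real (t * b n) + \<Psi> n t) \<longlonglongrightarrow>
     complex_of_real (- (t\<^sup>2 * gauss) / 2) + \<i> * complex_of_real (t * (e \<bullet> \<gamma>)) +
        (CLINT x|\<nu>. iexp (t * (e \<bullet> x)) - 1 - \<i> * complex_of_real (t * (e \<bullet> x)) * indicator (cball 0 1) x)"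
proof -
  define G where "G x = iexp (t * (e \<bullet> x)) - 1 - \<i> * complex_of_real (t * (e \<bullet> x)) * indicator (cball 0 1) x" for x :: 'a
  have [measurable]: "cball (0::'a) 1 \<in> sets borel" by simp
  have [measurable]: "G \<in> borel_measurable borel" unfolding G_def by measurable
  have G_bound: "norm (G x) \<le> (t\<^sup>2 + 2) * min 1 ((norm x)\<^sup>2)" for x
  proof (cases "norm x \<le> 1")
    case True
    have "norm (G x) \<le> (t * (e \<bullet> x))\<^sup>2" using iexp_remainder_le[of "t * (e \<bullet> x)"] True by (simp add: G_def)
    also have "\<dots> \<le> t\<^sup>2 * (norm x)\<^sup>2" unfolding power_mult_distrib
      using power_mono[OF inner_le, of x 2] by (intro mult_left_mono) auto
    also have "\<dots> \<le> (t\<^sup>2 + 2) * (norm x)\<^sup>2" by (intro mult_right_mono) auto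
    also have "(norm x)\<^sup>2 = min 1 ((norm x)\<^sup>2)" using True by (simp add: power_le_one)
    finally show ?thesis .
  next
    case False
    then have "norm (G x) \<le> 2" using norm_triangle_ineq4[of "iexp (t * (e \<bullet> x))" 1] by (simp add: G_def)
    moreover have "min 1 ((norm x)\<^sup>2) = 1" using False by (simp add: min_def one_le_power not_le order_less_imp_le)
    ultimately show ?thesis by (simp add: add_increasing)
  qed
  have G_int: "integrable \<nu> G" using G_bound by (intro integrable_\<nu>_bound) auto
  have G_lim: "(\<lambda>n. CLINT x|\<nu>. indicator {x. norm x > \<delta> n} x *\<^sub>R G x) \<longlonglongrightarrow> (CLINT x|\<nu>. G x)"
  proof (rule integral_dominated_convergence[where w = "\<lambda>x. norm (G x)"])
    show "G \<in> borel_measurable \<nu>" "\<And>n. (\<lambda>x. indicator {x. norm x > \<delta> n} x *\<^sub>R G x) \<in> borel_measurable \<nu>"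
      by (rule meas_\<nu>, measurable)+
    show "AE x in \<nu>. (\<lambda>n. indicator {x. norm x > \<delta> n} x *\<^sub>R G x) \<longlonglongrightarrow> G x"
    proof (rule AE_I2)
      fix x :: 'a
      show "(\<lambda>n. indicator {x. norm x > \<delta> n} x *\<^sub>R G x) \<longlonglongrightarrow> G x"
      \<comment> \<open>At 0 the indicator never becomes 1, but there \<open>G\<close>
        vanishes.\<close>
      proof (cases "x = 0")
        case False
        have "\<delta> \<longlonglongrightarrow> 0" unfolding \<delta>_def by real_asymp
        then have "\<forall>\<^sub>F n in sequentially. \<delta> n < norm x" by (rule order_tendstoD) (use False in simp)
        then have "\<forall>\<^sub>F n in sequentially. indicator {x. norm x > \<delta> n} x *\<^sub>R G x = G x"
          by eventually_elim simp
        then show ?thesis by (rule tendsto_eventually)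
      qed (simp add: G_def)
    qed
  qed (use G_int in \<open>auto simp: indicator_def\<close>)
  have eq: "\<i> * complex_of_real (t * b n) + \<Psi> n t = \<i> * complex_of_real (t * (e \<bullet> \<gamma>)) +
      (CLINT x|\<nu>. indicator {x. norm x > \<delta> n} x *\<^sub>R G x) + complex_of_real (gauss / (\<delta> n)\<^sup>2 * (cos (t * \<delta> n) - 1))" for n
  proof -
    let ?i = "indicator {x::'a. norm x > \<delta> n} :: 'a \<Rightarrow> real"
    have i1: "integrable \<nu> (\<lambda>x. ?i x *\<^sub>R (iexp (t * (e \<bullet> x)) - 1))"
      by (rule integrable_N_bounded[where K = 2 and F = "\<lambda>y. iexp (t * y) - 1"])
        (auto intro: order_trans[OF norm_triangle_ineq4])
    note i2 = integrable_truncated_drift[of n]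
    have "\<Psi> n t = (CLINT x|\<nu>. ?i x *\<^sub>R (iexp (t * (e \<bullet> x)) - 1)) + (gauss / (2 * (\<delta> n)\<^sup>2)) *\<^sub>R (iexp (t * \<delta> n) - 1 + (iexp (t * - \<delta> n) - 1))"
      unfolding \<Psi>_def by (rule integral_N) (use i1 in auto)
    also have "iexp (t * \<delta> n) - 1 + (iexp (t * - \<delta> n) - 1) = complex_of_real (2 * (cos (t * \<delta> n) - 1))"
      by (simp add: complex_eq_iff Re_exp Im_exp)
    also have "(gauss / (2 * (\<delta> n)\<^sup>2)) *\<^sub>R complex_of_real (2 * (cos (t * \<delta> n) - 1)) = complex_of_real (gauss / (\<delta> n)\<^sup>2 * (cos (t * \<delta> n) - 1))"
      by (simp only: scaleR_conv_of_real of_real_mult[symmetric]) (intro arg_cong[where f = complex_of_real], use \<delta>_bounds[of n] in \<open>simp add: field_simps\<close>)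
    also have "(CLINT x|\<nu>. ?i x *\<^sub>R (iexp (t * (e \<bullet> x)) - 1)) =
        (CLINT x|\<nu>. ?i x *\<^sub>R G x + \<i> * complex_of_real t * complex_of_real (?i x *\<^sub>R (indicator (cball 0 1) x * (e \<bullet> x))))"
      by (intro Bochner_Integration.integral_cong) (auto simp: G_def indicator_def scaleR_conv_of_real)
    also have "\<dots> = (CLINT x|\<nu>. ?i x *\<^sub>R G x) + \<i> * complex_of_real t * complex_of_real (LINT x|\<nu>. ?i x *\<^sub>R (indicator (cball 0 1) x * (e \<bullet> x)))"
    proof (subst Bochner_Integration.integral_add)
      show "integrable \<nu> (\<lambda>x. ?i x *\<^sub>R G x)"
        by (rule Bochner_Integration.integrable_bound[OF G_int]) (auto intro!: meas_\<nu> simp: indicator_def)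
      show "integrable \<nu> (\<lambda>x. \<i> * complex_of_real t * complex_of_real (?i x *\<^sub>R (indicator (cball 0 1) x * (e \<bullet> x))))"
        by (intro integrable_mult_right integrable_of_real i2)
    qed (simp only: integral_mult_right_zero integral_complex_of_real)
    finally show ?thesis by (simp add: b_def right_diff_distrib algebra_simps)
  qed
  have coin_lim: "(\<lambda>n. complex_of_real (gauss / (\<delta> n)\<^sup>2 * (cos (t * \<delta> n) - 1))) \<longlonglongrightarrow> complex_of_real (- (t\<^sup>2 * gauss) / 2)"
  proof (rule tendsto_of_real)
    have "((\<lambda>n. (cos (t * \<delta> n) - 1) / (\<delta> n)\<^sup>2) \<longlongrightarrow> - (t * t / 2)) sequentially" unfolding \<delta>_def by real_asymp
    from tendsto_mult_left[OF this, of gauss]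
    show "(\<lambda>n. gauss / (\<delta> n)\<^sup>2 * (cos (t * \<delta> n) - 1)) \<longlonglongrightarrow> - (t\<^sup>2 * gauss) / 2"
      by (simp add: mult.commute power2_eq_square mult.left_commute)
  qed
  have "(\<lambda>n. \<i> * complex_of_real (t * b n) + \<Psi> n t) \<longlonglongrightarrow>
      \<i> * complex_of_real (t * (e \<bullet> \<gamma>)) + (CLINT x|\<nu>. G x) + complex_of_real (- (t\<^sup>2 * gauss) / 2)"
    unfolding eq by (intro tendsto_add tendsto_const G_lim coin_lim)
  then show ?thesis unfolding G_def by (simp only: add_ac)
qed

definition proj :: "real measure" where "proj = distr \<mu> borel (\<lambda>x. e \<bullet> x)"

lemma inner_meas [measurable]: "(\<lambda>x. e \<bullet> x) \<in> borel_measurable \<mu>"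
proof -
  have "(\<lambda>x. e \<bullet> x) \<in> borel_measurable borel" by measurable
  then show ?thesis using sets_\<mu> by (simp cong: measurable_cong_sets)
qed

lemma real_distribution_proj: "real_distribution proj"
  unfolding proj_def by (rule real_distribution_distr) measurable

lemma char_proj: "char proj t = exp (complex_of_real (- (t\<^sup>2 * gauss) / 2) + \<i> * complex_of_real (t * (e \<bullet> \<gamma>)) +
        (CLINT x|\<nu>. iexp (t * (e \<bullet> x)) - 1 - \<i> * complex_of_real (t * (e \<bullet> x)) * indicator (cball 0 1) x))"
proof -
  have "char proj t = (CLINT x|\<mu>. iexp ((t *\<^sub>R e) \<bullet> x))"
    unfolding char_def proj_def by (subst integral_distr) auto
  also have "\<dots> = exp (complex_of_real (- ((t *\<^sub>R e) \<bullet> A (t *\<^sub>R e)) / 2) + \<i> * complex_of_real (\<gamma> \<bullet> (t *\<^sub>R e)) +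
        (CLINT x|\<nu>. iexp ((t *\<^sub>R e) \<bullet> x) - 1 - \<i> * complex_of_real ((t *\<^sub>R e) \<bullet> x) * indicator (cball 0 1) x))"
    using lk unfolding levy_khintchine_def by blast
  also have "(t *\<^sub>R e) \<bullet> A (t *\<^sub>R e) = t\<^sup>2 * gauss"
    using lk by (simp add: levy_khintchine_def gauss_def linear_scale power2_eq_square)
  finally show ?thesis by (simp add: inner_commute)
qed

text \<open>Levy's continuity theorem applies with a limit law that is already at hand, namely the
  projection of \<mu>. Rows shortened by one summand are needed for the rest after a big jump; their
  characteristic functions differ by at most \<open>norm (\<Psi> n t) / Suc (k n)\<close>, which
  tends to 0.\<close>

lemma array_approx:
  shows array_conv_Suc: "weak_conv_m (\<lambda>n. array_law (p n) (b n) (Suc (k n))) proj"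
    and array_conv: "weak_conv_m (\<lambda>n. array_law (p n) (b n) (k n)) proj"
proof -
  have inv: "(\<lambda>n. 12 / (real n + 1)) \<longlonglongrightarrow> 0" by real_asymp
  have main: "(\<lambda>n. char (array_law (p n) (b n) (Suc (k n))) t) \<longlonglongrightarrow> char proj t" for t
  proof -
    have "(\<lambda>n. iexp (t * b n) * (char (p n) t ^ Suc (k n) - exp (\<Psi> n t))) \<longlonglongrightarrow> 0"
    proof (rule Lim_null_comparison[OF _ inv], rule always_eventually, rule allI)
      fix n
      interpret P: real_distribution "p n" by (rule real_distribution_p)
      have "norm (char (p n) t ^ Suc (k n) - exp (\<Psi> n t)) \<le> 3 * (2 * \<Lambda> n)\<^sup>2 / real (Suc (k n))"
        unfolding char_p using \<Psi>_bounds[of n t] k_ge2[of n] P.cmod_char_le_1[of t] 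
        by (intro norm_exp_sub_power_le) (auto simp: char_p)
      also have "\<dots> \<le> 12 / (real n + 1)"
      proof -
        have "(real n + 1) * (\<Lambda> n)\<^sup>2 \<le> (real n + 1) * (\<Lambda> n + 1)\<^sup>2"
          using \<Lambda>_nonneg[of n] by (intro mult_left_mono power_mono) auto
        also have "\<dots> \<le> real (Suc (k n))" using k_ge[of n] by simp
        finally show ?thesis by (simp add: field_simps)
      qed
      finally show "norm (iexp (t * b n) * (char (p n) t ^ Suc (k n) - exp (\<Psi> n t))) \<le> 12 / (real n + 1)"
        by (simp add: norm_mult)
    qed
    moreover have "(\<lambda>n. exp (\<i> * complex_of_real (t * b n) + \<Psi> n t)) \<longlonglongrightarrow> char proj t"
      unfolding char_proj by (intro tendsto_exp exponent_limit)
    ultimately have "(\<lambda>n. iexp (t * b n) * (char (p n) t ^ Suc (k n) - exp (\<Psi> n t)) + exp (\<i> * complex_of_real (t * b n) + \<Psi> n t)) \<longlonglongrightarrow> 0 + char proj t"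
      by (rule tendsto_add)
    then show ?thesis
      by (simp add: real_distribution.char_array_law[OF real_distribution_p] exp_add right_diff_distrib)
  qed
  show "weak_conv_m (\<lambda>n. array_law (p n) (b n) (Suc (k n))) proj"
    by (rule levy_continuity[OF real_distribution.real_distribution_array_law[OF real_distribution_p] real_distribution_proj main])
  have "(\<lambda>n. char (array_law (p n) (b n) (k n)) t) \<longlonglongrightarrow> char proj t" for t
  proof -
    have "(\<lambda>n. char (array_law (p n) (b n) (Suc (k n))) t - char (array_law (p n) (b n) (k n)) t) \<longlonglongrightarrow> 0"
    proof (rule Lim_null_comparison[OF _ inv], rule always_eventually, rule allI)
      fix n
      interpret P: real_distribution "p n" by (rule real_distribution_p)
      have "char (array_law (p n) (b n) (Suc (k n))) t - char (array_law (p n) (b n) (k n)) t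
        = iexp (t * b n) * char (p n) t ^ k n * (char (p n) t - 1)"
        by (simp add: P.char_array_law algebra_simps)
      also have "norm \<dots> \<le> 1 * 1 * norm (char (p n) t - 1)"
        unfolding norm_mult norm_power using P.cmod_char_le_1[of t]
        by (intro mult_mono power_le_one) auto
      also have "\<dots> = norm (\<Psi> n t) / real (Suc (k n))" by (simp add: char_p norm_divide del: of_nat_Suc)
      also have "\<dots> \<le> 12 / (real n + 1)"
      proof -
        have "norm (\<Psi> n t) * (real n + 1) \<le> (2 * \<Lambda> n) * (real n + 1)"
          using \<Psi>_bounds[of n t] by (intro mult_right_mono) auto
        also have "\<dots> \<le> (\<Lambda> n + 1)\<^sup>2 * (real n + 1)"
          using \<Lambda>_nonneg[of n] by (intro mult_right_mono) (auto simp: power2_eq_square algebra_simps)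
        also have "\<dots> \<le> 12 * real (Suc (k n))" using k_ge[of n] by (simp add: mult.commute)
        finally show ?thesis by (simp add: field_simps)
      qed
      finally show "norm (char (array_law (p n) (b n) (Suc (k n))) t - char (array_law (p n) (b n) (k n)) t) \<le> 12 / (real n + 1)" .
    qed
    from tendsto_diff[OF main[of t] this] show ?thesis by simp
  qed
  then show "weak_conv_m (\<lambda>n. array_law (p n) (b n) (k n)) proj"
    by (intro levy_continuity real_distribution.real_distribution_array_law real_distribution_p real_distribution_proj)
qed

end

section \<open>Tails of a projection against the Levy measure\<close>

context levy_projection
begin

lemma proj_tail: "measure proj {x. \<bar>x\<bar> > r} = measure \<mu> {x. \<bar>e \<bullet> x\<bar> > r}"
  unfolding proj_def using sets_eq_imp_space_eq[OF sets_\<mu>]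
  by (subst measure_distr) (auto simp: vimage_def)

lemma p_tail:
  assumes "R \<ge> 1"
  shows "measure (p n) {x. \<bar>x\<bar> > R} = measure \<nu> {x. \<bar>e \<bullet> x\<bar> > R} / real (Suc (k n))"
proof -
  let ?F = "indicator {x. \<bar>x\<bar> > R} :: real \<Rightarrow> real"
  have iF: "integrable \<nu> (\<lambda>x. indicator {x. norm x > \<delta> n} x *\<^sub>R ?F (e \<bullet> x))"
    by (rule integrable_N_bounded[where K = 1 and F = ?F]) (auto simp: indicator_def)
  \<comment> \<open>The symmetric jumps that imitate the Gaussian part have size
    \<open>\<delta> n\<close>, at most 1 and so at most \<open>R\<close>; they are invisible to this
    tail.\<close>
  have F0: "?F 0 = 0" "?F (\<delta> n) = 0" "?F (- \<delta> n) = 0" using assms \<delta>_bounds[of n] by (auto simp: indicator_def)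
  have sp: "space (p n) = UNIV" by (simp add: p_def)
  have "measure (p n) {x. \<bar>x\<bar> > R} = integral\<^sup>L (p n) ?F" using sp by simp
  also have "\<dots> = ?F 0 + (1 / real (Suc (k n))) *\<^sub>R (LINT x|N n. ?F x - ?F 0)"
    by (rule integral_p) (simp, rule integrable_N[where F = ?F, OF _ iF], simp)
  also have "(LINT x|N n. ?F x - ?F 0) = integral\<^sup>L (N n) ?F" using F0 by simp
  also have "\<dots> = (LINT x|\<nu>. indicator {x. norm x > \<delta> n} x *\<^sub>R ?F (e \<bullet> x))
        + (gauss / (2 * (\<delta> n)\<^sup>2)) *\<^sub>R (?F (\<delta> n) + ?F (- \<delta> n))"
    by (rule integral_N[where F = ?F, OF _ iF]) simp
  also have "(LINT x|\<nu>. indicator {x. norm x > \<delta> n} x *\<^sub>R ?F (e \<bullet> x)) = (LINT x|\<nu>. indicator {x. \<bar>e \<bullet> x\<bar> > R} x)"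
  proof (intro Bochner_Integration.integral_cong refl)
    fix x :: 'a
    have "norm x > \<delta> n" if "\<bar>e \<bullet> x\<bar> > R" using that inner_le[of x] assms \<delta>_bounds[of n] by linarith
    then show "indicator {x. norm x > \<delta> n} x *\<^sub>R ?F (e \<bullet> x) = indicator {x. \<bar>e \<bullet> x\<bar> > R} x"
      by (auto simp: indicator_def)
  qed
  finally show ?thesis using F0 space_\<nu> by simp
qed

text \<open>In every row the tail of one summand at \<open>R\<close> times the number of summands is
  exactly the Levy tail \<open>q\<close>. If the remaining summands stay below \<open>y\<close> with
  probability at least 1/2, the single big jump gives \<open>q * (1 / 2 - q)\<close>. Tightness of
  the projection provides such a \<open>y\<close>.\<close>

lemma tail_ge_levy_tail:
  obtains y where "y \<ge> 0" "\<And>R. R \<ge> y + 1 \<Longrightarrow>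
    measure \<nu> {x. \<bar>e \<bullet> x\<bar> > R} * (1 / 2 - measure \<nu> {x. \<bar>e \<bullet> x\<bar> > R}) \<le> measure \<mu> {x. \<bar>e \<bullet> x\<bar> > R - y}"
proof -
  interpret P: real_distribution proj by (rule real_distribution_proj)
  have "(\<lambda>n. measure proj {x. \<bar>x\<bar> > real n}) \<longlonglongrightarrow> measure proj (\<Inter>n. {x. \<bar>x\<bar> > real n})"
  proof (rule P.finite_Lim_measure_decseq)
    show "decseq (\<lambda>n. {x::real. \<bar>x\<bar> > real n})" by (auto simp: decseq_def)
  qed auto
  moreover have "(\<Inter>n. {x::real. \<bar>x\<bar> > real n}) = {}"
    by (auto simp: not_less) (meson not_less real_arch_simple)
  ultimately have "\<forall>\<^sub>F n in sequentially. measure proj {x. \<bar>x\<bar> > real n} < 1 / 2"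
    by (auto dest!: order_tendstoD(2)[where a = "1/2"])
  then obtain y0 :: nat where y0: "measure proj {x. \<bar>x\<bar> > real y0} < 1 / 2"
    by (auto simp: eventually_sequentially)
  define y where "y = real y0 + 1"
  have dist: "real_distribution (array_law (p n) (b n) j)" for n j
    by (intro real_distribution.real_distribution_array_law real_distribution_p)
  have ev: "\<forall>\<^sub>F n in sequentially. measure (array_law (p n) (b n) (k n)) {x. \<bar>x\<bar> > y} < 1 / 2"
    using weak_conv_tail_less[OF dist real_distribution_proj array_conv y0] by (simp add: y_def)
  show ?thesis
  \<comment> \<open>Each passage between the limit and the array shifts a threshold by 1: once
    already inside \<open>y = real y0 + 1\<close>, and once more here.\<close>
  proof (rule that[of "y + 1"])
    show "y + 1 \<ge> 0" by (simp add: y_def)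
    fix R assume R: "R \<ge> y + 1 + 1"
    define q where "q = measure \<nu> {x. \<bar>e \<bullet> x\<bar> > R}"
    have q0: "q \<ge> 0" by (simp add: q_def)
    show "measure \<nu> {x. \<bar>e \<bullet> x\<bar> > R} * (1 / 2 - measure \<nu> {x. \<bar>e \<bullet> x\<bar> > R}) \<le> measure \<mu> {x. \<bar>e \<bullet> x\<bar> > R - (y + 1)}"
    proof (rule ccontr)
      \<comment> \<open>The weak limit transports strict upper bounds from \<open>proj\<close> to
        the array, so the failure of the inequality is moved to the array and refuted there.\<close>
      assume "\<not> ?thesis"
      then have "measure proj {x. \<bar>x\<bar> > R - (y + 1)} < q * (1 / 2 - q)" by (simp add: proj_tail q_def)
      from weak_conv_tail_less[OF dist real_distribution_proj array_conv_Suc this]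
      have "\<forall>\<^sub>F n in sequentially. measure (array_law (p n) (b n) (Suc (k n))) {x. \<bar>x\<bar> > R - y} < q * (1 / 2 - q)"
        by (simp add: algebra_simps)
      with ev have "\<forall>\<^sub>F n in sequentially. False"
      proof eventually_elim
        case (elim n)
        interpret L: real_distribution "array_law (p n) (b n) (k n)" by (rule dist)
        have pt: "measure (p n) {x. \<bar>x\<bar> > R} = q / real (Suc (k n))"
          unfolding q_def using R by (intro p_tail) (simp add: y_def)
        have "{x. \<bar>x\<bar> \<le> y} = space (array_law (p n) (b n) (k n)) - {x. \<bar>x\<bar> > y}"
          using sets_eq_imp_space_eq[OF L.events_eq_borel] by auto
        then have "measure (array_law (p n) (b n) (k n)) {x. \<bar>x\<bar> \<le> y} = 1 - measure (array_law (p n) (b n) (k n)) {x. \<bar>x\<bar> > y}"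
          by (simp only:, intro L.prob_compl) simp
        then have half: "measure (array_law (p n) (b n) (k n)) {x. \<bar>x\<bar> \<le> y} \<ge> 1 / 2" using elim by simp
        have "real (k n) * (q / real (Suc (k n))) \<le> q" using q0 by (simp add: field_simps)
        then have "q * (1 / 2 - q) \<le> q * (measure (array_law (p n) (b n) (k n)) {x. \<bar>x\<bar> \<le> y} - real (k n) * (q / real (Suc (k n))))"
          using half q0 by (intro mult_left_mono) auto
        also have "\<dots> = real (Suc (k n)) * (q / real (Suc (k n))) *
            (measure (array_law (p n) (b n) (k n)) {x. \<bar>x\<bar> \<le> y} - real (k n) * (q / real (Suc (k n))))" by simp
        also have "\<dots> \<le> measure (array_law (p n) (b n) (Suc (k n))) {x. \<bar>x\<bar> > R - y}"
          using real_distribution.one_big_jump[OF real_distribution_p[of n], where r = "R - y" and y = y and R = R and b = "b n" and k = "k n"] by (simp add: pt)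
        finally show False using elim by simp
      qed
      then show False by simp
    qed
  qed
qed

text \<open>Markov's inequality for \<open>H\<close> is applied to the rows of the array, with a
  moment bound that does not depend on \<open>n\<close>, and only the resulting tail bound is passed
  to the weak limit. The factor lost at each summand is controlled through
  \<open>1 + x \<le> exp x\<close>.\<close>

lemma tail_le_of_levy_moment:
  fixes H :: "real \<Rightarrow> real"
  assumes H0: "H 0 = 1" and Hmono: "\<And>x y. 0 \<le> x \<Longrightarrow> x \<le> y \<Longrightarrow> H x \<le> H y" and c: "c \<ge> 0"
    and sub: "\<And>x y. x \<ge> 0 \<Longrightarrow> y \<ge> 0 \<Longrightarrow> H (x + y) \<le> c * H x * H y"
    and C: "C \<ge> 0" and \<beta>: "\<beta> \<ge> 0" and exp_bound: "\<And>x. x \<ge> 0 \<Longrightarrow> H x \<le> C * exp (\<beta> * x)"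
    and moment: "integrable \<nu> (\<lambda>x. indicator {x. norm x > 1} x * H (norm x))"
  obtains B where "B \<ge> 0" "\<And>r. r \<ge> 0 \<Longrightarrow> measure \<mu> {x. \<bar>e \<bullet> x\<bar> > r + 1} \<le> B / H r"
proof -
  have Hge1: "H x \<ge> 1" if "x \<ge> 0" for x using Hmono[of 0 x] H0 that by simp
  have Hpos: "H x \<ge> 0" if "x \<ge> 0" for x using Hge1[OF that] by simp
  have "mono (\<lambda>x. H (max 0 x))" by (auto simp: mono_def intro!: Hmono)
  then have [measurable]: "(\<lambda>x. H (max 0 x)) \<in> borel_measurable borel" by (rule borel_measurable_mono)
  have "(\<lambda>x::real. H (max 0 \<bar>x\<bar>)) \<in> borel_measurable borel" by measurable
  then have H_meas [measurable]: "(\<lambda>x. H \<bar>x\<bar>) \<in> borel_measurable borel" by simp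
  let ?w = "step_weight H c \<beta>"
  have w_meas [measurable]: "?w s \<in> borel_measurable borel" for s
    unfolding step_weight_def by measurable
  have w0: "?w s 0 = 1" for s by (simp add: step_weight_def)
  have w_pos: "?w s x \<ge> 0" for s x using c Hpos by (auto simp: step_weight_def)
  \<comment> \<open>The term \<open>\<beta>\<^sup>2 * exp \<beta>\<close> bounds the Taylor
    remainder inside the unit ball. The terms \<open>exp \<beta>\<close> and 1 cover points outside
    it whose projection is still at most 1 in absolute value.\<close>
  define K where "K = \<beta>\<^sup>2 * exp \<beta> + exp \<beta> + 1"
  define G where "G x = K * min 1 ((norm x)\<^sup>2) + c * (indicator {x. norm x > 1} x * H (norm x))" for x :: 'a
  have G_int: "integrable \<nu> G" unfolding G_def
    by (intro Bochner_Integration.integrable_add integrable_mult_right int_min moment)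
  have [measurable]: "cball (0::'a) 1 \<in> sets borel" by simp
  \<comment> \<open>The weight minus 1, compensated by its linear term inside the unit ball:
    quadratically small at 0 and hence integrable. The linear term is returned exactly by the drift
    \<open>b n\<close>.\<close>
  define D where "D s x = ?w s (e \<bullet> x) - 1 - s * \<beta> * (indicator (cball 0 1) x * (e \<bullet> x))" for s and x :: 'a
  have D_meas [measurable]: "D s \<in> borel_measurable borel" for s unfolding D_def by measurable
  have D_bound: "\<bar>D s x\<bar> \<le> G x" if s: "s \<in> {1, -1}" for s x
  proof (cases "norm x \<le> 1")
    case True
    have ex: "\<bar>e \<bullet> x\<bar> \<le> 1" using inner_le[of x] True by simp
    have "\<bar>s * \<beta> * (e \<bullet> x)\<bar> = \<beta> * \<bar>e \<bullet> x\<bar>" using s \<beta> by (auto simp: abs_mult)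
    also have "\<dots> \<le> \<beta>" using ex \<beta> by (simp add: mult_left_le)
    finally have u: "\<bar>s * \<beta> * (e \<bullet> x)\<bar> \<le> \<beta>" .
    have D: "D s x = exp (s * \<beta> * (e \<bullet> x)) - 1 - s * \<beta> * (e \<bullet> x)"
      using True ex by (simp add: D_def step_weight_def)
    have "D s x \<ge> 0" unfolding D using exp_ge_add_one_self[of "s * \<beta> * (e \<bullet> x)"] by linarith
    moreover have "D s x \<le> (s * \<beta> * (e \<bullet> x))\<^sup>2 * exp \<beta>" unfolding D by (rule exp_remainder_le[OF u])
    moreover have "(s * \<beta> * (e \<bullet> x))\<^sup>2 * exp \<beta> = (\<beta>\<^sup>2 * exp \<beta>) * (e \<bullet> x)\<^sup>2" using s by (auto simp: power_mult_distrib)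
    moreover have "\<dots> \<le> K * (norm x)\<^sup>2"
      using power_mono[OF inner_le[of x], of 2] by (intro mult_mono) (auto simp: K_def)
    moreover have "(norm x)\<^sup>2 = min 1 ((norm x)\<^sup>2)" using True by (simp add: power_le_one)
    ultimately have "\<bar>D s x\<bar> \<le> K * min 1 ((norm x)\<^sup>2)" by simp
    then show ?thesis using True by (simp add: G_def)
  next
    case False
    have m: "min 1 ((norm x)\<^sup>2) = 1" using False by (simp add: min_def one_le_power not_le order_less_imp_le)
    have "?w s (e \<bullet> x) \<le> exp \<beta> + c * H (norm x)"
    proof (cases "\<bar>e \<bullet> x\<bar> \<le> 1")
      case True
      have "s * \<beta> * (e \<bullet> x) \<le> \<beta> * \<bar>e \<bullet> x\<bar>" using s \<beta> by (auto simp: abs_if mult_nonneg_nonneg mult_le_0_iff)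
      also have "\<dots> \<le> \<beta>" using True \<beta> by (simp add: mult_left_le)
      finally have "?w s (e \<bullet> x) \<le> exp \<beta>" using True by (simp add: step_weight_def)
      then show ?thesis using c Hpos[of "norm x"] by (simp add: add_increasing2)
    next
      case False
      then have "?w s (e \<bullet> x) = c * H \<bar>e \<bullet> x\<bar>" by (simp add: step_weight_def)
      also have "\<dots> \<le> c * H (norm x)" using c inner_le[of x] by (intro mult_left_mono Hmono) auto
      finally show ?thesis by (simp add: add_increasing)
    qed
    moreover have "\<beta>\<^sup>2 * exp \<beta> \<ge> 0" "exp \<beta> \<ge> 0" "c * H (norm x) \<ge> 0" using c Hpos[of "norm x"] by auto
    moreover have "D s x = ?w s (e \<bullet> x) - 1" "G x = K + c * H (norm x)" using False m by (auto simp: D_def G_def)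
    ultimately show ?thesis using w_pos[of s "e \<bullet> x"] unfolding K_def by linarith
  qed
  \<comment> \<open>Contributions of the drift, of the jumps and of the Gaussian part, all
    independent of \<open>n\<close>.\<close>
  define B0 where "B0 = \<bar>\<beta> * (e \<bullet> \<gamma>)\<bar> + (LINT x|\<nu>. G x) + gauss * (\<beta>\<^sup>2 * exp \<beta>)"
  have G0: "G x \<ge> 0" for x using D_bound[of 1 x] abs_ge_zero order_trans by blast
  define E where "E n s = (LINT x|N n. ?w s x - 1)" for n s
  have i_D: "integrable \<nu> (\<lambda>x. indicator {x. norm x > \<delta> n} x *\<^sub>R D s x)" if "s \<in> {1, -1}" for n s
  proof (rule Bochner_Integration.integrable_bound[OF G_int])
    show "(\<lambda>x. indicator {x. norm x > \<delta> n} x *\<^sub>R D s x) \<in> borel_measurable \<nu>" by (rule meas_\<nu>) measurable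
    show "AE x in \<nu>. norm (indicator {x. norm x > \<delta> n} x *\<^sub>R D s x) \<le> norm (G x)"
      using D_bound[OF that] G0 by (intro AE_I2) (auto simp: indicator_def)
  qed
  have split: "indicator {x. norm x > \<delta> n} x *\<^sub>R (?w s (e \<bullet> x) - 1) =
      indicator {x. norm x > \<delta> n} x *\<^sub>R D s x + s * \<beta> * (indicator {x. norm x > \<delta> n} x *\<^sub>R (indicator (cball 0 1) x * (e \<bullet> x)))" for n s x
    by (simp add: D_def algebra_simps)
  have i_w1: "integrable \<nu> (\<lambda>x. indicator {x. norm x > \<delta> n} x *\<^sub>R (?w s (e \<bullet> x) - 1))" if "s \<in> {1, -1}" for n s
    unfolding split by (intro Bochner_Integration.integrable_add integrable_mult_right i_D integrable_truncated_drift that)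
  have w1_N: "integrable (N n) (\<lambda>x. ?w s x - 1)" if "s \<in> {1, -1}" for n s
    using i_w1[OF that] by (rule integrable_N[where F = "\<lambda>x. ?w s x - 1", rotated]) measurable
  have w_N: "integrable (N n) (?w s)" if "s \<in> {1, -1}" for n s
  proof -
    interpret finite_measure "N n" by (rule finite_measure_N)
    have "integrable (N n) (\<lambda>x. (?w s x - 1) + 1)" by (intro Bochner_Integration.integrable_add w1_N that) auto
    then show ?thesis by simp
  qed
  \<comment> \<open>The linear terms of the jumps \<open>\<delta> n\<close> and
    \<open>- \<delta> n\<close> cancel. The quadratic remainder carries a factor
    \<open>(\<delta> n)\<^sup>2\<close>, which the intensity divides out.\<close>
  have coin: "gauss / (2 * (\<delta> n)\<^sup>2) * ((?w s (\<delta> n) - 1) + (?w s (- \<delta> n) - 1)) \<le> gauss * (\<beta>\<^sup>2 * exp \<beta>)" if s: "s \<in> {1, -1}" for n s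
  proof -
    have d: "\<delta> n \<le> 1" "\<delta> n > 0" using \<delta>_bounds[of n] by auto
    have u: "\<bar>s * \<beta> * z\<bar> \<le> \<beta>" if "\<bar>z\<bar> = \<delta> n" for z
      using s \<beta> d that by (auto simp: abs_mult mult_left_le)
    have "exp (s * \<beta> * \<delta> n) - 1 - s * \<beta> * \<delta> n \<le> (s * \<beta> * \<delta> n)\<^sup>2 * exp \<beta>"
      "exp (s * \<beta> * - \<delta> n) - 1 - s * \<beta> * - \<delta> n \<le> (s * \<beta> * - \<delta> n)\<^sup>2 * exp \<beta>"
      using d exp_remainder_le[OF u[of "\<delta> n"]] exp_remainder_le[OF u[of "- \<delta> n"]] by auto
    moreover have "(s * \<beta> * \<delta> n)\<^sup>2 * exp \<beta> = \<beta>\<^sup>2 * exp \<beta> * (\<delta> n)\<^sup>2" "(s * \<beta> * - \<delta> n)\<^sup>2 * exp \<beta> = \<beta>\<^sup>2 * exp \<beta> * (\<delta> n)\<^sup>2"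
      using s by (auto simp: power_mult_distrib)
    ultimately have "(?w s (\<delta> n) - 1) + (?w s (- \<delta> n) - 1) \<le> 2 * (\<beta>\<^sup>2 * exp \<beta> * (\<delta> n)\<^sup>2)"
      using d by (simp add: step_weight_def)
    then have "gauss / (2 * (\<delta> n)\<^sup>2) * ((?w s (\<delta> n) - 1) + (?w s (- \<delta> n) - 1)) \<le> gauss / (2 * (\<delta> n)\<^sup>2) * (2 * (\<beta>\<^sup>2 * exp \<beta> * (\<delta> n)\<^sup>2))"
      using gauss_nonneg by (intro mult_left_mono) auto
    also have "\<dots> = gauss * (\<beta>\<^sup>2 * exp \<beta>)" using d by (simp add: field_simps)
    finally show ?thesis .
  qed
  have E_bound: "s * \<beta> * b n + E n s \<le> B0" if s: "s \<in> {1, -1}" for n s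
  proof -
    have "E n s = (LINT x|\<nu>. indicator {x. norm x > \<delta> n} x *\<^sub>R (?w s (e \<bullet> x) - 1))
        + (gauss / (2 * (\<delta> n)\<^sup>2)) *\<^sub>R ((?w s (\<delta> n) - 1) + (?w s (- \<delta> n) - 1))"
      unfolding E_def by (rule integral_N[where F = "\<lambda>x. ?w s x - 1"]) (use i_w1[OF s] in measurable)
    also have "(LINT x|\<nu>. indicator {x. norm x > \<delta> n} x *\<^sub>R (?w s (e \<bullet> x) - 1)) =
       (LINT x|\<nu>. indicator {x. norm x > \<delta> n} x *\<^sub>R D s x)
        + s * \<beta> * (LINT x|\<nu>. indicator {x. norm x > \<delta> n} x *\<^sub>R (indicator (cball 0 1) x * (e \<bullet> x)))"
      unfolding split
      by (subst Bochner_Integration.integral_add[OF i_D[OF s] integrable_mult_right[OF integrable_truncated_drift]])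
        (simp only: integral_mult_right_zero)
    finally have "s * \<beta> * b n + E n s = s * \<beta> * (e \<bullet> \<gamma>) + (LINT x|\<nu>. indicator {x. norm x > \<delta> n} x *\<^sub>R D s x)
        + gauss / (2 * (\<delta> n)\<^sup>2) * ((?w s (\<delta> n) - 1) + (?w s (- \<delta> n) - 1))"
      by (simp add: b_def right_diff_distrib)
    moreover have "(LINT x|\<nu>. indicator {x. norm x > \<delta> n} x *\<^sub>R D s x) \<le> (LINT x|\<nu>. G x)"
      using D_bound[OF s] G0 by (intro integral_mono i_D s G_int) (auto simp: indicator_def abs_le_iff)
    moreover have "s * \<beta> * (e \<bullet> \<gamma>) \<le> \<bar>\<beta> * (e \<bullet> \<gamma>)\<bar>" using s by auto
    moreover note coin[OF s, of n]
    ultimately show ?thesis unfolding B0_def by linarith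
  qed
  have w_p: "(\<integral>\<^sup>+x. ennreal (?w s x) \<partial>p n) \<le> ennreal (exp (E n s / real (Suc (k n))))" if s: "s \<in> {1, -1}" for n s
  proof -
    have "integrable (p n) (?w s)" unfolding p_def
      using p_coeff[of n] w_N[OF s, of n] by (intro integrable_comb_measure) (auto simp: integrable_iff_bounded nn_integral_return)
    then have "(\<integral>\<^sup>+x. ennreal (?w s x) \<partial>p n) = ennreal (integral\<^sup>L (p n) (?w s))"
      using w_pos by (intro nn_integral_eq_integral) auto
    also have "integral\<^sup>L (p n) (?w s) = 1 + E n s / real (Suc (k n))"
      by (subst integral_p) (auto simp: w_N[OF s] w0 E_def)
    also have "ennreal (1 + E n s / real (Suc (k n))) \<le> ennreal (exp (E n s / real (Suc (k n))))"
      by (intro ennreal_leI exp_ge_add_one_self)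
    finally show ?thesis .
  qed
  define B where "B = c * C * (exp B0 + exp B0)"
  have B0: "B \<ge> 0" using c C by (simp add: B_def)
  have law: "(\<integral>\<^sup>+x. ennreal (H \<bar>x\<bar>) \<partial>array_law (p n) (b n) (Suc (k n))) \<le> ennreal B" for n
  proof -
    have "(\<integral>\<^sup>+x. ennreal (H \<bar>x\<bar>) \<partial>array_law (p n) (b n) (Suc (k n))) \<le>
      ennreal (c * C * (exp (\<beta> * b n + E n 1) + exp (- \<beta> * b n + E n (-1))))"
      by (rule real_distribution.nn_integral_array_law_le[OF real_distribution_p H0 Hmono c sub C \<beta> exp_bound w_p]) auto
    also have "\<dots> \<le> ennreal B" unfolding B_def
      using E_bound[of 1 n] E_bound[of "-1" n] c C by (intro ennreal_leI mult_left_mono add_mono) auto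
    finally show ?thesis .
  qed
  have tail: "measure (array_law (p n) (b n) (Suc (k n))) {x. \<bar>x\<bar> > r} \<le> B / H r" if r: "r \<ge> 0" for n r
  proof -
    let ?L = "array_law (p n) (b n) (Suc (k n))"
    interpret L: real_distribution ?L
      by (intro real_distribution.real_distribution_array_law real_distribution_p)
    have "ennreal (H r) * emeasure ?L {x. \<bar>x\<bar> > r} = (\<integral>\<^sup>+x. ennreal (H r) * indicator {x. \<bar>x\<bar> > r} x \<partial>?L)"
      by (simp add: nn_integral_cmult_indicator)
    also have "\<dots> \<le> (\<integral>\<^sup>+x. ennreal (H \<bar>x\<bar>) \<partial>?L)"
      using r by (intro nn_integral_mono) (auto simp: indicator_def intro!: ennreal_leI Hmono)
    also have "\<dots> \<le> ennreal B" by (rule law)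
    finally have "ennreal (H r * measure ?L {x. \<bar>x\<bar> > r}) \<le> ennreal B"
      using Hpos[OF r] by (simp add: L.emeasure_eq_measure ennreal_mult)
    then have "H r * measure ?L {x. \<bar>x\<bar> > r} \<le> B" using B0 by simp
    then show ?thesis using Hge1[OF r] by (simp add: field_simps)
  qed
  show ?thesis
  proof (rule that[OF B0])
    fix r :: real assume r: "r \<ge> 0"
    have "measure proj {x. \<bar>x\<bar> > r + 1} \<le> B / H r"
      by (rule weak_conv_tail_le[OF _ real_distribution_proj array_conv_Suc])
        (auto intro!: always_eventually tail[OF r] real_distribution.real_distribution_array_law real_distribution_p)
    then show "measure \<mu> {x. \<bar>e \<bullet> x\<bar> > r + 1} \<le> B / H r" by (simp add: proj_tail)
  qed
qed

end

section \<open>Radial tails of the Levy measure\<close>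

text \<open>Compactness of the sphere gives finitely many balls of radius \<open>1 - b\<close>, and
  unit vectors at distance below \<open>1 - b\<close> have inner product above \<open>b\<close>.
  Taking \<open>b\<close> close to 1 makes the passage to finitely many projections cost an
  arbitrarily small dilation.\<close>

lemma finite_direction_net:
  fixes b :: real
  assumes "b < 1"
  obtains E :: "'a::euclidean_space set" where "finite E" "\<And>e. e \<in> E \<Longrightarrow> norm e = 1"
    "\<And>x. \<exists>e\<in>E. b * norm x \<le> \<bar>e \<bullet> x\<bar>"
proof -
  have "compact (sphere (0::'a) 1)" by simp
  then obtain E where E: "finite E" "E \<subseteq> sphere (0::'a) 1" "sphere 0 1 \<subseteq> (\<Union>e\<in>E. ball e (1 - b))"
    using seq_compact_imp_totally_bounded[of "sphere (0::'a) 1"] assms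
    unfolding seq_compact_eq_compact by (metis diff_gt_0_iff_gt)
  show ?thesis
  proof (rule that[OF E(1)])
    show "norm e = 1" if "e \<in> E" for e using E(2) that by auto
    fix x :: 'a
    obtain v :: 'a where v: "norm v = 1" using vector_choose_size[of 1] by auto
    define u where "u = (if x = 0 then v else x /\<^sub>R norm x)"
    have u: "norm u = 1" "x = norm x *\<^sub>R u" using v by (auto simp: u_def)
    then obtain e where e: "e \<in> E" "dist e u < 1 - b" using E(3) by auto
    have "1 - e \<bullet> u = (u - e) \<bullet> u" using u(1) by (simp add: inner_diff_left norm_eq_1)
    also have "\<dots> \<le> norm (u - e) * norm u" by (rule norm_cauchy_schwarz)
    finally have "b \<le> e \<bullet> u" using e(2) u(1) by (simp add: dist_norm norm_minus_commute)
    then have "norm x * b \<le> norm x * (e \<bullet> u)" by (intro mult_left_mono) auto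
    also have "\<dots> = e \<bullet> x" by (subst (2) u(2)) simp
    finally show "\<exists>e\<in>E. b * norm x \<le> \<bar>e \<bullet> x\<bar>" using e(1) by (auto simp: mult.commute intro!: bexI[of _ e])
  qed
qed

lemma nn_integral_inverse_Ioc:
  assumes "0 < r" "r \<le> s"
  shows "(\<integral>\<^sup>+x. indicator {r<..s} x * ennreal (1 / x) \<partial>lborel) = ennreal (ln s - ln r)"
proof -
  have "(\<integral>\<^sup>+x. ennreal (1 / x) * indicator {r..s} x \<partial>lborel) = ennreal (ln s - ln r)"
    using assms by (intro nn_integral_FTC_Icc) (auto intro!: derivative_eq_intros)
  moreover have "(\<integral>\<^sup>+x. indicator {r<..s} x * ennreal (1 / x) \<partial>lborel) = (\<integral>\<^sup>+x. ennreal (1 / x) * indicator {r..s} x \<partial>lborel)"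
    using AE_lborel_singleton[of r] by (intro nn_integral_cong_AE) (auto elim!: eventually_mono simp: indicator_def)
  ultimately show ?thesis by simp
qed

locale radial_levy =
  fixes \<nu> :: "'a::euclidean_space measure" and \<sigma> :: "'a measure" and k :: "'a \<Rightarrow> real \<Rightarrow> real"
  assumes rep: "selfdecomposable_representation \<nu> \<sigma> k"
    and tail_fin: "\<And>d. d > 0 \<Longrightarrow> emeasure \<nu> {x. norm x > d} < \<infinity>"
begin

definition K :: "real \<Rightarrow> real" where "K r = (LINT \<xi>|\<sigma>. k \<xi> r)"

lemma space_\<sigma>: "space \<sigma> = sphere 0 1"
proof -
  have "sets \<sigma> = sets (restrict_space borel (sphere (0::'a) 1))" using rep by (simp add: selfdecomposable_representation_def)
  from sets_eq_imp_space_eq[OF this] show ?thesis by (simp add: space_restrict_space)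
qed

lemma k_nonneg: "\<xi> \<in> space \<sigma> \<Longrightarrow> r > 0 \<Longrightarrow> 0 \<le> k \<xi> r"
  and k_meas: "r > 0 \<Longrightarrow> (\<lambda>\<xi>. k \<xi> r) \<in> borel_measurable \<sigma>"
  and k_antimono: "\<xi> \<in> space \<sigma> \<Longrightarrow> 0 < r \<Longrightarrow> r \<le> s \<Longrightarrow> k \<xi> s \<le> k \<xi> r"
  using rep unfolding selfdecomposable_representation_def space_\<sigma>
  by (auto simp: monotone_on_def)

lemma emeasure_\<nu>: "B \<in> sets borel \<Longrightarrow> emeasure \<nu> B =
    (\<integral>\<^sup>+\<xi>. (\<integral>\<^sup>+r\<in>{0<..}. indicator B (r *\<^sub>R \<xi>) * ennreal (k \<xi> r / r) \<partial>lborel) \<partial>\<sigma>)"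
  using rep unfolding selfdecomposable_representation_def by blast

text \<open>As \<open>k \<xi>\<close> decreases, its value at the inner radius bounds it on the
  whole shell, and the remaining \<open>ds / s\<close> integrates to \<open>ln q\<close> whatever
  the radius.\<close>

lemma shell_upper_nn:
  assumes "0 < r" "1 < q"
  shows "emeasure \<nu> {x. r < norm x \<and> norm x \<le> q * r} \<le> (\<integral>\<^sup>+\<xi>. ennreal (k \<xi> r) \<partial>\<sigma>) * ennreal (ln q)"
proof -
  have "emeasure \<nu> {x. r < norm x \<and> norm x \<le> q * r} =
    (\<integral>\<^sup>+\<xi>. (\<integral>\<^sup>+s\<in>{0<..}. indicator {x. r < norm x \<and> norm x \<le> q * r} (s *\<^sub>R \<xi>) * ennreal (k \<xi> s / s) \<partial>lborel) \<partial>\<sigma>)"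
    by (rule emeasure_\<nu>) measurable
  also have "\<dots> \<le> (\<integral>\<^sup>+\<xi>. ennreal (k \<xi> r) * ennreal (ln q) \<partial>\<sigma>)"
  proof (rule nn_integral_mono)
    fix \<xi> assume xi: "\<xi> \<in> space \<sigma>"
    then have n: "norm \<xi> = 1" by (simp add: space_\<sigma>)
    have "(\<integral>\<^sup>+s\<in>{0<..}. indicator {x. r < norm x \<and> norm x \<le> q * r} (s *\<^sub>R \<xi>) * ennreal (k \<xi> s / s) \<partial>lborel)
      \<le> (\<integral>\<^sup>+s. ennreal (k \<xi> r) * (indicator {r<..q * r} s * ennreal (1 / s)) \<partial>lborel)"
    proof (rule nn_integral_mono)
      fix s :: real
      show "indicator {x. r < norm x \<and> norm x \<le> q * r} (s *\<^sub>R \<xi>) * ennreal (k \<xi> s / s) * indicator {0<..} s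
         \<le> ennreal (k \<xi> r) * (indicator {r<..q * r} s * ennreal (1 / s))"
        using k_antimono[OF xi, of r s] k_nonneg[OF xi, of r] assms n
        by (auto simp: indicator_def ennreal_mult[symmetric] intro!: ennreal_leI divide_right_mono)
    qed
    also have "\<dots> = ennreal (k \<xi> r) * ennreal (ln (q * r) - ln r)"
      using assms by (subst nn_integral_cmult) (auto simp: nn_integral_inverse_Ioc)
    also have "ln (q * r) - ln r = ln q" using assms by (simp add: ln_mult)
    finally show "(\<integral>\<^sup>+s\<in>{0<..}. indicator {x. r < norm x \<and> norm x \<le> q * r} (s *\<^sub>R \<xi>) * ennreal (k \<xi> s / s) \<partial>lborel)
      \<le> ennreal (k \<xi> r) * ennreal (ln q)" .
  qed
  also have "\<dots> = (\<integral>\<^sup>+\<xi>. ennreal (k \<xi> r) \<partial>\<sigma>) * ennreal (ln q)"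
    using k_meas[OF assms(1)] by (intro nn_integral_multc) auto
  finally show ?thesis .
qed

text \<open>The tail is bounded below by its part in the shell from \<open>r\<close> to
  \<open>q * r\<close>, where \<open>k \<xi>\<close> is at least its value at the outer
  radius.\<close>

lemma shell_lower_nn:
  assumes "0 < r" "1 < q"
  shows "(\<integral>\<^sup>+\<xi>. ennreal (k \<xi> (q * r)) \<partial>\<sigma>) * ennreal (ln q) \<le> emeasure \<nu> {x. r < norm x}"
proof -
  have qr: "q * r > 0" using assms by simp
  have "(\<integral>\<^sup>+\<xi>. ennreal (k \<xi> (q * r)) \<partial>\<sigma>) * ennreal (ln q) = (\<integral>\<^sup>+\<xi>. ennreal (k \<xi> (q * r)) * ennreal (ln q) \<partial>\<sigma>)"
    using k_meas[OF qr] by (intro nn_integral_multc[symmetric]) auto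
  also have "\<dots> \<le> (\<integral>\<^sup>+\<xi>. (\<integral>\<^sup>+s\<in>{0<..}. indicator {x. r < norm x} (s *\<^sub>R \<xi>) * ennreal (k \<xi> s / s) \<partial>lborel) \<partial>\<sigma>)"
  proof (rule nn_integral_mono)
    fix \<xi> assume xi: "\<xi> \<in> space \<sigma>"
    then have n: "norm \<xi> = 1" by (simp add: space_\<sigma>)
    have "ennreal (k \<xi> (q * r)) * ennreal (ln q) = ennreal (k \<xi> (q * r)) * ennreal (ln (q * r) - ln r)"
      using assms by (simp add: ln_mult)
    also have "\<dots> = (\<integral>\<^sup>+s. ennreal (k \<xi> (q * r)) * (indicator {r<..q * r} s * ennreal (1 / s)) \<partial>lborel)"
      using assms by (subst nn_integral_cmult) (auto simp: nn_integral_inverse_Ioc)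
    also have "\<dots> \<le> (\<integral>\<^sup>+s\<in>{0<..}. indicator {x. r < norm x} (s *\<^sub>R \<xi>) * ennreal (k \<xi> s / s) \<partial>lborel)"
    proof (rule nn_integral_mono)
      fix s :: real
      show "ennreal (k \<xi> (q * r)) * (indicator {r<..q * r} s * ennreal (1 / s))
         \<le> indicator {x. r < norm x} (s *\<^sub>R \<xi>) * ennreal (k \<xi> s / s) * indicator {0<..} s"
        using k_antimono[OF xi, of s "q * r"] k_nonneg[OF xi qr] assms n
        by (auto simp: indicator_def ennreal_mult[symmetric] intro!: ennreal_leI divide_right_mono)
    qed
    finally show "ennreal (k \<xi> (q * r)) * ennreal (ln q)
        \<le> (\<integral>\<^sup>+s\<in>{0<..}. indicator {x. r < norm x} (s *\<^sub>R \<xi>) * ennreal (k \<xi> s / s) \<partial>lborel)" .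
  qed
  also have "\<dots> = emeasure \<nu> {x. r < norm x}" by (rule emeasure_\<nu>[symmetric]) measurable
  finally show ?thesis .
qed

text \<open>Finiteness comes from comparing with the Levy mass beyond \<open>r / 2\<close> by means
  of a shell of ratio 2. From here on the Bochner integral \<open>K r\<close> carries the same
  information as the nonnegative one.\<close>

lemma nn_integral_k: 
  assumes "r > 0" shows "(\<integral>\<^sup>+\<xi>. ennreal (k \<xi> r) \<partial>\<sigma>) = ennreal (K r)"
proof -
  have "(\<integral>\<^sup>+\<xi>. ennreal (k \<xi> r) \<partial>\<sigma>) * ennreal (ln 2) < \<infinity>"
    using shell_lower_nn[of "r / 2" 2] tail_fin[of "r / 2"] assms by (auto intro: le_less_trans)
  then have "(\<integral>\<^sup>+\<xi>. ennreal (k \<xi> r) \<partial>\<sigma>) < \<infinity>"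
    by (auto simp: ennreal_mult_less_top ennreal_mult_eq_top_iff less_top)
  moreover have "AE \<xi> in \<sigma>. 0 \<le> k \<xi> r" using k_nonneg assms by auto
  ultimately have "integrable \<sigma> (\<lambda>\<xi>. k \<xi> r)"
    using k_meas[OF assms] by (intro integrableI_nonneg) auto
  then show ?thesis unfolding K_def using k_nonneg assms by (intro nn_integral_eq_integral) auto
qed

lemma K_nonneg: "r > 0 \<Longrightarrow> K r \<ge> 0"
  unfolding K_def using k_nonneg by (intro integral_nonneg_AE) auto

lemma shell_upper:
  assumes "0 < r" "1 < q"
  shows "emeasure \<nu> {x. r < norm x \<and> norm x \<le> q * r} \<le> ennreal (K r * ln q)"
  using shell_upper_nn[OF assms] nn_integral_k[OF assms(1)] K_nonneg[OF assms(1)] assms(2)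
  by (simp add: ennreal_mult)

lemma shell_lower:
  assumes "0 < r" "1 < q"
  shows "K (q * r) * ln q \<le> measure \<nu> {x. norm x > r}"
proof -
  have "ennreal (K (q * r) * ln q) \<le> emeasure \<nu> {x. norm x > r}"
    using shell_lower_nn[OF assms] nn_integral_k[of "q * r"] K_nonneg[of "q * r"] assms
    by (simp add: ennreal_mult)
  also have "\<dots> = ennreal (measure \<nu> {x. norm x > r})"
    using tail_fin[OF assms(1)] by (intro emeasure_eq_ennreal_measure) auto
  finally show ?thesis by simp
qed

end

section \<open>Exponential bounds carried between the radial function, the Levy measure and the
  law\<close>

locale submultiplicative_scale = growth_scale +
  assumes submult: "submultiplicative (\<lambda>r. exp (r powr \<alpha> * f (ln (max r 1))))"
begin

lemma g_0 [simp]: "g 0 = 0" by (simp add: g_def)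

lemma g_subadditive:
  obtains d where "\<And>x y. x \<ge> 0 \<Longrightarrow> y \<ge> 0 \<Longrightarrow> g (x + y) \<le> d + g x + g y"
proof -
  obtain c where c: "c > 0" "\<And>x y. x \<ge> 0 \<Longrightarrow> y \<ge> 0 \<Longrightarrow> exp (g (x + y)) \<le> c * exp (g x) * exp (g y)"
    using submult unfolding submultiplicative_def g_def by blast
  show ?thesis
  proof (rule that[of "ln c"])
    fix x y :: real assume "x \<ge> 0" "y \<ge> 0"
    then have "exp (g (x + y)) \<le> exp (ln c + g x + g y)" using c by (simp add: exp_add)
    then show "g (x + y) \<le> ln c + g x + g y" by simp
  qed
qed

text \<open>Adding 1 to the argument costs a bounded amount, so \<open>g\<close> grows at most
  linearly. This supplies the exponential bound with which the small jumps are treated.\<close>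

lemma g_linear_bound:
  obtains L where "L \<ge> 0" "\<And>x. x \<ge> 0 \<Longrightarrow> g x \<le> L + L * x"
proof -
  obtain d where d: "\<And>x y. x \<ge> 0 \<Longrightarrow> y \<ge> 0 \<Longrightarrow> g (x + y) \<le> d + g x + g y" using g_subadditive by blast
  define L where "L = max 0 (d + g 1)"
  have nat: "g (real n) \<le> real n * L" for n
  proof (induction n)
    case (Suc n)
    have "g (real (Suc n)) \<le> d + g (real n) + g 1" using d[of "real n" 1] by (simp add: add.commute)
    also have "\<dots> \<le> real n * L + L" using Suc by (simp add: L_def)
    finally show ?case by (simp add: algebra_simps)
  qed simp
  show ?thesis
  proof (rule that[of L])
    show "L \<ge> 0" by (simp add: L_def)
    fix x :: real assume x: "x \<ge> 0"
    have "g x \<le> g (real (nat \<lceil>x\<rceil>))" using x by (intro g_mono) (auto simp: real_nat_ceiling_ge)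
    also have "\<dots> \<le> real (nat \<lceil>x\<rceil>) * L" by (rule nat)
    also have "\<dots> \<le> (1 + x) * L" using x \<open>L \<ge> 0\<close> by (intro mult_right_mono) linarith+
    finally show "g x \<le> L + L * x" by (simp add: algebra_simps)
  qed
qed

text \<open>Space beyond \<open>r0\<close> is cut into shells of ratio \<open>q\<close>. On a shell
  with inner radius \<open>r\<close> the weight is at most \<open>exp (\<kappa>2 * g r)\<close>,
  while the mass is at most \<open>ln q * exp (- \<kappa> * g r)\<close>. The products decay like
  \<open>exp (- (\<kappa> - \<kappa>2) * g r)\<close> and are summable over the geometric
  radii.\<close>

lemma levy_moment:
  fixes \<nu> :: "'b::euclidean_space measure"
  assumes "radial_levy \<nu> \<sigma> k" and tail: "tail_le (\<lambda>r. LINT \<xi>|\<sigma>. k \<xi> r) \<kappa>" and \<kappa>': "0 < \<kappa>'" "\<kappa>' < \<kappa>"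
    and s\<nu>: "sets \<nu> = sets borel"
  shows "integrable \<nu> (\<lambda>x. indicator {x. norm x > 1} x * exp (\<kappa>' * g (norm x)))"
proof -
  interpret radial_levy \<nu> \<sigma> k by fact
  obtain b where b: "0 < b" "b < 1" "\<kappa>' < \<kappa> * b powr \<alpha>" using shrink_factor[OF \<kappa>'] by blast
  \<comment> \<open>So close to 1 that moving from the inner to the outer radius of a shell
    multiplies \<kappa>' by \<open>q powr \<alpha>\<close> and still stays below \<kappa>.\<close>
  define q where "q = 1 / b"
  have q: "q > 1" using b by (simp add: q_def)
  have "\<kappa>' * q powr \<alpha> < \<kappa>" using b by (simp add: q_def powr_divide field_simps)
  then obtain \<kappa>2 where \<kappa>2: "\<kappa>' * q powr \<alpha> < \<kappa>2" "\<kappa>2 < \<kappa>" using dense by blast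
  have ev1: "\<forall>\<^sub>F r in at_top. g (q * r) \<le> (\<kappa>2 / \<kappa>') * g r"
    using q \<kappa>2 \<kappa>' by (intro g_scale_le) (auto simp: field_simps)
  have ev2: "\<forall>\<^sub>F r in at_top. K r \<le> exp (- \<kappa> * g r)" using tail by (simp add: tail_le_def K_def)
  have ev3: "\<forall>\<^sub>F r in at_top. \<forall>J. (\<Sum>j<J. exp (- (\<kappa> - \<kappa>2) * g (q ^ j * r))) \<le> 2 * exp (- (\<kappa> - \<kappa>2) * g r)"
    using geometric_tail_sum[of "\<kappa> - \<kappa>2" q] \<kappa>2 q by simp
  obtain r1 where r1: "\<And>r. r \<ge> r1 \<Longrightarrow> g (q * r) \<le> (\<kappa>2 / \<kappa>') * g r" "\<And>r. r \<ge> r1 \<Longrightarrow> K r \<le> exp (- \<kappa> * g r)"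
    "\<And>r J. r \<ge> r1 \<Longrightarrow> (\<Sum>j<J. exp (- (\<kappa> - \<kappa>2) * g (q ^ j * r))) \<le> 2 * exp (- (\<kappa> - \<kappa>2) * g r)"
    using eventually_conj[OF ev1 eventually_conj[OF ev2 ev3]] unfolding eventually_at_top_linorder by blast
  define r0 where "r0 = max 1 r1"
  have r0: "r0 \<ge> 1" "r0 \<ge> r1" by (auto simp: r0_def)
  define S where "S j = {x::'b. q ^ j * r0 < norm x \<and> norm x \<le> q * (q ^ j * r0)}" for j
  have qj: "q ^ j * r0 \<ge> r0" for j
    using mult_right_mono[of 1 "q ^ j" r0] q r0 by simp
  have S_meas: "S j \<in> sets \<nu>" for j
  proof -
    have "S j \<in> sets borel" unfolding S_def by measurable
    then show ?thesis using s\<nu> by simp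
  qed
  have T_meas: "{x::'b. norm x > 1} \<in> sets \<nu>"
  proof -
    have "{x::'b. norm x > 1} \<in> sets borel" by measurable
    then show ?thesis using s\<nu> by simp
  qed
  let ?H = "\<lambda>r. exp (\<kappa>' * g r)"
  have Hmono: "?H r \<le> ?H s" if "0 \<le> r" "r \<le> s" for r s using g_mono[OF that] \<kappa>' by simp
  have point: "ennreal (indicator {x. norm x > 1} x * ?H (norm x)) \<le>
      ennreal (?H r0) * indicator {x. norm x > 1} x + (\<Sum>j. ennreal (?H (q * (q ^ j * r0))) * indicator (S j) x)" for x :: 'b
  proof (cases "norm x \<le> r0")
    case True
    then have "?H (norm x) \<le> ?H r0" by (intro Hmono) auto
    then have "ennreal (indicator {x. norm x > 1} x * ?H (norm x)) \<le> ennreal (?H r0) * indicator {x. norm x > 1} x"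
      by (auto simp: indicator_def intro!: ennreal_leI)
    then show ?thesis by (rule order_trans) simp
  next
    case False
    have "\<exists>j. norm x \<le> q * (q ^ j * r0)"
    proof -
      obtain n where "norm x < q ^ n" using real_arch_pow[OF q] by blast
      moreover have "q ^ n * 1 \<le> q ^ n * r0" using q r0 by (intro mult_left_mono) auto
      moreover have "1 * (q ^ n * r0) \<le> q * (q ^ n * r0)" using q r0 by (intro mult_right_mono) auto
      ultimately show ?thesis by (intro exI[of _ n]) linarith
    qed
    \<comment> \<open>Minimality puts \<open>x\<close> beyond the inner radius of its shell; for
      \<open>j = 0\<close> this is the case assumption \<open>norm x > r0\<close>.\<close>
    define j where "j = (LEAST j. norm x \<le> q * (q ^ j * r0))"
    have j1: "norm x \<le> q * (q ^ j * r0)" unfolding j_def by (rule LeastI_ex) fact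
    have j2: "q ^ j * r0 < norm x"
    proof (cases j)
      case (Suc i)
      then have "\<not> norm x \<le> q * (q ^ i * r0)" using not_less_Least[of i "\<lambda>j. norm x \<le> q * (q ^ j * r0)"] by (simp add: j_def)
      then show ?thesis using Suc by (simp add: mult.assoc)
    qed (use False in simp)
    have "ennreal (indicator {x. norm x > 1} x * ?H (norm x)) \<le> ennreal (?H (q * (q ^ j * r0))) * indicator (S j) x"
    proof -
      have "?H (norm x) \<le> ?H (q * (q ^ j * r0))" using j1 by (intro Hmono) auto
      then show ?thesis using j1 j2 by (auto simp: S_def indicator_def intro!: ennreal_leI)
    qed
    also have "\<dots> = (\<Sum>i\<in>{j}. ennreal (?H (q * (q ^ i * r0))) * indicator (S i) x)" by (simp only: sum.insert_if finite.emptyI sum.empty) simp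
    also have "\<dots> \<le> (\<Sum>j. ennreal (?H (q * (q ^ j * r0))) * indicator (S j) x)"
      by (rule sum_le_suminf) auto
    also have "\<dots> \<le> ennreal (?H r0) * indicator {x. norm x > 1} x + \<dots>" by simp
    finally show ?thesis .
  qed
  have shell: "ennreal (?H (q * (q ^ j * r0))) * emeasure \<nu> (S j) \<le> ennreal (ln q * exp (- (\<kappa> - \<kappa>2) * g (q ^ j * r0)))" for j
  proof -
    let ?r = "q ^ j * r0"
    have r: "?r > 0" "?r \<ge> r1" using qj[of j] r0 by linarith+
    have "emeasure \<nu> (S j) \<le> ennreal (K ?r * ln q)" unfolding S_def using r q by (intro shell_upper) auto
    also have "\<dots> \<le> ennreal (exp (- \<kappa> * g ?r) * ln q)"
      using r1(2)[OF r(2)] q by (intro ennreal_leI mult_right_mono) auto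
    finally have "ennreal (?H (q * ?r)) * emeasure \<nu> (S j) \<le> ennreal (?H (q * ?r)) * ennreal (exp (- \<kappa> * g ?r) * ln q)"
      by (intro mult_left_mono) auto
    also have "\<dots> = ennreal (ln q * exp (\<kappa>' * g (q * ?r) - \<kappa> * g ?r))"
      using q by (simp add: ennreal_mult[symmetric] exp_diff exp_minus field_simps)
    also have "\<dots> \<le> ennreal (ln q * exp (- (\<kappa> - \<kappa>2) * g ?r))"
    proof (intro ennreal_leI mult_left_mono)
      have "\<kappa>' * g (q * ?r) \<le> \<kappa>2 * g ?r" using r1(1)[OF r(2)] \<kappa>' by (simp add: field_simps)
      then show "exp (\<kappa>' * g (q * ?r) - \<kappa> * g ?r) \<le> exp (- (\<kappa> - \<kappa>2) * g ?r)" by (simp add: algebra_simps)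
    qed (use q in simp)
    finally show ?thesis .
  qed
  have "(\<integral>\<^sup>+x. ennreal (indicator {x. norm x > 1} x * ?H (norm x)) \<partial>\<nu>) \<le>
      (\<integral>\<^sup>+x. ennreal (?H r0) * indicator {x. norm x > 1} x + (\<Sum>j. ennreal (?H (q * (q ^ j * r0))) * indicator (S j) x) \<partial>\<nu>)"
    by (intro nn_integral_mono point)
  also have "\<dots> = ennreal (?H r0) * emeasure \<nu> {x. norm x > 1} + (\<Sum>j. ennreal (?H (q * (q ^ j * r0))) * emeasure \<nu> (S j))"
    using S_meas T_meas
    by (subst nn_integral_add) (auto simp: nn_integral_suminf nn_integral_cmult_indicator intro!: borel_measurable_suminf)
  also have "(\<Sum>j. ennreal (?H (q * (q ^ j * r0))) * emeasure \<nu> (S j)) \<le> ennreal (ln q * 2)"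
    unfolding suminf_eq_SUP
  proof (rule SUP_least)
    fix J :: nat
    have "(\<Sum>j<J. ennreal (?H (q * (q ^ j * r0))) * emeasure \<nu> (S j)) \<le> (\<Sum>j<J. ennreal (ln q * exp (- (\<kappa> - \<kappa>2) * g (q ^ j * r0))))"
      by (intro sum_mono shell)
    also have "\<dots> = ennreal (ln q * (\<Sum>j<J. exp (- (\<kappa> - \<kappa>2) * g (q ^ j * r0))))"
      using q by (subst sum_ennreal) (auto simp: sum_distrib_left)
    also have "\<dots> \<le> ennreal (ln q * 2)"
    proof (intro ennreal_leI mult_left_mono)
      have "g r0 \<ge> 0" using r0 by (intro g_nonneg) auto
      then have "exp (- (\<kappa> - \<kappa>2) * g r0) \<le> 1" using \<kappa>2 by (simp add: mult_nonpos_nonneg)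
      with r1(3)[OF r0(2), of J] show "(\<Sum>j<J. exp (- (\<kappa> - \<kappa>2) * g (q ^ j * r0))) \<le> 2" by linarith
    qed (use q in simp)
    finally show "(\<Sum>j<J. ennreal (?H (q * (q ^ j * r0))) * emeasure \<nu> (S j)) \<le> ennreal (ln q * 2)" .
  qed
  also have "ennreal (?H r0) * emeasure \<nu> {x. norm x > 1} + ennreal (ln q * 2) < \<infinity>"
    using tail_fin[of 1] by (simp add: ennreal_mult_less_top)
  finally have fin: "(\<integral>\<^sup>+x. ennreal (indicator {x. norm x > 1} x * ?H (norm x)) \<partial>\<nu>) < \<infinity>" by (simp add: add_left_mono)
  have "mono (\<lambda>x. ?H (max 0 x))" by (rule monoI, rule Hmono) auto
  then have [measurable]: "(\<lambda>x. ?H (max 0 x)) \<in> borel_measurable borel" by (rule borel_measurable_mono)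
  have "(\<lambda>x::'b. indicator {x. norm x > 1} x * ?H (max 0 (norm x))) \<in> borel_measurable borel" by measurable
  then have "(\<lambda>x::'b. indicator {x. norm x > 1} x * ?H (norm x)) \<in> borel_measurable \<nu>"
    using s\<nu> by (simp cong: measurable_cong_sets)
  then show ?thesis by (rule integrableI_nonneg) (use fin in auto)
qed

text \<open>A vector longer than \<open>r\<close> has a projection longer than \<open>b * r\<close>
  on some direction of the net, so a union bound over finitely many real tails suffices. The
  dilation by \<open>b\<close> and the shift by 1 are paid from the gap between \<kappa>' and
  \<kappa>.\<close>

lemma tail_of_levy_moment:
  fixes \<mu> \<nu> :: "'b::euclidean_space measure"
  assumes "prob_space \<mu>" "sets \<mu> = sets borel" "levy_khintchine \<mu> A \<nu> \<gamma>"
    and \<kappa>: "0 < \<kappa>" and moment: "integrable \<nu> (\<lambda>x. indicator {x. norm x > 1} x * exp (\<kappa> * g (norm x)))"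
    and \<kappa>': "0 < \<kappa>'" "\<kappa>' < \<kappa>"
  shows "tail_le (\<lambda>r. measure \<mu> {x. norm x > r}) \<kappa>'"
proof -
  interpret prob_space \<mu> by fact
  obtain d where d: "\<And>x y. x \<ge> 0 \<Longrightarrow> y \<ge> 0 \<Longrightarrow> g (x + y) \<le> d + g x + g y" using g_subadditive by blast
  obtain L where L: "L \<ge> 0" "\<And>x. x \<ge> 0 \<Longrightarrow> g x \<le> L + L * x" using g_linear_bound by blast
  let ?H = "\<lambda>r. exp (\<kappa> * g r)"
  obtain b where b: "0 < b" "b < 1" "\<kappa>' < \<kappa> * b powr \<alpha>" using shrink_factor[OF \<kappa>'] by blast
  obtain E :: "'b set" where E: "finite E" "\<And>e. e \<in> E \<Longrightarrow> norm e = 1" "\<And>x. \<exists>e\<in>E. b * norm x \<le> \<bar>e \<bullet> x\<bar>"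
    using finite_direction_net[OF b(2)] by metis
  have "\<exists>B\<ge>0. \<forall>r\<ge>0. measure \<mu> {x. \<bar>e \<bullet> x\<bar> > r + 1} \<le> B / ?H r" if e: "e \<in> E" for e
  proof -
    interpret levy_projection \<mu> A \<nu> \<gamma> e
      by unfold_locales (use assms E(2)[OF e] in auto)
    show ?thesis
    \<comment> \<open>With \<open>exp (\<kappa> * g r)\<close> as moment function, the additive
      defect \<open>d\<close> of \<open>g\<close> becomes the constant of submultiplicativity, and
      its linear bound becomes the exponential one.\<close>
    proof (rule tail_le_of_levy_moment[of ?H "exp (\<kappa> * d)" "exp (\<kappa> * L)" "\<kappa> * L"])
      show "?H x \<le> ?H y" if "0 \<le> x" "x \<le> y" for x y using g_mono[OF that] \<kappa> by simp
      show "?H (x + y) \<le> exp (\<kappa> * d) * ?H x * ?H y" if "0 \<le> x" "0 \<le> y" for x y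
        using d[OF that] \<kappa> by (simp add: exp_add[symmetric] distrib_left[symmetric])
      show "?H x \<le> exp (\<kappa> * L) * exp (\<kappa> * L * x)" if "0 \<le> x" for x
        using L(2)[OF that] \<kappa> by (simp add: exp_add[symmetric] mult.assoc distrib_left[symmetric])
    qed (use \<kappa> L moment in auto)
  qed
  then obtain B where B: "\<And>e. e \<in> E \<Longrightarrow> B e \<ge> 0" "\<And>e r. e \<in> E \<Longrightarrow> r \<ge> 0 \<Longrightarrow> measure \<mu> {x. \<bar>e \<bullet> x\<bar> > r + 1} \<le> B e / ?H r"
    by metis
  have ms: "{x::'b. \<bar>e \<bullet> x\<bar> > s} \<in> events" for e s
  proof -
    have "{x::'b. \<bar>e \<bullet> x\<bar> > s} \<in> sets borel" by measurable
    then show ?thesis using assms(2) by simp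
  qed
  have "\<forall>\<^sub>F r in at_top. measure \<mu> {x. norm x > r} \<le> (\<Sum>e\<in>E. B e) * exp (- \<kappa> * g (b * r - 1))"
    using eventually_ge_at_top[of "1 / b"]
  proof eventually_elim
    case (elim r)
    then have r: "b * r - 1 \<ge> 0" using b by (simp add: field_simps)
    have "{x. norm x > r} \<subseteq> (\<Union>e\<in>E. {x. \<bar>e \<bullet> x\<bar> > (b * r - 1) + 1})"
    proof
      fix x :: 'b assume "x \<in> {x. norm x > r}"
      then have "b * r < b * norm x" using b by simp
      with E(3)[of x] show "x \<in> (\<Union>e\<in>E. {x. \<bar>e \<bullet> x\<bar> > (b * r - 1) + 1})" by fastforce
    qed
    then have "measure \<mu> {x. norm x > r} \<le> measure \<mu> (\<Union>e\<in>E. {x. \<bar>e \<bullet> x\<bar> > (b * r - 1) + 1})"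
      by (rule finite_measure_mono) (auto intro!: sets.finite_UN E ms)
    also have "\<dots> \<le> (\<Sum>e\<in>E. measure \<mu> {x. \<bar>e \<bullet> x\<bar> > (b * r - 1) + 1})"
      using E ms by (intro finite_measure_subadditive_finite) auto
    also have "\<dots> \<le> (\<Sum>e\<in>E. B e * exp (- \<kappa> * g (b * r - 1)))"
      using B(2)[OF _ r] by (intro sum_mono) (simp add: exp_minus divide_inverse)
    finally show ?case by (simp add: sum_distrib_right)
  qed
  moreover have "tail_le (\<lambda>r. exp (- \<kappa> * g r)) \<kappa>" by (simp add: tail_le_def)
  ultimately show ?thesis
    using b \<kappa> B(1) by (intro tail_le_transfer[of "\<lambda>r. exp (- \<kappa> * g r)" \<kappa> b \<kappa>' "\<Sum>e\<in>E. B e" _ 1]) (auto intro: sum_nonneg)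
qed

text \<open>The big-jump estimate is quadratic in the Levy tail \<open>q\<close>. Far out
  \<open>q\<close> is at most 1/4, so the factor \<open>1 / 2 - q\<close> is at least 1/4 and the
  estimate becomes linear, with constant 4 per direction.\<close>

lemma levy_tail_of_tail:
  fixes \<mu> \<nu> :: "'b::euclidean_space measure"
  assumes "prob_space \<mu>" "sets \<mu> = sets borel" "levy_khintchine \<mu> A \<nu> \<gamma>"
    and tail: "tail_le (\<lambda>r. measure \<mu> {x. norm x > r}) \<kappa>" and \<kappa>': "0 < \<kappa>'" "\<kappa>' < \<kappa>"
  shows "tail_le (\<lambda>r. measure \<nu> {x. norm x > r}) \<kappa>'"
proof -
  interpret prob_space \<mu> by fact
  note \<nu>D = levy_khintchine_levy_measureD[OF assms(3)]
  obtain b where b: "0 < b" "b < 1" "\<kappa>' < \<kappa> * b powr \<alpha>" using shrink_factor[OF \<kappa>'] by blast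
  obtain E :: "'b set" where E: "finite E" "\<And>e. e \<in> E \<Longrightarrow> norm e = 1" "\<And>x. \<exists>e\<in>E. b * norm x \<le> \<bar>e \<bullet> x\<bar>"
    using finite_direction_net[OF b(2)] by metis
  have "\<exists>y\<ge>0. \<forall>R\<ge>y + 1. measure \<nu> {x. \<bar>e \<bullet> x\<bar> > R} * (1 / 2 - measure \<nu> {x. \<bar>e \<bullet> x\<bar> > R}) \<le> measure \<mu> {x. \<bar>e \<bullet> x\<bar> > R - y}"
    if e: "e \<in> E" for e
  proof -
    interpret levy_projection \<mu> A \<nu> \<gamma> e
      by unfold_locales (use assms E(2)[OF e] in auto)
    show ?thesis by (rule tail_ge_levy_tail) blast
  qed
  then obtain Y where Y: "\<And>e. e \<in> E \<Longrightarrow> Y e \<ge> 0" "\<And>e R. e \<in> E \<Longrightarrow> R \<ge> Y e + 1 \<Longrightarrow>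
      measure \<nu> {x. \<bar>e \<bullet> x\<bar> > R} * (1 / 2 - measure \<nu> {x. \<bar>e \<bullet> x\<bar> > R}) \<le> measure \<mu> {x. \<bar>e \<bullet> x\<bar> > R - Y e}"
    by metis
  \<comment> \<open>A common upper bound for the shifts of all directions; the sum avoids a maximum
    over a set not known to be nonempty.\<close>
  define y where "y = (\<Sum>e\<in>E. Y e)"
  have Yy: "Y e \<le> y" if "e \<in> E" for e unfolding y_def using that E(1) Y(1) by (intro member_le_sum) auto
  have y0: "y \<ge> 0" unfolding y_def using Y(1) by (intro sum_nonneg) auto
  have m1: "{x::'b. \<bar>e \<bullet> x\<bar> > s} \<in> sets \<nu>" and m2: "{x::'b. norm x > s} \<in> sets \<nu>" and m3: "{x::'b. norm x > s} \<in> events" for e s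
  proof -
    have "{x::'b. \<bar>e \<bullet> x\<bar> > s} \<in> sets borel" "{x::'b. norm x > s} \<in> sets borel" by measurable
    then show "{x::'b. \<bar>e \<bullet> x\<bar> > s} \<in> sets \<nu>" "{x::'b. norm x > s} \<in> sets \<nu>" "{x::'b. norm x > s} \<in> events"
      using assms(2) \<nu>D(1) by auto
  qed
  have inner_sub: "{x. \<bar>e \<bullet> x\<bar> > s} \<subseteq> {x. norm x > s}" if "e \<in> E" for e s
  proof
    fix x assume "x \<in> {x. \<bar>e \<bullet> x\<bar> > s}"
    then show "x \<in> {x. norm x > s}" using Cauchy_Schwarz_ineq2[of e x] E(2)[OF that] by simp
  qed
  have fm: "{x. norm x > s} \<in> fmeasurable \<nu>" if "s > 0" for s
    using \<nu>D(4)[OF that] m2 by (intro fmeasurableI) auto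
  obtain r1 where r1: "r1 > 0" "\<And>r. r \<ge> r1 \<Longrightarrow> measure \<nu> {x. norm x > r} \<le> 1 / 4"
  proof -
    have "(\<lambda>n. measure \<nu> {x. norm x > real n + 1}) \<longlonglongrightarrow> measure \<nu> (\<Inter>n. {x::'b. norm x > real n + 1})"
    proof (rule Lim_measure_decseq)
      show "decseq (\<lambda>n. {x::'b. norm x > real n + 1})" by (auto simp: decseq_def)
      show "emeasure \<nu> {x. norm x > real i + 1} \<noteq> \<infinity>" for i
        using \<nu>D(4)[of "real i + 1"] by simp
    qed (use m2 in auto)
    moreover have "(\<Inter>n. {x::'b. norm x > real n + 1}) = {}"
    proof -
      have "\<exists>n. \<not> norm x > real n + 1" for x :: 'b
      proof -
        obtain n where "norm x \<le> real n" using real_arch_simple by blast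
        then show ?thesis by (intro exI[of _ n]) simp
      qed
      then show ?thesis by auto
    qed
    ultimately have "\<forall>\<^sub>F n in sequentially. measure \<nu> {x. norm x > real n + 1} < 1 / 4"
      by (auto dest!: order_tendstoD(2)[where a = "1/4"])
    then obtain n where n: "measure \<nu> {x. norm x > real n + 1} < 1 / 4" by (auto simp: eventually_sequentially)
    show ?thesis
    proof (rule that[of "real n + 1"])
      fix r assume "r \<ge> real n + 1"
      then have "measure \<nu> {x. norm x > r} \<le> measure \<nu> {x. norm x > real n + 1}"
        by (intro measure_mono_fmeasurable fm m2) auto
      then show "measure \<nu> {x. norm x > r} \<le> 1 / 4" using n by simp
    qed simp
  qed
  have "\<forall>\<^sub>F r in at_top. measure \<nu> {x. norm x > r} \<le> (4 * real (card E)) * measure \<mu> {x. norm x > b * r - y}"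
    using eventually_ge_at_top[of "(y + 1) / b"] eventually_ge_at_top[of "r1 / b"]
  proof eventually_elim
    case (elim r)
    let ?R = "b * r"
    have R: "?R \<ge> y + 1" "?R \<ge> r1" using elim b(1) by (auto simp: field_simps)
    then have "?R > 0" using y0 by linarith
    note R = R this
    have "{x. norm x > r} \<subseteq> (\<Union>e\<in>E. {x. \<bar>e \<bullet> x\<bar> > ?R})"
    proof
      fix x :: 'b assume "x \<in> {x. norm x > r}"
      then have "b * r < b * norm x" using b by simp
      with E(3)[of x] show "x \<in> (\<Union>e\<in>E. {x. \<bar>e \<bullet> x\<bar> > ?R})" by fastforce
    qed
    moreover have fmU: "{x. \<bar>e \<bullet> x\<bar> > ?R} \<in> fmeasurable \<nu>" if "e \<in> E" for e
      using fmeasurableI2[OF fm[OF R(3)] inner_sub[OF that] m1] .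
    ultimately have "measure \<nu> {x. norm x > r} \<le> measure \<nu> (\<Union>e\<in>E. {x. \<bar>e \<bullet> x\<bar> > ?R})"
    proof (intro measure_mono_fmeasurable m2)
      show "(\<Union>e\<in>E. {x. \<bar>e \<bullet> x\<bar> > ?R}) \<in> fmeasurable \<nu>"
        by (rule fmeasurable.finite_UN[OF E(1) fmU])
    qed
    also have "\<dots> \<le> (\<Sum>e\<in>E. measure \<nu> {x. \<bar>e \<bullet> x\<bar> > ?R})"
      by (rule measure_UNION_le[OF E(1) m1])
    also have "\<dots> \<le> (\<Sum>e\<in>E. 4 * measure \<mu> {x. norm x > ?R - y})"
    proof (intro sum_mono)
      fix e assume e: "e \<in> E"
      let ?q = "measure \<nu> {x. \<bar>e \<bullet> x\<bar> > ?R}"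
      have "?q \<le> measure \<nu> {x. norm x > ?R}"
        using measure_mono_fmeasurable[OF inner_sub[OF e] m1 fm[OF R(3)]] .
      also have "\<dots> \<le> 1 / 4" by (rule r1(2)[OF R(2)])
      finally have "?q * (1 / 4) \<le> ?q * (1 / 2 - ?q)" by (intro mult_left_mono) auto
      also have "\<dots> \<le> measure \<mu> {x. \<bar>e \<bullet> x\<bar> > ?R - Y e}"
        using Yy[OF e] R by (intro Y(2) e) auto
      also have "\<dots> \<le> measure \<mu> {x. norm x > ?R - y}"
      proof (intro finite_measure_mono m3 subsetI)
        fix x assume "x \<in> {x. \<bar>e \<bullet> x\<bar> > ?R - Y e}"
        then have "x \<in> {x. norm x > ?R - Y e}" using inner_sub[OF e] by blast
        then show "x \<in> {x. norm x > ?R - y}" using Yy[OF e] by simp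
      qed
      finally show "?q \<le> 4 * measure \<mu> {x. norm x > ?R - y}" by simp
    qed
    finally show ?case by simp
  qed
  note ev = this
  have "0 < \<kappa>" using \<kappa>' by linarith
  from tail_le_transfer[OF tail this b(1) b(3) _ ev] show ?thesis by simp
qed

text \<open>The shell from \<open>b * r\<close> to \<open>r\<close> bounds the radial integral at
  \<open>r\<close> by the Levy tail at \<open>b * r\<close>, up to the constant
  \<open>1 / ln (1 / b)\<close>.\<close>

lemma radial_tail_of_levy_tail:
  fixes \<nu> :: "'b::euclidean_space measure"
  assumes "radial_levy \<nu> \<sigma> k" and tail: "tail_le (\<lambda>r. measure \<nu> {x. norm x > r}) \<kappa>" and \<kappa>': "0 < \<kappa>'" "\<kappa>' < \<kappa>"
  shows "tail_le (\<lambda>r. LINT \<xi>|\<sigma>. k \<xi> r) \<kappa>'"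
proof -
  interpret radial_levy \<nu> \<sigma> k by fact
  obtain b where b: "0 < b" "b < 1" "\<kappa>' < \<kappa> * b powr \<alpha>" using shrink_factor[OF \<kappa>'] by blast
  have l: "ln (1 / b) > 0" using b by (intro ln_gt_zero) simp
  have "\<forall>\<^sub>F r in at_top. (LINT \<xi>|\<sigma>. k \<xi> r) \<le> (1 / ln (1 / b)) * measure \<nu> {x. norm x > b * r - 0}"
    using eventually_gt_at_top[of 0]
  proof eventually_elim
    case (elim r)
    have "K r * ln (1 / b) \<le> measure \<nu> {x. norm x > b * r}"
      using shell_lower[of "b * r" "1 / b"] b elim by simp
    then show ?case unfolding K_def[symmetric] using l by (simp add: field_simps)
  qed
  note ev = this
  have "0 < \<kappa>" using \<kappa>' by linarith
  moreover have "0 \<le> 1 / ln (1 / b)" using l by simp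
  ultimately show ?thesis by (rule tail_le_transfer[OF tail _ b(1) b(3) _ ev])
qed

end

section \<open>Selfsimilar additive processes\<close>

text \<open>The second Borel-Cantelli lemma: by independence and
  \<open>1 - p \<le> exp (- p)\<close>, avoiding all targets from \<open>m\<close> on has
  probability at most the exponential of minus any partial sum of a divergent series.\<close>

lemma (in prob_space) indep_vars_frequently:
  fixes X :: "nat \<Rightarrow> 'a \<Rightarrow> 'b::topological_space"
  assumes ind: "indep_vars (\<lambda>_. borel) X UNIV" and B: "\<And>n. B n \<in> sets borel"
    and div: "\<not> summable (\<lambda>n. prob {\<omega>\<in>space M. X n \<omega> \<in> B n})"
  shows "AE \<omega> in M. \<exists>\<^sub>F n in sequentially. X n \<omega> \<in> B n"
proof -
  have X [measurable]: "X n \<in> borel_measurable M" for n using ind by (auto simp: indep_vars_def)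
  note [measurable] = B
  define p where "p n = prob {\<omega>\<in>space M. X n \<omega> \<in> B n}" for n
  have p01: "0 \<le> p n" "p n \<le> 1" for n by (auto simp: p_def)
  have compl: "prob (X n -` (- B n) \<inter> space M) = 1 - p n" for n
  proof -
    have "X n -` (- B n) \<inter> space M = space M - {\<omega>\<in>space M. X n \<omega> \<in> B n}" by auto
    then show ?thesis unfolding p_def by (simp add: prob_compl)
  qed
  have null: "AE \<omega> in M. \<exists>n\<ge>m. X n \<omega> \<in> B n" for m
  proof -
    define N where "N = {\<omega>\<in>space M. \<forall>n\<ge>m. X n \<omega> \<notin> B n}"
    have N_meas: "N \<in> events" unfolding N_def by measurable
    have bound: "prob N \<le> exp (- (\<Sum>n<j. p (n + m)))" for j
    proof (cases "j = 0")
      case False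
      have "prob N \<le> prob (\<Inter>n\<in>{m..<m + j}. X n -` (- B n) \<inter> space M)"
      proof (rule finite_measure_mono)
        show "N \<subseteq> (\<Inter>n\<in>{m..<m + j}. X n -` (- B n) \<inter> space M)" by (auto simp: N_def)
        have "X n -` (- B n) \<inter> space M \<in> events" for n
          by (rule measurable_sets[OF X]) (use B in auto)
        then show "(\<Inter>n\<in>{m..<m + j}. X n -` (- B n) \<inter> space M) \<in> events"
          using False by (intro sets.finite_INT) auto
      qed
      also have "\<dots> = (\<Prod>n\<in>{m..<m + j}. prob (X n -` (- B n) \<inter> space M))"
        using False B by (intro indep_varsD[OF ind]) auto
      also have "\<dots> = (\<Prod>n\<in>{m..<m + j}. 1 - p n)" by (simp add: compl)
      also have "\<dots> \<le> (\<Prod>n\<in>{m..<m + j}. exp (- p n))"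
      proof (intro prod_mono conjI)
        show "1 - p n \<le> exp (- p n)" for n using exp_ge_add_one_self[of "- p n"] by simp
      qed (use p01 in auto)
      also have "\<dots> = exp (- (\<Sum>n\<in>{m..<m + j}. p n))" by (simp add: exp_sum[symmetric] sum_negf)
      also have "(\<Sum>n\<in>{m..<m + j}. p n) = (\<Sum>n<j. p (n + m))"
        using sum.shift_bounds_nat_ivl[of p 0 m j] by (simp add: add.commute atLeast0LessThan)
      finally show ?thesis .
    qed simp
    have "prob N \<le> e" if "e > 0" for e :: real
    proof -
      have "\<not> summable (\<lambda>n. p (n + m))"
        using div unfolding summable_iff_shift by (simp add: p_def[abs_def])
      then have "\<not> (\<forall>j. (\<Sum>n<j. p (n + m)) \<le> \<bar>ln e\<bar>)"
        using p01 summableI_nonneg_bounded[of "\<lambda>n. p (n + m)" "\<bar>ln e\<bar>"] by blast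
      then obtain j where "(\<Sum>n<j. p (n + m)) > \<bar>ln e\<bar>" by (auto simp: not_le)
      then have "exp (- (\<Sum>n<j. p (n + m))) \<le> exp (ln e)" by (subst exp_le_cancel_iff) linarith
      with bound[of j] that show ?thesis by simp
    qed
    then have "prob N \<le> 0" by (rule dense_ge)
    then have "prob N = 0" using measure_nonneg[of M N] by linarith
    then have "N \<in> null_sets M" using N_meas by (simp add: null_sets_def emeasure_eq_measure)
    then show ?thesis by (rule AE_I') (auto simp: N_def)
  qed
  then have "AE \<omega> in M. \<forall>m. \<exists>n\<ge>m. X n \<omega> \<in> B n" by (simp add: AE_all_countable)
  then show ?thesis by eventually_elim (auto simp: frequently_sequentially)
qed

text \<open>Decompose along the first index at which the partial sum exceeds \<open>r + y\<close>.\<close>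
lemma (in prob_space) ottaviani:
  fixes V :: "nat \<Rightarrow> 'a \<Rightarrow> 'b::euclidean_space"
  assumes ind: "indep_vars (\<lambda>_. borel) V {..<n}"
    and half: "\<And>i. i \<le> n \<Longrightarrow> 1 / 2 \<le> prob {\<omega>\<in>space M. norm (\<Sum>j\<in>{i..<n}. V j \<omega>) \<le> y}"
  shows "prob {\<omega>\<in>space M. \<exists>i\<le>n. norm (\<Sum>j<i. V j \<omega>) > r + y} \<le> 2 * prob {\<omega>\<in>space M. norm (\<Sum>j<n. V j \<omega>) > r}"
proof -
  have V [measurable]: "V i \<in> borel_measurable M" if "i < n" for i using ind that by (auto simp: indep_vars_def)
  have S_meas: "(\<lambda>\<omega>. \<Sum>j\<in>A. V j \<omega>) \<in> borel_measurable M" if "A \<subseteq> {..<n}" for A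
    using that by (intro borel_measurable_sum V) auto
  define F where "F i = {\<omega>\<in>space M. norm (\<Sum>j<i. V j \<omega>) > r + y \<and> (\<forall>l<i. norm (\<Sum>j<l. V j \<omega>) \<le> r + y)}" for i
  define G where "G i = {\<omega>\<in>space M. norm (\<Sum>j\<in>{i..<n}. V j \<omega>) \<le> y}" for i
  have norm_meas [measurable]: "(\<lambda>\<omega>. norm (\<Sum>j<i. V j \<omega>)) \<in> borel_measurable M" if "i \<le> n" for i
    using that by (intro measurable_compose[OF S_meas borel_measurable_norm]) auto
  have F_meas: "F i \<in> events" if i: "i \<le> n" for i
  proof -
    have "F i = {\<omega>\<in>space M. norm (\<Sum>j<i. V j \<omega>) > r + y} \<inter> {\<omega>\<in>space M. \<forall>l\<in>{..<i}. norm (\<Sum>j<l. V j \<omega>) \<le> r + y}"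
      by (auto simp: F_def)
    moreover have "{\<omega>\<in>space M. norm (\<Sum>j<i. V j \<omega>) > r + y} \<in> events"
      using norm_meas[OF i] by measurable
    moreover have "{\<omega>\<in>space M. \<forall>l\<in>{..<i}. norm (\<Sum>j<l. V j \<omega>) \<le> r + y} \<in> events"
    proof (rule sets.sets_Collect_finite_All)
      fix l assume "l \<in> {..<i}"
      then have "l \<le> n" using i by simp
      then show "{\<omega>\<in>space M. norm (\<Sum>j<l. V j \<omega>) \<le> r + y} \<in> events"
        using norm_meas[of l] by measurable
    qed auto
    ultimately show ?thesis by auto
  qed
  have G_meas: "G i \<in> events" for i
  proof -
    have [measurable]: "(\<lambda>\<omega>. \<Sum>j\<in>{i..<n}. V j \<omega>) \<in> borel_measurable M" by (rule S_meas) auto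
    show ?thesis unfolding G_def by measurable
  qed
  have prod: "prob (F i \<inter> G i) = prob (F i) * prob (G i)" if i: "i \<le> n" for i
  proof -
    let ?A = "{..<i}" and ?B = "{i..<n}"
    \<comment> \<open>\<open>F i\<close> is determined by the summands before \<open>i\<close> and
      \<open>G i\<close> by those from \<open>i\<close> on, so grouping the family into two blocks
      makes the events independent.\<close>
    have iv: "indep_var (\<Pi>\<^sub>M j\<in>?A. borel) (\<lambda>\<omega>. restrict (\<lambda>j. V j \<omega>) ?A) (\<Pi>\<^sub>M j\<in>?B. borel) (\<lambda>\<omega>. restrict (\<lambda>j. V j \<omega>) ?B)"
      by (rule indep_var_restrict[OF ind]) (use i in auto)
    define a where "a = {v\<in>space (\<Pi>\<^sub>M j\<in>?A. borel). norm (\<Sum>j<i. v j) > r + y \<and> (\<forall>l\<in>{..<i}. norm (\<Sum>j<l. v j :: 'b) \<le> r + y)}"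
    define b where "b = {v\<in>space (\<Pi>\<^sub>M j\<in>?B. borel). norm (\<Sum>j\<in>?B. v j :: 'b) \<le> y}"
    have nm: "(\<lambda>v. norm (\<Sum>j\<in>J. v j :: 'b)) \<in> borel_measurable (\<Pi>\<^sub>M j\<in>I. borel)" if "J \<subseteq> I" for I J :: "nat set"
    proof -
      have "(\<lambda>v. \<Sum>j\<in>J. v j :: 'b) \<in> borel_measurable (\<Pi>\<^sub>M j\<in>I. borel)"
        using that by (intro borel_measurable_sum measurable_component_singleton) auto
      then show ?thesis by (rule measurable_compose[OF _ borel_measurable_norm])
    qed
    have "a = {v\<in>space (\<Pi>\<^sub>M j\<in>?A. borel). norm (\<Sum>j<i. v j) > r + y} \<inter> {v\<in>space (\<Pi>\<^sub>M j\<in>?A. borel). \<forall>l\<in>{..<i}. norm (\<Sum>j<l. v j :: 'b) \<le> r + y}"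
      by (auto simp: a_def)
    moreover have "{v\<in>space (\<Pi>\<^sub>M j\<in>?A. borel). norm (\<Sum>j<i. v j :: 'b) > r + y} \<in> sets (\<Pi>\<^sub>M j\<in>?A. borel)"
      using nm[of ?A ?A] by measurable
    moreover have "{v\<in>space (\<Pi>\<^sub>M j\<in>?A. borel). \<forall>l\<in>{..<i}. norm (\<Sum>j<l. v j :: 'b) \<le> r + y} \<in> sets (\<Pi>\<^sub>M j\<in>?A. borel)"
    proof (rule sets.sets_Collect_finite_All)
      fix l assume "l \<in> {..<i}"
      then have "(\<lambda>v. norm (\<Sum>j<l. v j :: 'b)) \<in> borel_measurable (\<Pi>\<^sub>M j\<in>?A. borel)" by (intro nm) auto
      then show "{v\<in>space (\<Pi>\<^sub>M j\<in>?A. borel). norm (\<Sum>j<l. v j :: 'b) \<le> r + y} \<in> sets (\<Pi>\<^sub>M j\<in>?A. borel)" by measurable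
    qed auto
    ultimately have am: "a \<in> sets (\<Pi>\<^sub>M j\<in>?A. borel)" by auto
    have bm: "b \<in> sets (\<Pi>\<^sub>M j\<in>?B. borel)" unfolding b_def using nm[of ?B ?B] by measurable
    have rs: "(\<Sum>j<l. restrict (\<lambda>j. V j \<omega>) ?A j) = (\<Sum>j<l. V j \<omega>)" if "l \<le> i" for l \<omega>
      using that by (intro sum.cong) auto
    have "restrict (\<lambda>j. V j \<omega>) ?A \<in> a \<longleftrightarrow> \<omega> \<in> F i" if "\<omega> \<in> space M" for \<omega>
    proof -
      have "restrict (\<lambda>j. V j \<omega>) ?A \<in> space (\<Pi>\<^sub>M j\<in>?A. borel)" by (simp add: space_PiM)
      moreover have "norm (\<Sum>j<l. restrict (\<lambda>j. V j \<omega>) ?A j) \<le> r + y \<longleftrightarrow> norm (\<Sum>j<l. V j \<omega>) \<le> r + y" if "l < i" for l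
        using rs[of l \<omega>] that by (simp only: less_imp_le)
      ultimately show ?thesis using rs[of i \<omega>] that unfolding a_def F_def
        by (simp only: mem_Collect_eq order_refl lessThan_iff Ball_def cong: imp_cong)
    qed
    then have ea: "(\<lambda>\<omega>. restrict (\<lambda>j. V j \<omega>) ?A) -` a \<inter> space M = F i"
      using sets.sets_into_space[OF F_meas[OF i]] by blast
    have eb: "(\<lambda>\<omega>. restrict (\<lambda>j. V j \<omega>) ?B) -` b \<inter> space M = G i"
      unfolding b_def G_def by (auto simp: space_PiM)
    have "F i \<inter> G i = (\<lambda>\<omega>. (restrict (\<lambda>j. V j \<omega>) ?A, restrict (\<lambda>j. V j \<omega>) ?B)) -` (a \<times> b) \<inter> space M"
      unfolding ea[symmetric] eb[symmetric] by auto
    then show ?thesis using indep_varD[OF iv am bm] ea eb by simp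
  qed
  have disj: "disjoint_family_on F {..n}"
  proof -
    have "False" if "\<omega> \<in> F i" "\<omega> \<in> F j" "i < j" for \<omega> i j using that unfolding F_def by force
    then show ?thesis unfolding disjoint_family_on_def by (metis disjoint_iff nat_neq_iff)
  qed
  have "{\<omega>\<in>space M. \<exists>i\<le>n. norm (\<Sum>j<i. V j \<omega>) > r + y} = (\<Union>i\<in>{..n}. F i)"
  proof (intro equalityI subsetI)
    fix \<omega> assume w: "\<omega> \<in> {\<omega>\<in>space M. \<exists>i\<le>n. norm (\<Sum>j<i. V j \<omega>) > r + y}"
    let ?P = "\<lambda>i. norm (\<Sum>j<i. V j \<omega>) > r + y"
    obtain i where i: "i \<le> n" "?P i" using w by auto
    define l where "l = (LEAST i. ?P i)"
    have "?P l" unfolding l_def using i(2) by (rule LeastI)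
    moreover have "l \<le> i" unfolding l_def using i(2) by (rule Least_le)
    moreover have "\<not> ?P m" if "m < l" for m using that unfolding l_def by (rule not_less_Least)
    ultimately show "\<omega> \<in> (\<Union>i\<in>{..n}. F i)" using i w by (auto simp: F_def not_less intro!: bexI[of _ l])
  qed (auto simp: F_def)
  then have "prob {\<omega>\<in>space M. \<exists>i\<le>n. norm (\<Sum>j<i. V j \<omega>) > r + y} = (\<Sum>i\<le>n. prob (F i))"
    using F_meas disj by (subst finite_measure_finite_Union[symmetric]) auto
  also have "\<dots> \<le> (\<Sum>i\<le>n. 2 * prob (F i \<inter> G i))"
  proof (rule sum_mono)
    fix i assume "i \<in> {..n}"
    then have i: "i \<le> n" by simp
    have "prob (F i) * (1 / 2) \<le> prob (F i) * prob (G i)"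
      using half[OF i] by (intro mult_left_mono) (auto simp: G_def)
    then show "prob (F i) \<le> 2 * prob (F i \<inter> G i)" using prod[OF i] by simp
  qed
  also have "\<dots> = 2 * prob (\<Union>i\<in>{..n}. F i \<inter> G i)"
  proof -
    have "disjoint_family_on (\<lambda>i. F i \<inter> G i) {..n}"
      using disj unfolding disjoint_family_on_def by blast
    then show ?thesis using F_meas G_meas
      by (subst finite_measure_finite_Union) (auto simp: sum_distrib_left)
  qed
  also have "\<dots> \<le> 2 * prob {\<omega>\<in>space M. norm (\<Sum>j<n. V j \<omega>) > r}"
  proof (intro mult_left_mono finite_measure_mono subsetI)
    show "{\<omega>\<in>space M. norm (\<Sum>j<n. V j \<omega>) > r} \<in> events" using norm_meas[of n] by measurable
    fix \<omega> assume "\<omega> \<in> (\<Union>i\<in>{..n}. F i \<inter> G i)"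
    then obtain i where i: "i \<le> n" "\<omega> \<in> F i" "\<omega> \<in> G i" by auto
    have "(\<Sum>j<n. V j \<omega>) = (\<Sum>j<i. V j \<omega>) + (\<Sum>j\<in>{i..<n}. V j \<omega>)"
      using sum.atLeastLessThan_concat[of 0 i n "\<lambda>j. V j \<omega>"] i(1) by (simp add: atLeast0LessThan)
    then have "norm (\<Sum>j<i. V j \<omega>) - norm (\<Sum>j\<in>{i..<n}. V j \<omega>) \<le> norm (\<Sum>j<n. V j \<omega>)"
      by (simp only: norm_diff_ineq)
    moreover have "\<omega> \<in> space M" "norm (\<Sum>j<i. V j \<omega>) > r + y" using i(2) unfolding F_def by blast+
    moreover have "norm (\<Sum>j\<in>{i..<n}. V j \<omega>) \<le> y" using i(3) unfolding G_def by blast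
    ultimately have "norm (\<Sum>j<n. V j \<omega>) > r" by linarith
    with \<open>\<omega> \<in> space M\<close> show "\<omega> \<in> {\<omega>\<in>space M. norm (\<Sum>j<n. V j \<omega>) > r}" by blast
  qed simp
  finally show ?thesis .
qed

locale selfsimilar_process =
  fixes M :: "'w measure" and H :: real and X :: "real \<Rightarrow> 'w \<Rightarrow> 'a::euclidean_space"
  assumes ssap: "selfsimilar_additive_process M H X"
begin

sublocale prob_space M using ssap by (simp add: selfsimilar_additive_process_def)

lemma H_pos: "H > 0" using ssap by (simp add: selfsimilar_additive_process_def)

lemma X_meas: "t \<ge> 0 \<Longrightarrow> X t \<in> borel_measurable M"
  using ssap by (simp add: selfsimilar_additive_process_def)

lemma scaling:
  assumes "c > 0" "finite J" "J \<subseteq> {0..}" and A: "A \<in> sets (\<Pi>\<^sub>M t\<in>J. borel)"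
  shows "prob {\<omega>\<in>space M. (\<lambda>t\<in>J. X (c * t) \<omega>) \<in> A} = prob {\<omega>\<in>space M. (\<lambda>t\<in>J. (c powr H) *\<^sub>R X t \<omega>) \<in> A}"
proof -
  have m1: "(\<lambda>\<omega>. \<lambda>t\<in>J. X (c * t) \<omega>) \<in> measurable M (\<Pi>\<^sub>M t\<in>J. borel)"
    using assms by (intro measurable_restrict X_meas) auto
  have m2: "(\<lambda>\<omega>. \<lambda>t\<in>J. (c powr H) *\<^sub>R X t \<omega>) \<in> measurable M (\<Pi>\<^sub>M t\<in>J. borel)"
    using assms by (intro measurable_restrict borel_measurable_scaleR borel_measurable_const X_meas) auto
  have "fdd M (\<lambda>t. X (c * t)) J = fdd M (\<lambda>t \<omega>. (c powr H) *\<^sub>R X t \<omega>) J"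
    using ssap assms unfolding selfsimilar_additive_process_def same_fdds_def by blast
  then have eq: "measure (fdd M (\<lambda>t. X (c * t)) J) A = measure (fdd M (\<lambda>t \<omega>. (c powr H) *\<^sub>R X t \<omega>) J) A" by simp
  have D: "measure (fdd M Y J) A = prob {\<omega>\<in>space M. (\<lambda>t\<in>J. Y t \<omega>) \<in> A}"
    if "(\<lambda>\<omega>. \<lambda>t\<in>J. Y t \<omega>) \<in> measurable M (\<Pi>\<^sub>M t\<in>J. borel)" for Y
    unfolding fdd_def measure_distr[OF that A] by (rule arg_cong[where f = prob]) auto
  show ?thesis using eq unfolding D[OF m1] D[OF m2] .
qed

lemma scaling_at:
  assumes "c > 0" "t \<ge> 0"
  shows "prob {\<omega>\<in>space M. norm (X (c * t) \<omega>) > z} = prob {\<omega>\<in>space M. c powr H * norm (X t \<omega>) > z}"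
proof -
  let ?A = "{v\<in>space (\<Pi>\<^sub>M s\<in>{t}. borel). norm (v t :: 'a) > z}"
  have [measurable]: "(\<lambda>v. v t :: 'a) \<in> borel_measurable (\<Pi>\<^sub>M s\<in>{t}. borel)"
    by (rule measurable_component_singleton) simp
  have "?A \<in> sets (\<Pi>\<^sub>M s\<in>{t}. borel)" by measurable
  from scaling[OF assms(1) _ _ this] assms show ?thesis by (simp add: space_PiM)
qed

lemma scaling_increment:
  assumes "c > 0" "0 \<le> s" "s < t"
  shows "prob {\<omega>\<in>space M. norm (X (c * t) \<omega> - X (c * s) \<omega>) > z} =
    prob {\<omega>\<in>space M. c powr H * norm (X t \<omega> - X s \<omega>) > z}"
proof -
  let ?A = "{v\<in>space (\<Pi>\<^sub>M u\<in>{s, t}. borel). norm (v t - v s :: 'a) > z}"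
  have [measurable]: "(\<lambda>v. v t :: 'a) \<in> borel_measurable (\<Pi>\<^sub>M u\<in>{s, t}. borel)" "(\<lambda>v. v s :: 'a) \<in> borel_measurable (\<Pi>\<^sub>M u\<in>{s, t}. borel)"
    by (rule measurable_component_singleton, simp)+
  have "?A \<in> sets (\<Pi>\<^sub>M u\<in>{s, t}. borel)" by measurable
  from scaling[OF assms(1) _ _ this] assms show ?thesis
    by (simp add: space_PiM scaleR_diff_right[symmetric])
qed

definition \<mu>_tail :: "real \<Rightarrow> real" where "\<mu>_tail r = prob {\<omega>\<in>space M. norm (X 1 \<omega>) > r}"

lemma \<mu>_tail_eq: "\<mu>_tail r = measure (distr M borel (X 1)) {x. norm x > r}"
proof -
  have "{x::'a. norm x > r} \<in> sets borel" by measurable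
  moreover have "X 1 \<in> borel_measurable M" by (rule X_meas) simp
  ultimately have "measure (distr M borel (X 1)) {x. norm x > r} = prob (X 1 -` {x. norm x > r} \<inter> space M)"
    by (intro measure_distr)
  also have "X 1 -` {x. norm x > r} \<inter> space M = {\<omega>\<in>space M. norm (X 1 \<omega>) > r}" by auto
  finally show ?thesis by (simp add: \<mu>_tail_def)
qed

lemma tail_at:
  assumes "t > 0" shows "prob {\<omega>\<in>space M. norm (X t \<omega>) > r * t powr H} = \<mu>_tail r"
  using scaling_at[OF assms, of 1 "r * t powr H"] assms by (simp add: \<mu>_tail_def mult.commute)

lemma norm_gt_event: "t \<ge> 0 \<Longrightarrow> {\<omega>\<in>space M. norm (X t \<omega>) > r} \<in> events"
  using X_meas[of t] by measurable

lemma \<mu>_tail_antimono: "r \<le> s \<Longrightarrow> \<mu>_tail s \<le> \<mu>_tail r"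
  unfolding \<mu>_tail_def by (intro finite_measure_mono norm_gt_event) auto

lemma \<mu>_tail_nonneg: "\<mu>_tail r \<ge> 0" by (simp add: \<mu>_tail_def)

lemma \<mu>_tail_limit: "(\<mu>_tail \<longlongrightarrow> 0) at_top"
proof (rule tendstoI)
  fix e :: real assume "e > 0"
  have "(\<lambda>n. \<mu>_tail (real n)) \<longlonglongrightarrow> prob (\<Inter>n. {\<omega>\<in>space M. norm (X 1 \<omega>) > real n})"
    unfolding \<mu>_tail_def
    by (rule finite_Lim_measure_decseq) (auto simp: decseq_def intro!: norm_gt_event)
  moreover have "(\<Inter>n. {\<omega>\<in>space M. norm (X 1 \<omega>) > real n}) = {}"
  proof -
    have "\<exists>n. \<not> norm (X 1 \<omega>) > real n" for \<omega> using real_arch_simple[of "norm (X 1 \<omega>)"] by (auto simp: not_less)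
    then show ?thesis by auto
  qed
  ultimately have "(\<lambda>n. \<mu>_tail (real n)) \<longlonglongrightarrow> 0" by simp
  then have "\<forall>\<^sub>F n in sequentially. \<mu>_tail (real n) < e" using \<open>e > 0\<close> by (rule order_tendstoD)
  then obtain n where n: "\<mu>_tail (real n) < e" by (auto simp: eventually_sequentially)
  show "\<forall>\<^sub>F r in at_top. dist (\<mu>_tail r) 0 < e"
    using eventually_ge_at_top[of "real n"]
  proof eventually_elim
    case (elim r)
    then show ?case using \<mu>_tail_antimono[of "real n" r] n \<mu>_tail_nonneg[of r] by (simp add: dist_real_def)
  qed
qed

text \<open>Rescaling time fixes 0, so the law of \<open>X 0\<close> is invariant under all positive
  dilations: the tail at \<open>e\<close> equals the tail at \<open>e * (real n + 1)\<close> for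
  every \<open>n\<close>, hence is 0.\<close>

lemma X_0: "AE \<omega> in M. X 0 \<omega> = 0"
proof -
  have null: "prob {\<omega>\<in>space M. norm (X 0 \<omega>) > e} = 0" if e: "e > 0" for e
  proof -
    have eq: "prob {\<omega>\<in>space M. norm (X 0 \<omega>) > e} = prob {\<omega>\<in>space M. norm (X 0 \<omega>) > e * (real n + 1)}" for n
    proof -
      \<comment> \<open>Chosen so that \<open>c powr H\<close> is
        \<open>1 / (real n + 1)\<close>.\<close>
      define c where "c = (1 / (real n + 1)) powr (1 / H)"
      have c: "c > 0" "c powr H = 1 / (real n + 1)" using H_pos by (auto simp: c_def powr_powr)
      have "prob {\<omega>\<in>space M. norm (X (c * 0) \<omega>) > e} = prob {\<omega>\<in>space M. c powr H * norm (X 0 \<omega>) > e}"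
        by (rule scaling_at) (use c in auto)
      then show ?thesis unfolding c(2) by (simp add: field_simps)
    qed
    have "(\<lambda>n. prob {\<omega>\<in>space M. norm (X 0 \<omega>) > e * (real n + 1)}) \<longlonglongrightarrow> prob (\<Inter>n. {\<omega>\<in>space M. norm (X 0 \<omega>) > e * (real n + 1)})"
    proof (rule finite_Lim_measure_decseq)
      show "decseq (\<lambda>n. {\<omega>\<in>space M. norm (X 0 \<omega>) > e * (real n + 1)})"
      proof (rule decseq_SucI, rule subsetI)
        fix n \<omega> assume "\<omega> \<in> {\<omega>\<in>space M. norm (X 0 \<omega>) > e * (real (Suc n) + 1)}"
        moreover have "e * (real n + 1) \<le> e * (real (Suc n) + 1)" using e by simp
        ultimately show "\<omega> \<in> {\<omega>\<in>space M. norm (X 0 \<omega>) > e * (real n + 1)}" by auto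
      qed
    qed (auto intro!: norm_gt_event)
    moreover have "(\<Inter>n. {\<omega>\<in>space M. norm (X 0 \<omega>) > e * (real n + 1)}) = {}"
    proof -
      have "\<exists>n. \<not> norm (X 0 \<omega>) > e * (real n + 1)" for \<omega>
      proof -
        obtain n where "norm (X 0 \<omega>) / e \<le> real n" using real_arch_simple by blast
        then have "norm (X 0 \<omega>) \<le> e * (real n + 1)" using e by (simp add: field_simps)
        then show ?thesis by (auto simp: not_less)
      qed
      then show ?thesis by auto
    qed
    ultimately have "(\<lambda>n::nat. prob {\<omega>\<in>space M. norm (X 0 \<omega>) > e}) \<longlonglongrightarrow> 0" by (simp add: eq[symmetric])
    then show ?thesis by (simp add: LIMSEQ_const_iff)
  qed
  have "AE \<omega> in M. \<not> norm (X 0 \<omega>) > 1 / (real n + 1)" for n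
    using null[of "1 / (real n + 1)"] norm_gt_event[of 0 "1 / (real n + 1)"]
    by (subst AE_iff_measurable[OF _ refl]) (auto simp: emeasure_eq_measure)
  then have "AE \<omega> in M. \<forall>n::nat. \<not> norm (X 0 \<omega>) > 1 / (real n + 1)" by (simp add: AE_all_countable)
  then show ?thesis
  proof eventually_elim
    case (elim \<omega>)
    show ?case
    proof (rule ccontr)
      assume "X 0 \<omega> \<noteq> 0"
      then have "norm (X 0 \<omega>) > 0" by simp
      then obtain n where "1 / real (Suc n) < norm (X 0 \<omega>)" using nat_approx_posE by metis
      then show False using elim by (auto simp: add.commute)
    qed
  qed
qed

lemma increments_indep:
  assumes "0 \<le> t 0" "strict_mono t"
  shows "indep_vars (\<lambda>_. borel) (\<lambda>i \<omega>. X (t (Suc i)) \<omega> - X (t i) \<omega>) (UNIV :: nat set)"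
proof -
  let ?V = "\<lambda>i \<omega>. X (t (Suc i)) \<omega> - X (t i) \<omega>"
  have n: "indep_vars (\<lambda>_. borel) ?V {..<n}" for n
    using ssap assms unfolding selfsimilar_additive_process_def independent_increments_def
    by (auto simp: strict_mono_on_def strict_mono_def)
  have rv: "random_variable borel (?V i)" for i
    using n[of "Suc i"] by (auto simp: indep_vars_def)
  have "indep_sets (\<lambda>i. {?V i -` A \<inter> space M |A. A \<in> sets borel}) UNIV"
  proof (subst indep_sets_finite_index_sets, intro allI impI)
    fix J :: "nat set" assume J: "J \<subseteq> UNIV" "J \<noteq> {}" "finite J"
    then obtain n where "J \<subseteq> {..<n}" using finite_nat_iff_bounded by blast
    then have "indep_vars (\<lambda>_. borel) ?V J" using n indep_vars_subset by blast
    then show "indep_sets (\<lambda>i. {?V i -` A \<inter> space M |A. A \<in> sets borel}) J"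
      unfolding indep_vars_def2 by blast
  qed
  then show ?thesis unfolding indep_vars_def2 using rv by blast
qed

text \<open>Ottaviani's hypothesis comes from selfsimilarity: at each time up to \<open>T\<close>
  the process exceeds \<open>y * T powr H\<close> with probability at most 1/4. A difference of two
  values then exceeds twice that level with probability at most 1/2.\<close>

lemma grid_maximal:
  assumes T: "T > 0" and N: "N > 0" and y: "\<mu>_tail y \<le> 1 / 4" "y \<ge> 0"
  shows "prob {\<omega>\<in>space M. \<exists>i\<le>N. norm (X (T * real i / real N) \<omega> - X 0 \<omega>) > (r + 2 * y) * T powr H} \<le> 2 * \<mu>_tail r"
proof -
  define t where "t i = T * real i / real N" for i
  have t: "t 0 = 0" "t N = T" "strict_mono t" "\<And>i. t i \<ge> 0"
    using T N by (auto simp: t_def strict_mono_def field_simps)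
  let ?V = "\<lambda>i \<omega>. X (t (Suc i)) \<omega> - X (t i) \<omega>"
  have ind: "indep_vars (\<lambda>_. borel) ?V {..<N}"
    by (rule indep_vars_subset[OF increments_indep]) (use t in auto)
  have S: "(\<Sum>j<i. ?V j \<omega>) = X (t i) \<omega> - X 0 \<omega>" for i \<omega>
    using sum_lessThan_telescope[of "\<lambda>j. X (t j) \<omega>" i] t(1) by simp
  have S': "(\<Sum>j\<in>{i..<N}. ?V j \<omega>) = X T \<omega> - X (t i) \<omega>" if "i \<le> N" for i \<omega>
    using sum_Suc_diff'[OF that, of "\<lambda>j. X (t j) \<omega>"] t(2) by simp
  have TH: "T powr H > 0" using T by simp
  \<comment> \<open>Time 0 is treated apart because it is not a rescaling of time 1.\<close>
  have quarter: "prob {\<omega>\<in>space M. norm (X s \<omega>) > y * T powr H} \<le> 1 / 4" if s: "0 \<le> s" "s \<le> T" for s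
  proof (cases "s = 0")
    case True
    have "AE \<omega> in M. \<omega> \<notin> {\<omega>\<in>space M. norm (X s \<omega>) > y * T powr H}"
      using X_0 by eventually_elim (use y TH True in \<open>auto simp: not_less\<close>)
    then have "prob {\<omega>\<in>space M. norm (X s \<omega>) > y * T powr H} = 0"
      using norm_gt_event[OF s(1)] by (subst prob_eq_0) auto
    then show ?thesis by simp
  next
    case False
    have "y * s powr H \<le> y * T powr H" using s H_pos y by (intro mult_left_mono powr_mono2) auto
    then have "prob {\<omega>\<in>space M. norm (X s \<omega>) > y * T powr H} \<le> prob {\<omega>\<in>space M. norm (X s \<omega>) > y * s powr H}"
      using s by (intro finite_measure_mono norm_gt_event) auto
    also have "\<dots> = \<mu>_tail y" using s False by (intro tail_at) auto
    finally show ?thesis using y by simp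
  qed
  have half: "1 / 2 \<le> prob {\<omega>\<in>space M. norm (\<Sum>j\<in>{i..<N}. ?V j \<omega>) \<le> 2 * y * T powr H}" if i: "i \<le> N" for i
  proof -
    have "T * real i \<le> T * real N" using i T by (intro mult_left_mono) auto
    then have ti: "t i \<le> T" "0 \<le> t i" using N t(4)[of i] by (simp_all only: t_def) (simp add: pos_divide_le_eq)
    note ti = ti(2,1)
    let ?A = "{\<omega>\<in>space M. norm (X T \<omega>) > y * T powr H}" and ?B = "{\<omega>\<in>space M. norm (X (t i) \<omega>) > y * T powr H}"
    have AB: "?A \<in> events" "?B \<in> events" using norm_gt_event[OF ti(1)] norm_gt_event[of T] T by simp_all
    have "prob (?A \<union> ?B) \<le> prob ?A + prob ?B" using AB by (rule measure_Un_le)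
    also have "\<dots> \<le> 1 / 2" using quarter[of T] quarter[OF ti] T by simp
    finally have "1 / 2 \<le> prob (space M - (?A \<union> ?B))" by (subst prob_compl[OF sets.Un[OF AB]]) linarith
    also have "\<dots> \<le> prob {\<omega>\<in>space M. norm (\<Sum>j\<in>{i..<N}. ?V j \<omega>) \<le> 2 * y * T powr H}"
    proof (rule finite_measure_mono)
      have "(\<lambda>\<omega>. X T \<omega> - X (t i) \<omega>) \<in> borel_measurable M" using X_meas ti T by (intro borel_measurable_diff) auto
      then show "{\<omega>\<in>space M. norm (\<Sum>j\<in>{i..<N}. ?V j \<omega>) \<le> 2 * y * T powr H} \<in> events"
        unfolding S'[OF i] by measurable
      show "space M - (?A \<union> ?B) \<subseteq> {\<omega>\<in>space M. norm (\<Sum>j\<in>{i..<N}. ?V j \<omega>) \<le> 2 * y * T powr H}"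
      proof
        fix \<omega> assume w: "\<omega> \<in> space M - (?A \<union> ?B)"
        have "norm (X T \<omega> - X (t i) \<omega>) \<le> norm (X T \<omega>) + norm (X (t i) \<omega>)" by (rule norm_triangle_ineq4)
        also have "\<dots> \<le> y * T powr H + y * T powr H" using w by (intro add_mono) auto
        finally show "\<omega> \<in> {\<omega>\<in>space M. norm (\<Sum>j\<in>{i..<N}. ?V j \<omega>) \<le> 2 * y * T powr H}"
          using w unfolding S'[OF i] by simp
      qed
    qed
    finally show ?thesis .
  qed
  have X0T: "prob {\<omega>\<in>space M. norm (X T \<omega> - X 0 \<omega>) > r * T powr H} = \<mu>_tail r"
  proof -
    have m: "(\<lambda>\<omega>. X T \<omega> - X 0 \<omega>) \<in> borel_measurable M" using X_meas T by (intro borel_measurable_diff) auto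
    have "prob {\<omega>\<in>space M. norm (X T \<omega> - X 0 \<omega>) > r * T powr H} = prob {\<omega>\<in>space M. norm (X T \<omega>) > r * T powr H}"
    proof (rule finite_measure_eq_AE)
      show "AE \<omega> in M. (\<omega> \<in> {\<omega>\<in>space M. norm (X T \<omega> - X 0 \<omega>) > r * T powr H}) = (\<omega> \<in> {\<omega>\<in>space M. norm (X T \<omega>) > r * T powr H})"
        using X_0 by eventually_elim simp
      show "{\<omega>\<in>space M. norm (X T \<omega> - X 0 \<omega>) > r * T powr H} \<in> events" using m by measurable
      show "{\<omega>\<in>space M. norm (X T \<omega>) > r * T powr H} \<in> events" using T by (intro norm_gt_event) auto
    qed
    then show ?thesis using tail_at[OF T] by simp
  qed
  have "prob {\<omega>\<in>space M. \<exists>i\<le>N. norm (\<Sum>j<i. ?V j \<omega>) > r * T powr H + 2 * y * T powr H}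
     \<le> 2 * prob {\<omega>\<in>space M. norm (\<Sum>j<N. ?V j \<omega>) > r * T powr H}"
    by (rule ottaviani[OF ind half])
  then show ?thesis
    unfolding S t(2) X0T by (simp add: t_def distrib_right)
qed

text \<open>Right continuity carries the bound from grids to all times below \<open>T\<close>. The
  event of a large value at some \<open>t\<close> is an uncountable union, so it is covered almost
  surely by a measurable \<open>E\<close>.\<close>

lemma maximal:
  assumes T: "T > 0" and y: "\<mu>_tail y \<le> 1 / 4" "y \<ge> 0"
  obtains E where "E \<in> events" "prob E \<le> 2 * \<mu>_tail r"
    "AE \<omega> in M. (\<exists>t\<in>{0..<T}. norm (X t \<omega>) > (r + 2 * y) * T powr H) \<longrightarrow> \<omega> \<in> E"
proof -
  define z where "z = (r + 2 * y) * T powr H"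
  define F where "F N = {\<omega>\<in>space M. \<exists>i\<le>Suc N. norm (X (T * real i / real (Suc N)) \<omega> - X 0 \<omega>) > z}" for N
  have F_meas: "F N \<in> events" for N
  proof -
    have "{\<omega>\<in>space M. norm (X (T * real i / real (Suc N)) \<omega> - X 0 \<omega>) > z} \<in> events" for i
    proof -
      have "(\<lambda>\<omega>. X (T * real i / real (Suc N)) \<omega> - X 0 \<omega>) \<in> borel_measurable M"
        using T by (intro borel_measurable_diff X_meas) auto
      then show ?thesis by measurable
    qed
    then have "(\<Union>i\<in>{..Suc N}. {\<omega>\<in>space M. norm (X (T * real i / real (Suc N)) \<omega> - X 0 \<omega>) > z}) \<in> events" by blast
    also have "(\<Union>i\<in>{..Suc N}. {\<omega>\<in>space M. norm (X (T * real i / real (Suc N)) \<omega> - X 0 \<omega>) > z}) = F N"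
      by (auto simp: F_def)
    finally show ?thesis .
  qed
  have F_prob: "prob (F N) \<le> 2 * \<mu>_tail r" for N
    unfolding F_def z_def by (rule grid_maximal[OF T _ y]) simp
  \<comment> \<open>The grids are not nested, so the events \<open>F N\<close> need not increase. A
    right-continuous path that is large somewhere is large on all sufficiently fine grids, and the
    union of the \<open>D K\<close> is exactly that limit inferior.\<close>
  define D where "D K = (\<Inter>N\<in>{K..}. F N)" for K
  have D_meas: "D K \<in> events" for K unfolding D_def by (intro sets.countable_INT') (use F_meas in auto)
  have D_prob: "prob (D K) \<le> 2 * \<mu>_tail r" for K
  proof -
    have "prob (D K) \<le> prob (F K)" using F_meas by (intro finite_measure_mono) (auto simp: D_def)
    then show ?thesis using F_prob[of K] by simp
  qed
  show ?thesis
  proof (rule that[of "\<Union>K. D K"])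
    show "(\<Union>K. D K) \<in> events" using D_meas by blast
    have "(\<lambda>K. prob (D K)) \<longlonglongrightarrow> prob (\<Union>K. D K)"
      by (rule finite_Lim_measure_incseq) (use D_meas in \<open>auto simp: incseq_def D_def\<close>)
    then show "prob (\<Union>K. D K) \<le> 2 * \<mu>_tail r"
      by (rule LIMSEQ_le_const2) (use D_prob in auto)
    have "AE \<omega> in M. cadlag (\<lambda>t. X t \<omega>)" using ssap by (simp add: selfsimilar_additive_process_def)
    then show "AE \<omega> in M. (\<exists>t\<in>{0..<T}. norm (X t \<omega>) > (r + 2 * y) * T powr H) \<longrightarrow> \<omega> \<in> (\<Union>K. D K)"
      using X_0 AE_space
    proof eventually_elim
      case (elim \<omega>)
      show ?case unfolding z_def[symmetric]
      proof
        assume "\<exists>t\<in>{0..<T}. norm (X t \<omega>) > z"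
        then obtain t where t: "0 \<le> t" "t < T" "norm (X t \<omega>) > z" by auto
        have "continuous (at_right t) (\<lambda>t. X t \<omega>)" using elim t by (simp add: cadlag_def)
        then have "((\<lambda>s. norm (X s \<omega>)) \<longlongrightarrow> norm (X t \<omega>)) (at_right t)"
          by (intro tendsto_norm) (simp add: continuous_within)
        then have "\<forall>\<^sub>F s in at_right t. norm (X s \<omega>) > z" using t(3) by (rule order_tendstoD)
        then obtain u where u: "u > t" "\<And>s. t < s \<Longrightarrow> s < u \<Longrightarrow> norm (X s \<omega>) > z"
          using eventually_at_right_field by metis
        \<comment> \<open>Length of an interval to the right of \<open>t\<close> on which the path
          stays large and time stays below \<open>T\<close>; any grid finer than \<open>d\<close>
          has a point in it.\<close>
        define d where "d = min u T - t"
        have d: "d > 0" using u t by (auto simp: d_def)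
        obtain K :: nat where K: "T / d < real K" using reals_Archimedean2 by blast
        have "\<omega> \<in> F N" if N: "N \<ge> K" for N
        proof -
          define n where "n = real (Suc N)"
          have n: "n > 0" "T / n < d"
          proof -
            have "T / d < n" using K N by (simp add: n_def)
            then show "n > 0" "T / n < d" using d T by (auto simp: n_def field_simps)
          qed
          \<comment> \<open>Index of the first grid point strictly to the right of
            \<open>t\<close>.\<close>
          define i where "i = nat (\<lfloor>t * n / T\<rfloor> + 1)"
          have pos: "t * n / T \<ge> 0" using t T n by simp
          then have i: "t * n / T < real i" "real i \<le> t * n / T + 1" unfolding i_def by linarith+
          have i1: "t < T * real i / n" using i(1) T n by (simp add: field_simps)
          have "T * real i \<le> T * (t * n / T + 1)" using i(2) T by (intro mult_left_mono) auto
          also have "T * (t * n / T + 1) = t * n + T" using T by (simp add: distrib_left)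
          finally have "T * real i / n \<le> t + T / n" using n(1) by (simp add: field_simps)
          then have i2: "T * real i / n < min u T" using n(2) unfolding d_def by linarith
          then have "T * real i < T * n" using n(1) by (simp add: pos_divide_less_eq)
          then have i3: "i \<le> Suc N" using T by (simp add: n_def)
          have "norm (X (T * real i / n) \<omega>) > z" using u(2)[OF i1] i2 by simp
          then show "\<omega> \<in> F N" unfolding F_def using i3 elim by (auto simp: n_def intro!: exI[of _ i])
        qed
        then show "\<omega> \<in> (\<Union>K. D K)" by (auto simp: D_def intro!: exI[of _ K])
      qed
    qed
  qed
qed

end

section \<open>Almost sure upper and lower bounds for the process\<close>

text \<open>Substitute for monotonicity of \<phi>. With \<open>c\<close> strictly between 1 and
  \<open>2 powr \<alpha>\<close>, \<open>g (\<phi> s)\<close> is below \<open>c * ln s\<close> and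
  \<open>g (2 * \<phi> (s + h))\<close> is above \<open>c * ln (s + h)\<close>; monotonicity of
  \<open>g\<close> then orders the arguments.\<close>

lemma (in growth_scale) phi_double:
  assumes "h > 0" shows "\<forall>\<^sub>F s in at_top. \<phi> s \<le> 2 * \<phi> (s + h)"
proof -
  define c where "c = (1 + 2 powr \<alpha>) / 2"
  have "(2::real) powr \<alpha> > 1" using \<alpha>_pos by (simp add: gr_one_powr)
  then have c: "1 < c" "c < 2 powr \<alpha>" by (auto simp: c_def)
  have "((\<lambda>s. g (1 * \<phi> s) / ln s) \<longlongrightarrow> 1 powr \<alpha>) at_top" by (rule g_phi) simp
  then have e1: "\<forall>\<^sub>F s in at_top. g (1 * \<phi> s) / ln s < c" using c by (intro order_tendstoD) auto
  have sh: "filterlim (\<lambda>s. s + h) at_top at_top" by real_asymp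
  have "((\<lambda>s. g (2 * \<phi> s) / ln s) \<longlongrightarrow> 2 powr \<alpha>) at_top" by (rule g_phi) simp
  then have "\<forall>\<^sub>F s in at_top. g (2 * \<phi> s) / ln s > c" using c by (intro order_tendstoD) auto
  then have e2: "\<forall>\<^sub>F s in at_top. g (2 * \<phi> (s + h)) / ln (s + h) > c" by (rule eventually_compose_filterlim[OF _ sh])
  show ?thesis using e1 e2 eventually_gt_at_top[of 1] phi_pos_ev
  proof eventually_elim
    case (elim s)
    have l: "0 < ln s" "ln s \<le> ln (s + h)" using elim assms by auto
    have "g (\<phi> s) < c * ln s" using elim(1) l by (simp add: field_simps)
    also have "\<dots> \<le> c * ln (s + h)" using l c by (intro mult_left_mono) auto
    also have "\<dots> < g (2 * \<phi> (s + h))" using elim(2) l by (simp add: field_simps)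
    finally have lt: "g (\<phi> s) < g (2 * \<phi> (s + h))" .
    show ?case
    proof (rule ccontr)
      assume n: "\<not> \<phi> s \<le> 2 * \<phi> (s + h)"
      show False
      proof (cases "0 \<le> 2 * \<phi> (s + h)")
        case True
        then show False using g_mono[of "2 * \<phi> (s + h)" "\<phi> s"] n lt by simp
      next
        case False
        then have "\<phi> (s + h) < 0" by simp
        then show False by (simp add: \<phi>_def divide_less_0_iff)
      qed
    qed
  qed
qed

text \<open>By monotonicity \<open>T r\<close> is at most every term whose argument
  \<open>b * \<phi> (real (Suc n) * h)\<close> does not exceed \<open>r\<close>. As
  \<open>g (b * \<phi> s)\<close> is at most \<open>c * ln s\<close>, there are about
  \<open>exp (g r / c) / h\<close> such terms, and a bounded sum forces \<open>T r\<close> below a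
  constant times \<open>exp (- g r / c)\<close>.\<close>

lemma (in growth_scale) tail_le_of_summable:
  assumes antimono: "\<And>r s. r \<le> s \<Longrightarrow> T s \<le> T r" and nonneg: "\<And>r. 0 \<le> T r" and b: "0 < b" and h: "0 < h"
    and summable: "summable (\<lambda>n. T (b * \<phi> (real (Suc n) * h)))" and \<kappa>: "0 < \<kappa>" "\<kappa> * b powr \<alpha> < 1"
  shows "tail_le T \<kappa>"
proof -
  define p where "p n = T (b * \<phi> (real (Suc n) * h))" for n
  have p: "summable p" using summable unfolding p_def[abs_def] .
  have p0: "p n \<ge> 0" for n by (simp add: p_def nonneg)
  define S where "S = suminf p"
  have S0: "S \<ge> 0" unfolding S_def using p p0 by (rule suminf_nonneg)
  have "b powr \<alpha> < 1 / \<kappa>" using \<kappa> by (simp add: field_simps)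
  \<comment> \<open>Above \<open>b powr \<alpha>\<close> so that the asymptotics of
    \<open>g (b * \<phi> s)\<close> apply, below \<open>1 / \<kappa>\<close> so that the rate
    \<open>1 / c\<close> beats \<kappa>.\<close>
  then obtain c where c: "b powr \<alpha> < c" "c < 1 / \<kappa>" using dense by blast
  have c0: "c > 0" using c(1) powr_ge_zero[of b \<alpha>] by linarith
  have "\<forall>\<^sub>F s in at_top. g (b * \<phi> s) / ln s < c" using g_phi[OF b] c(1) by (rule order_tendstoD)
  then have "\<forall>\<^sub>F s in at_top. 1 < s \<and> g (b * \<phi> s) \<le> c * ln s \<and> \<phi> s > 0"
    using eventually_gt_at_top[of 1] phi_pos_ev by eventually_elim (simp add: field_simps)
  then obtain S1 where S0: "\<And>s. s \<ge> S1 \<Longrightarrow> 1 < s" "\<And>s. s \<ge> S1 \<Longrightarrow> g (b * \<phi> s) \<le> c * ln s" "\<And>s. s \<ge> S1 \<Longrightarrow> \<phi> s > 0"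
    unfolding eventually_at_top_linorder by blast
  define n0 where "n0 = nat \<lceil>S1 / h\<rceil>"
  have n0: "real (Suc n) * h \<ge> S1" if "n \<ge> n0" for n
  proof -
    have "S1 / h \<le> real (Suc n)" using that unfolding n0_def by linarith
    then show ?thesis using h by (simp add: field_simps)
  qed
  have "filterlim (\<lambda>r. exp (g r / c)) at_top at_top"
  proof (rule filterlim_compose[OF exp_at_top])
    have "filterlim (\<lambda>r. (1 / c) * g r) at_top at_top"
      by (rule filterlim_tendsto_pos_mult_at_top[OF tendsto_const _ g_at_top]) (use c0 in simp)
    then show "filterlim (\<lambda>r. g r / c) at_top at_top" by simp
  qed
  \<comment> \<open>Large enough that after dropping the first \<open>n0\<close> indices and
    rounding, at least half of the \<open>exp (g r / c) / h\<close> indices remain.\<close>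
  then have "\<forall>\<^sub>F r in at_top. exp (g r / c) \<ge> 2 * h * (real n0 + 3)" by (simp add: filterlim_at_top)
  then have ev: "\<forall>\<^sub>F r in at_top. T r \<le> (2 * h * S) * exp (- (1 / c) * g r)"
    using eventually_gt_at_top[of 0]
  proof eventually_elim
    case (elim r)
    define m where "m = nat \<lfloor>exp (g r / c) / h\<rfloor>"
    have x: "exp (g r / c) / h \<ge> 2 * (real n0 + 3)" using elim(1) h by (simp add: field_simps)
    have m: "real m \<le> exp (g r / c) / h" "exp (g r / c) / h < real m + 1" 
    proof -
      have "real (nat \<lfloor>z\<rfloor>) \<le> z \<and> z < real (nat \<lfloor>z\<rfloor>) + 1" if "z \<ge> 0" for z :: real using that by linarith
      from this[of "exp (g r / c) / h"] x
      show "real m \<le> exp (g r / c) / h" "exp (g r / c) / h < real m + 1" by (auto simp: m_def)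
    qed
    have le: "T r \<le> p n" if n: "n \<in> {n0..<m - 1}" for n
    proof -
      let ?s = "real (Suc n) * h"
      have "n < m - 1" using n by simp
      then have "Suc n < m" by linarith
      then have "real (Suc n) < real m" by (simp only: of_nat_less_iff)
      then have "?s < real m * h" using h by (simp only: mult_less_cancel_right_pos)
      moreover have "real m * h \<le> exp (g r / c)" using m(1) h by (simp add: pos_le_divide_eq)
      ultimately have "?s < exp (g r / c)" by linarith
      moreover have s1: "?s \<ge> S1" using n by (intro n0) simp
      moreover have "?s > 1" by (rule S0(1)[OF s1])
      ultimately have "ln ?s < ln (exp (g r / c))" by (subst ln_less_cancel_iff) auto
      then have "ln ?s < g r / c" by (simp only: ln_exp)
      then have "c * ln ?s < g r" using c0 by (simp add: field_simps)
      then have "g (b * \<phi> ?s) < g r" using S0(2)[OF s1] by linarith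
      then have "b * \<phi> ?s \<le> r" using g_mono[of r "b * \<phi> ?s"] elim(2) by linarith
      then show ?thesis unfolding p_def by (rule antimono)
    qed
    have "(exp (g r / c) / (2 * h)) * T r \<le> real (m - 1 - n0) * T r"
    proof (intro mult_right_mono nonneg)
      have "z \<le> 2 * real (m - 1 - n0)" if "2 * (real n0 + 3) \<le> z" "z < real m + 1" for z
      proof -
        have "real m - 1 - real n0 \<le> real (m - 1 - n0)" by linarith
        then have "2 * (real m - 1 - real n0) \<le> 2 * real (m - 1 - n0)" by (rule mult_left_mono) simp
        moreover have "z \<le> 2 * (real m - 1 - real n0)" using that by argo
        ultimately show ?thesis by (rule order_trans[rotated])
      qed
      from this[OF x m(2)] have "exp (g r / c) / h \<le> 2 * real (m - 1 - n0)" .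
      then show "exp (g r / c) / (2 * h) \<le> real (m - 1 - n0)" using h by (simp add: field_simps)
    qed
    also have "\<dots> = (\<Sum>n\<in>{n0..<m - 1}. T r)" by simp
    also have "\<dots> \<le> (\<Sum>n\<in>{n0..<m - 1}. p n)" by (intro sum_mono le)
    also have "\<dots> \<le> S" unfolding S_def using p p0 by (intro sum_le_suminf) auto
    finally have "exp (g r / c) * T r \<le> 2 * h * S" using h by (simp add: field_simps)
    then have "exp (- (1 / c) * g r) * (exp (g r / c) * T r) \<le> exp (- (1 / c) * g r) * (2 * h * S)"
      by (intro mult_left_mono) auto
    moreover have "exp (- (1 / c) * g r) * exp (g r / c) = 1" by (simp add: exp_add[symmetric])
    then have "exp (- (1 / c) * g r) * (exp (g r / c) * T r) = T r" by (simp only: mult.assoc[symmetric] mult_1_left)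
    ultimately show ?case by (simp only: mult.commute)
  qed
  show ?thesis
  proof (rule tail_le_transfer[of "\<lambda>r. exp (- (1 / c) * g r)" "1 / c" 1 \<kappa> "2 * h * S" T 0])
    show "tail_le (\<lambda>r. exp (- (1 / c) * g r)) (1 / c)" by (simp add: tail_le_def)
    show "\<kappa> < 1 / c * 1 powr \<alpha>" using c c0 \<kappa>(1) by (simp add: field_simps)
    show "0 \<le> 2 * h * S" using h \<open>S \<ge> 0\<close> by simp
    show "\<forall>\<^sub>F r in at_top. T r \<le> 2 * h * S * exp (- (1 / c) * g (1 * r - 0))" using ev by simp
  qed (use c0 in auto)
qed

locale selfsimilar_growth = growth_scale \<alpha> f + selfsimilar_process M H X
  for \<alpha> :: real and f :: "real \<Rightarrow> real" and M :: "'w measure" and H :: real and X :: "real \<Rightarrow> 'w \<Rightarrow> 'a::euclidean_space"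
begin

lemma quarter_bound: obtains y where "y \<ge> 0" "\<mu>_tail y \<le> 1 / 4"
proof -
  have "\<forall>\<^sub>F y in at_top. \<mu>_tail y < 1 / 4" using \<mu>_tail_limit by (rule order_tendstoD) simp
  with eventually_ge_at_top[of 0] have "\<forall>\<^sub>F y in at_top. 0 \<le> y \<and> \<mu>_tail y \<le> 1 / 4" by eventually_elim auto
  then obtain y where "0 \<le> y \<and> \<mu>_tail y \<le> 1 / 4" using eventually_happens'[OF trivial_limit_at_top_linorder] by blast
  then show ?thesis using that by blast
qed

text \<open>Logarithmic time is cut into blocks of length \<delta>. On each block the maximal
  inequality gives a probability of order \<open>s powr (- \<theta>)\<close> with \<theta> > 1,
  which is summable over the blocks. Within a block both \<open>t powr H\<close> and the comparison
  of values of \<phi> cost one factor \<open>u\<close>.\<close>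

lemma upper_bound:
  assumes tail: "tail_le \<mu>_tail \<kappa>" and \<kappa>: "0 < \<kappa>" and a: "a > 0" "1 < \<kappa> * a powr \<alpha>"
  shows "AE \<omega> in M. \<forall>\<^sub>F t in at_top. norm (X t \<omega>) \<le> a * (t powr H * \<phi> (ln t))"
proof -
  obtain y where y: "y \<ge> 0" "\<mu>_tail y \<le> 1 / 4" by (rule quarter_bound)
  obtain b where b: "0 < b" "b < 1" "1 < (\<kappa> * a powr \<alpha>) * b powr \<alpha>" using shrink_factor[of 1 "\<kappa> * a powr \<alpha>"] a(2) by auto
  \<comment> \<open>After the two factors \<open>u\<close> are removed from \<open>a\<close>, the
    level \<open>a2 = a * b powr (2 / 3)\<close> still exceeds \<open>a0 = a * b\<close>. The gap
    absorbs the term \<open>2 * y\<close> of the maximal inequality, and \<open>a0\<close> still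
    satisfies \<open>\<kappa> * a0 powr \<alpha> > 1\<close>.\<close>
  define u where "u = b powr (- (1 / 3))"
  define a2 where "a2 = a / (u * u)"
  define a0 where "a0 = a * b"
  have u: "u > 1" "u > 0" using b by (auto simp: u_def gr_one_powr powr_minus one_less_inverse_iff powr01_less_one)
  have "u * u = b powr (- (2 / 3))" by (simp add: u_def powr_add[symmetric])
  then have "a2 = a * b powr (2 / 3)" by (simp add: a2_def powr_minus_divide)
  moreover have "b < b powr (2 / 3)"
  proof -
    have "ln b < 0" using b by simp
    then have "exp (ln b) < exp (2 / 3 * ln b)" by (subst exp_less_cancel_iff) simp
    then show ?thesis using b by (simp add: powr_def)
  qed
  ultimately have a02: "0 < a0" "a0 < a2" "a2 > 0" using a b by (auto simp: a0_def)
  define \<delta> where "\<delta> = ln u / H"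
  have \<delta>: "\<delta> > 0" "exp (H * \<delta>) = u" using u H_pos by (auto simp: \<delta>_def)
  have "1 / \<kappa> < a0 powr \<alpha>" using b a \<kappa> by (simp add: a0_def powr_mult field_simps)
  then obtain \<theta>' where th': "1 / \<kappa> < \<theta>'" "\<theta>' < a0 powr \<alpha>" using dense by blast
  define \<theta> where "\<theta> = \<kappa> * \<theta>'"
  have \<theta>: "\<theta> > 1" using th' \<kappa> by (simp add: \<theta>_def field_simps)
  have e1: "\<forall>\<^sub>F s in at_top. \<phi> s \<ge> 1" using phi_at_top by (simp add: filterlim_at_top)
  have e2: "\<forall>\<^sub>F s in at_top. \<phi> s \<ge> 2 * y / (a2 - a0)" using phi_at_top by (simp add: filterlim_at_top)
  have "filterlim (\<lambda>s. a0 * \<phi> s) at_top at_top"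
    by (rule filterlim_tendsto_pos_mult_at_top[OF tendsto_const a02(1) phi_at_top])
  then have e3: "\<forall>\<^sub>F s in at_top. \<mu>_tail (a0 * \<phi> s) \<le> exp (- \<kappa> * g (a0 * \<phi> s))"
    by (rule eventually_compose_filterlim[OF tail[unfolded tail_le_def]])
  have e4: "\<forall>\<^sub>F s in at_top. g (a0 * \<phi> s) / ln s > \<theta>'"
    using g_phi[OF a02(1)] th'(2) by (rule order_tendstoD)
  have "\<forall>\<^sub>F s in at_top. \<phi> s \<ge> 1 \<and> \<mu>_tail (a2 * \<phi> s - 2 * y) \<le> s powr (- \<theta>)"
    using e1 e2 e3 e4 eventually_gt_at_top[of 1]
  proof eventually_elim
    case (elim s)
    have "2 * y \<le> (a2 - a0) * \<phi> s" using elim(2) a02 by (simp add: field_simps)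
    then have "\<mu>_tail (a2 * \<phi> s - 2 * y) \<le> \<mu>_tail (a0 * \<phi> s)" by (intro \<mu>_tail_antimono) (simp add: algebra_simps)
    also have "\<dots> \<le> exp (- \<kappa> * g (a0 * \<phi> s))" by (rule elim(3))
    also have "\<dots> \<le> exp (- \<theta> * ln s)"
    proof (subst exp_le_cancel_iff)
      have "\<theta>' * ln s \<le> g (a0 * \<phi> s)" using elim(4,5) by (simp add: field_simps)
      then have "\<kappa> * (\<theta>' * ln s) \<le> \<kappa> * g (a0 * \<phi> s)" using \<kappa> by simp
      then show "- \<kappa> * g (a0 * \<phi> s) \<le> - \<theta> * ln s" by (simp add: \<theta>_def mult.assoc)
    qed
    also have "\<dots> = s powr (- \<theta>)" using elim by (simp add: powr_def)
    finally show ?case using elim(1) by simp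
  qed
  then obtain S where S: "\<And>s. s \<ge> S \<Longrightarrow> \<phi> s \<ge> 1" "\<And>s. s \<ge> S \<Longrightarrow> \<mu>_tail (a2 * \<phi> s - 2 * y) \<le> s powr (- \<theta>)"
    unfolding eventually_at_top_linorder by blast
  define n0 where "n0 = Suc (nat \<lceil>S / \<delta>\<rceil>)"
  have n0: "real (n + n0) * \<delta> \<ge> S" "n + n0 > 0" for n
  proof -
    have "S / \<delta> \<le> real (n + n0)" unfolding n0_def by linarith
    then show "real (n + n0) * \<delta> \<ge> S" using \<delta> by (simp add: field_simps)
    show "n + n0 > 0" by (simp add: n0_def)
  qed
  define I where "I n = {real (n + n0) * \<delta>..real (n + n0 + 1) * \<delta>}" for n
  have I_ge: "s \<ge> S" if "s \<in> I n" for s n using that n0[of n] by (auto simp: I_def)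
  text \<open>\<open>\<phi>\<close> need not attain its infimum on \<open>I n\<close>; a near-minimizer is enough.\<close>
  have "\<exists>s\<in>I n. \<forall>s'\<in>I n. \<phi> s \<le> u * \<phi> s'" for n
  proof -
    have ne: "\<phi> ` I n \<noteq> {}" using \<delta> by (auto simp: I_def)
    have bd: "bdd_below (\<phi> ` I n)" by (rule bdd_belowI[of _ 1]) (use S(1) I_ge in auto)
    have ge1: "Inf (\<phi> ` I n) \<ge> 1" by (rule cInf_greatest[OF ne]) (use S(1) I_ge in auto)
    then have "1 * Inf (\<phi> ` I n) < u * Inf (\<phi> ` I n)" using u by (intro mult_strict_right_mono) auto
    then have "Inf (\<phi> ` I n) < u * Inf (\<phi> ` I n)" by simp
    from cInf_lessD[OF ne this] obtain s where s: "s \<in> I n" "\<phi> s < u * Inf (\<phi> ` I n)" by auto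
    have "\<phi> s \<le> u * \<phi> s'" if "s' \<in> I n" for s'
    proof -
      have "Inf (\<phi> ` I n) \<le> \<phi> s'" using that bd by (intro cInf_lower) auto
      then have "u * Inf (\<phi> ` I n) \<le> u * \<phi> s'" using u by simp
      then show ?thesis using s by linarith
    qed
    then show ?thesis using s by blast
  qed
  then obtain s where s: "\<And>n. s n \<in> I n" "\<And>n s'. s' \<in> I n \<Longrightarrow> \<phi> (s n) \<le> u * \<phi> s'" by metis
  define T where "T n = exp (real (n + n0 + 1) * \<delta>)" for n
  define Q where "Q n E \<longleftrightarrow> E \<in> events \<and> prob E \<le> 2 * \<mu>_tail (a2 * \<phi> (s n) - 2 * y) \<and>
      (AE \<omega> in M. (\<exists>t\<in>{0..<T n}. norm (X t \<omega>) > a2 * \<phi> (s n) * T n powr H) \<longrightarrow> \<omega> \<in> E)" for n E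
  have "\<exists>E. Q n E" for n
  proof -
    have "T n > 0" by (simp add: T_def)
    from maximal[OF this y(2,1), of "a2 * \<phi> (s n) - 2 * y"] obtain E
      where "E \<in> events" "prob E \<le> 2 * \<mu>_tail (a2 * \<phi> (s n) - 2 * y)"
        "AE \<omega> in M. (\<exists>t\<in>{0..<T n}. norm (X t \<omega>) > (a2 * \<phi> (s n) - 2 * y + 2 * y) * T n powr H) \<longrightarrow> \<omega> \<in> E"
      by blast
    then show ?thesis unfolding diff_add_cancel Q_def by blast
  qed
  then obtain E where "\<And>n. Q n (E n)" by metis
  then have E: "\<And>n. E n \<in> events" "\<And>n. prob (E n) \<le> 2 * \<mu>_tail (a2 * \<phi> (s n) - 2 * y)"
     "\<And>n. AE \<omega> in M. (\<exists>t\<in>{0..<T n}. norm (X t \<omega>) > a2 * \<phi> (s n) * T n powr H) \<longrightarrow> \<omega> \<in> E n"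
    unfolding Q_def by blast+
  have E_le: "prob (E n) \<le> 2 * \<delta> powr (- \<theta>) * real (n + n0) powr (- \<theta>)" for n
  proof -
    have pos: "real (n + n0) * \<delta> > 0" using n0(2)[of n] \<delta>(1) by (intro mult_pos_pos) (simp_all only: of_nat_0_less_iff)
    have "prob (E n) \<le> 2 * s n powr (- \<theta>)" using E(2)[of n] S(2)[OF I_ge[OF s(1)[of n]]] by linarith
    also have "s n powr (- \<theta>) \<le> (real (n + n0) * \<delta>) powr (- \<theta>)"
      using s(1)[of n] pos \<theta> by (intro powr_mono2') (auto simp: I_def)
    also have "\<dots> = \<delta> powr (- \<theta>) * real (n + n0) powr (- \<theta>)" using \<delta> by (simp add: powr_mult)
    finally show ?thesis by simp
  qed
  have "summable (\<lambda>n. real n powr (- \<theta>))" using \<theta> by (simp add: summable_real_powr_iff)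
  then have "summable (\<lambda>n. real (n + n0) powr (- \<theta>))" by (rule summable_ignore_initial_segment)
  then have "summable (\<lambda>n. 2 * \<delta> powr (- \<theta>) * real (n + n0) powr (- \<theta>))" by (rule summable_mult)
  then have "summable (\<lambda>n. prob (E n))" by (rule summable_comparison_test'[where N = 0]) (use E_le in simp)
  then have "AE \<omega> in M. \<forall>\<^sub>F n in sequentially. \<omega> \<in> space M - E n"
    using E(1) by (intro borel_cantelli_AE1) (auto simp: less_top[symmetric])
  moreover have "AE \<omega> in M. \<forall>n. (\<exists>t\<in>{0..<T n}. norm (X t \<omega>) > a2 * \<phi> (s n) * T n powr H) \<longrightarrow> \<omega> \<in> E n"
    using E(3) by (simp add: AE_all_countable)
  ultimately show ?thesis
  proof eventually_elim
    case (elim \<omega>)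
    then obtain n1 where n1: "\<And>n. n \<ge> n1 \<Longrightarrow> \<omega> \<notin> E n" by (auto simp: eventually_sequentially)
    show ?case using eventually_ge_at_top[of "exp (real (n1 + n0) * \<delta>)"]
    proof eventually_elim
      case (elim t)
      then have t: "t > 0" by (meson exp_gt_zero less_le_trans)
      have lt: "real (n1 + n0) * \<delta> \<le> ln t" using elim t by (simp add: ln_ge_iff)
      define N where "N = nat \<lfloor>ln t / \<delta>\<rfloor>"
      have "real (n1 + n0) \<le> ln t / \<delta>" using lt \<delta> by (simp add: field_simps)
      then have N: "N \<ge> n1 + n0" "real N \<le> ln t / \<delta>" "ln t / \<delta> < real N + 1" unfolding N_def by linarith+
      define n where "n = N - n0"
      have n: "n \<ge> n1" "n + n0 = N" using N by (auto simp: n_def)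
      have lnt: "real N * \<delta> \<le> ln t" "ln t < (real N + 1) * \<delta>" using N \<delta> by (auto simp: field_simps)
      have inI: "ln t \<in> I n" using lnt n(2) by (simp add: I_def add.commute)
      have "t < T n"
      proof -
        have "exp (ln t) < exp ((real N + 1) * \<delta>)" using lnt(2) by simp
        then show ?thesis using t n(2) by (simp add: T_def add.commute)
      qed
      have "\<omega> \<notin> E n" by (rule n1[OF n(1)])
      with \<open>\<forall>n. (\<exists>t\<in>{0..<T n}. norm (X t \<omega>) > a2 * \<phi> (s n) * T n powr H) \<longrightarrow> \<omega> \<in> E n\<close>
      have no: "\<not> (\<exists>t\<in>{0..<T n}. norm (X t \<omega>) > a2 * \<phi> (s n) * T n powr H)" by blast
      have "t \<in> {0..<T n}" using t \<open>t < T n\<close> by simp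
      with no have "\<not> norm (X t \<omega>) > a2 * \<phi> (s n) * T n powr H" by blast
      then have "norm (X t \<omega>) \<le> a2 * \<phi> (s n) * T n powr H" by simp
      also have "\<dots> \<le> a2 * (u * \<phi> (ln t)) * (u * t powr H)"
      proof (intro mult_mono mult_left_mono s(2) inI)
        have "T n powr H = exp (H * (real N * \<delta>)) * exp (H * \<delta>)"
          using n(2) by (simp add: T_def powr_def exp_add[symmetric] algebra_simps)
        also have "\<dots> \<le> exp (H * ln t) * exp (H * \<delta>)" using lnt(1) H_pos by (intro mult_right_mono) auto
        finally show "T n powr H \<le> u * t powr H" using t \<delta> by (simp add: powr_def mult.commute)
        have "\<phi> (ln t) \<ge> 1" by (rule S(1)[OF I_ge[OF inI]])
        then show "0 \<le> a2 * (u * \<phi> (ln t))" using a02 u by simp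
      qed (use a02 S(1)[OF I_ge[OF s(1)[of n]]] in auto)
      also have "\<dots> = a * (t powr H * \<phi> (ln t))" using u by (simp add: a2_def)
      finally show ?case .
    qed
  qed
qed

text \<open>Giving \<open>X 1\<close> the share \<open>d\<close> of the threshold
  \<open>r * q powr H\<close> leaves it the level \<open>d * q powr H * r = r / d\<close>.
  Thresholds thus grow geometrically: the remainder of the iteration tends to 0, and the increment
  tails sum to a multiple of the first exponential bound.\<close>

lemma tail_le_of_increment_tail:
  assumes d: "0 < d" "d < 1" and q: "1 < q" "q powr H = 1 / d\<^sup>2"
    and tail: "tail_le (\<lambda>r. prob {\<omega>\<in>space M. norm (X q \<omega> - X 1 \<omega>) > q powr H * r}) \<kappa>1"
    and \<kappa>1: "0 < \<kappa>1" "\<kappa> < \<kappa>1 * (1 - d) powr \<alpha>"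
  shows "tail_le \<mu>_tail \<kappa>"
proof -
  define T\<xi> where "T\<xi> r = prob {\<omega>\<in>space M. norm (X q \<omega> - X 1 \<omega>) > q powr H * r}" for r
  have ev_xi: "{\<omega>\<in>space M. norm (X q \<omega> - X 1 \<omega>) > z} \<in> events" for z
  proof -
    have "(\<lambda>\<omega>. X q \<omega> - X 1 \<omega>) \<in> borel_measurable M" using q by (intro borel_measurable_diff X_meas) auto
    then show ?thesis by measurable
  qed
  have step: "\<mu>_tail r \<le> T\<xi> ((1 - d) * r) + \<mu>_tail (1 / d * r)" for r
  proof -
    have "\<mu>_tail r = prob {\<omega>\<in>space M. norm (X q \<omega>) > r * q powr H}" using tail_at[of q r] q by simp
    also have "\<dots> \<le> prob ({\<omega>\<in>space M. norm (X q \<omega> - X 1 \<omega>) > q powr H * ((1 - d) * r)} \<union> {\<omega>\<in>space M. norm (X 1 \<omega>) > 1 / d * r})"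
    proof (intro finite_measure_mono sets.Un ev_xi norm_gt_event subsetI)
      fix \<omega> assume w: "\<omega> \<in> {\<omega>\<in>space M. norm (X q \<omega>) > r * q powr H}"
      have "norm (X q \<omega>) \<le> norm (X q \<omega> - X 1 \<omega>) + norm (X 1 \<omega>)" using norm_triangle_sub[of "X q \<omega>" "X 1 \<omega>"] by simp
      moreover have "r * q powr H = q powr H * ((1 - d) * r) + 1 / d * r"
        unfolding q(2) using d by (simp add: field_simps power2_eq_square)
      ultimately show "\<omega> \<in> {\<omega>\<in>space M. norm (X q \<omega> - X 1 \<omega>) > q powr H * ((1 - d) * r)} \<union> {\<omega>\<in>space M. norm (X 1 \<omega>) > 1 / d * r}"
        using w by (cases "norm (X 1 \<omega>) > 1 / d * r") auto
    qed simp
    also have "\<dots> \<le> T\<xi> ((1 - d) * r) + \<mu>_tail (1 / d * r)"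
      unfolding T\<xi>_def \<mu>_tail_def by (intro measure_Un_le ev_xi norm_gt_event) simp
    finally show ?thesis .
  qed
  have iter: "\<mu>_tail r \<le> (\<Sum>j<J. T\<xi> ((1 / d) ^ j * ((1 - d) * r))) + \<mu>_tail ((1 / d) ^ J * r)" for r J
  proof (induction J)
    case (Suc J)
    have "\<mu>_tail ((1 / d) ^ J * r) \<le> T\<xi> ((1 - d) * ((1 / d) ^ J * r)) + \<mu>_tail (1 / d * ((1 / d) ^ J * r))" by (rule step)
    then show ?case using Suc by (simp add: mult.assoc mult.left_commute)
  qed simp
  obtain R where R: "\<And>r. r \<ge> R \<Longrightarrow> T\<xi> r \<le> exp (- \<kappa>1 * g r)"
    using tail unfolding T\<xi>_def[symmetric] tail_le_def eventually_at_top_linorder by blast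
  have d1: "1 / d > 1" using d by simp
  have shrink: "filterlim (\<lambda>r. (1 - d) * r) at_top at_top"
    by (rule filterlim_tendsto_pos_mult_at_top[OF tendsto_const _ filterlim_ident]) (use d in simp)
  have "\<forall>\<^sub>F r in at_top. \<forall>J. (\<Sum>j<J. exp (- \<kappa>1 * g ((1 / d) ^ j * ((1 - d) * r)))) \<le> 2 * exp (- \<kappa>1 * g ((1 - d) * r))"
    by (rule eventually_compose_filterlim[OF geometric_tail_sum[OF \<kappa>1(1) d1] shrink])
  moreover have "\<forall>\<^sub>F r in at_top. (1 - d) * r \<ge> R" using shrink by (simp add: filterlim_at_top)
  ultimately have ev: "\<forall>\<^sub>F r in at_top. \<mu>_tail r \<le> 2 * exp (- \<kappa>1 * g ((1 - d) * r - 0))"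
    using eventually_gt_at_top[of 0]
  proof eventually_elim
    case (elim r)
    have term_le: "T\<xi> ((1 / d) ^ j * ((1 - d) * r)) \<le> exp (- \<kappa>1 * g ((1 / d) ^ j * ((1 - d) * r)))" for j
    proof (rule R)
      have "1 \<le> (1 / d) ^ j" using d1 by (intro one_le_power) simp
      then have "1 * ((1 - d) * r) \<le> (1 / d) ^ j * ((1 - d) * r)" using d elim by (intro mult_right_mono) auto
      then show "R \<le> (1 / d) ^ j * ((1 - d) * r)" using elim by linarith
    qed
    have "\<mu>_tail r \<le> 2 * exp (- \<kappa>1 * g ((1 - d) * r)) + \<mu>_tail ((1 / d) ^ J * r)" for J
    proof -
      have "(\<Sum>j<J. T\<xi> ((1 / d) ^ j * ((1 - d) * r))) \<le> (\<Sum>j<J. exp (- \<kappa>1 * g ((1 / d) ^ j * ((1 - d) * r))))"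
        by (intro sum_mono term_le)
      also have "\<dots> \<le> 2 * exp (- \<kappa>1 * g ((1 - d) * r))" using elim(1) by blast
      finally show ?thesis using iter[of r J] by linarith
    qed
    moreover have "(\<lambda>J. 2 * exp (- \<kappa>1 * g ((1 - d) * r)) + \<mu>_tail ((1 / d) ^ J * r)) \<longlonglongrightarrow> 2 * exp (- \<kappa>1 * g ((1 - d) * r)) + 0"
    proof (intro tendsto_add tendsto_const filterlim_compose[OF \<mu>_tail_limit])
      have "filterlim (\<lambda>J. r * w ^ J) at_top sequentially" if "w > 1" for w
        using that elim(3) by real_asymp
      from this[OF d1]
      show "filterlim (\<lambda>J. (1 / d) ^ J * r) at_top sequentially" by (simp add: mult.commute)
    qed
    ultimately have "\<mu>_tail r \<le> 2 * exp (- \<kappa>1 * g ((1 - d) * r)) + 0" by (intro LIMSEQ_le_const) auto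
    then show ?case by simp
  qed
  show ?thesis
  proof (rule tail_le_transfer[of "\<lambda>r. exp (- \<kappa>1 * g r)" \<kappa>1 "1 - d" \<kappa> 2 \<mu>_tail 0, OF _ _ _ _ _ ev])
    show "tail_le (\<lambda>r. exp (- \<kappa>1 * g r)) \<kappa>1" by (simp add: tail_le_def)
    show "\<kappa> < \<kappa>1 * (1 - d) powr \<alpha>" by (rule \<kappa>1(2))
  qed (use \<kappa>1(1) d in auto)
qed

text \<open>Dichotomy on the increments over the times \<open>q ^ n\<close>. If their exceedance
  probabilities are not summable, infinitely many increments are so large that one endpoint must be
  large; if they are summable, the tail of the law would decay faster than assumed.\<close>

lemma lower_bound:
  assumes tail: "\<not> tail_le \<mu>_tail \<kappa>" and \<kappa>: "0 < \<kappa>" and a: "a > 0" "\<kappa> * a powr \<alpha> < 1"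
  shows "AE \<omega> in M. \<exists>\<^sub>F t in at_top. norm (X t \<omega>) > a * (t powr H * \<phi> (ln t))"
proof -
  \<comment> \<open>In the limit \<open>d = 0\<close> the inequality is the hypothesis
    \<open>\<kappa> * a powr \<alpha> < 1\<close>. By continuity it survives the losses
    \<open>1 - d\<close> from the iteration and \<open>1 + 2 * d\<^sup>2\<close> from the two
    endpoints.\<close>
  obtain d where d: "0 < d" "d < 1" "\<kappa> * (a * (1 + 2 * d\<^sup>2)) powr \<alpha> < (1 - d) powr \<alpha>"
  proof -
    have "((\<lambda>d. (1 - d) powr \<alpha> - \<kappa> * (a * (1 + 2 * d\<^sup>2)) powr \<alpha>) \<longlongrightarrow> (1 - 0) powr \<alpha> - \<kappa> * (a * (1 + 2 * 0\<^sup>2)) powr \<alpha>) (at_right 0)"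
      using a by (intro tendsto_intros) auto
    then have "\<forall>\<^sub>F d in at_right 0. (1 - d) powr \<alpha> - \<kappa> * (a * (1 + 2 * d\<^sup>2)) powr \<alpha> > 0"
      by (rule order_tendstoD(1)) (use a in simp)
    moreover have "\<forall>\<^sub>F d in at_right 0. d < (1::real)" by (rule eventually_mono[OF eventually_at_right_real[of 0 1]]) auto
    moreover have "\<forall>\<^sub>F d in at_right 0. 0 < (d::real)" by (simp add: eventually_at_right_less)
    ultimately have "\<forall>\<^sub>F d in at_right 0. 0 < d \<and> d < 1 \<and> \<kappa> * (a * (1 + 2 * d\<^sup>2)) powr \<alpha> < (1 - d) powr \<alpha>"
      by eventually_elim simp
    then show ?thesis using that eventually_happens'[OF trivial_limit_at_right_real] by blast
  qed
  \<comment> \<open>If both endpoints respect level \<open>a\<close>, the increment is at most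
    \<open>a * (q powr H + 2)\<close> times the scale at \<open>q ^ n\<close> and the later \<phi>;
    the 2 comes from \<open>phi_double\<close>. Since \<open>q powr H = 1 / d\<^sup>2\<close>, this
    is \<open>q powr H * b\<close>.\<close>
  define b where "b = a * (1 + 2 * d\<^sup>2)"
  have b: "b > 0" using a by (auto simp: b_def intro!: mult_pos_pos add_pos_nonneg)
  have "\<kappa> / (1 - d) powr \<alpha> < 1 / b powr \<alpha>" using d b by (simp add: b_def[symmetric] field_simps)
  \<comment> \<open>The upper bound makes \<kappa>1 a rate that summability can deliver; the lower
    bound makes it sufficient for the rate \<kappa> after the iteration.\<close>
  then obtain \<kappa>1 where \<kappa>1: "\<kappa> / (1 - d) powr \<alpha> < \<kappa>1" "\<kappa>1 < 1 / b powr \<alpha>" using dense by blast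
  have "0 < \<kappa> / (1 - d) powr \<alpha>" using \<kappa> d by simp
  with \<kappa>1 have \<kappa>1_pos: "\<kappa>1 > 0" by linarith
  define q where "q = d powr (- 2 / H)"
  have q: "q > 1" "q powr H = 1 / d\<^sup>2"
  proof -
    have "d powr (2 / H) < 1" using d H_pos by (simp add: powr01_less_one)
    then show "q > 1" using d by (simp add: q_def powr_minus one_less_inverse_iff)
    have "(- 2 / H) * H = - 2" using H_pos by simp
    then show "q powr H = 1 / d\<^sup>2" using d by (simp only: q_def powr_powr) (simp add: powr_minus_divide)
  qed
  define h where "h = ln q"
  have h: "h > 0" using q by (simp add: h_def)
  define V where "V n \<omega> = X (q ^ Suc n) \<omega> - X (q ^ n) \<omega>" for n \<omega>
  define B where "B n = {v::'a. norm v > (q ^ n) powr H * (q powr H * (b * \<phi> (real (Suc n) * h)))}" for n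
  define T\<xi> where "T\<xi> r = prob {\<omega>\<in>space M. norm (X q \<omega> - X 1 \<omega>) > q powr H * r}" for r
  have ind: "indep_vars (\<lambda>_. borel) V UNIV"
    unfolding V_def by (rule increments_indep) (use q in \<open>auto simp: strict_mono_Suc_iff\<close>)
  have B_meas: "B n \<in> sets borel" for n unfolding B_def by measurable
  have V_prob: "prob {\<omega>\<in>space M. V n \<omega> \<in> B n} = T\<xi> (b * \<phi> (real (Suc n) * h))" for n
  proof -
    have qn: "q ^ n > 0" "(q ^ n) powr H > 0" using q by auto
    have "prob {\<omega>\<in>space M. norm (X (q ^ n * q) \<omega> - X (q ^ n * 1) \<omega>) > (q ^ n) powr H * (q powr H * (b * \<phi> (real (Suc n) * h)))}
      = prob {\<omega>\<in>space M. (q ^ n) powr H * norm (X q \<omega> - X 1 \<omega>) > (q ^ n) powr H * (q powr H * (b * \<phi> (real (Suc n) * h)))}"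
      by (rule scaling_increment) (use q qn in auto)
    then show ?thesis using qn(2) unfolding V_def B_def T\<xi>_def by (simp add: mult.commute[of q])
  qed
  show ?thesis
  proof (cases "summable (\<lambda>n. prob {\<omega>\<in>space M. V n \<omega> \<in> B n})")
    case False
    from indep_vars_frequently[OF ind B_meas False] show ?thesis
    proof eventually_elim
      case (elim \<omega>)
      show ?case
      proof (rule ccontr)
        assume "\<not> ?thesis"
        then have ev: "\<forall>\<^sub>F t in at_top. norm (X t \<omega>) \<le> a * (t powr H * \<phi> (ln t))" by (simp add: not_frequently not_less)
        have qn: "filterlim (\<lambda>n. q ^ n) at_top sequentially" using q(1) by real_asymp
        have hn: "filterlim (\<lambda>n. real n * h) at_top sequentially" using h by real_asymp
        have "\<forall>\<^sub>F n in sequentially. norm (X (q ^ n) \<omega>) \<le> a * ((q ^ n) powr H * \<phi> (ln (q ^ n)))"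
          by (rule eventually_compose_filterlim[OF ev qn])
        then have e1: "\<forall>\<^sub>F n in sequentially. norm (X (q ^ n) \<omega>) \<le> a * ((q ^ n) powr H * \<phi> (real n * h))"
          using q by (simp add: ln_realpow h_def)
        then have e2: "\<forall>\<^sub>F n in sequentially. norm (X (q ^ Suc n) \<omega>) \<le> a * ((q ^ Suc n) powr H * \<phi> (real (Suc n) * h))"
          by (rule eventually_compose_filterlim[OF _ filterlim_Suc])
        have e3: "\<forall>\<^sub>F n in sequentially. \<phi> (real n * h) \<le> 2 * \<phi> (real n * h + h)"
          by (rule eventually_compose_filterlim[OF phi_double[OF h] hn])
        have "\<forall>\<^sub>F n in sequentially. V n \<omega> \<notin> B n"
          using e1 e2 e3
        proof eventually_elim
          case (elim n)
          let ?p = "\<phi> (real (Suc n) * h)"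
          have Sn: "real n * h + h = real (Suc n) * h" by (simp add: algebra_simps)
          have qp: "(q ^ n) powr H > 0" using q by simp
          have "norm (V n \<omega>) \<le> norm (X (q ^ Suc n) \<omega>) + norm (X (q ^ n) \<omega>)"
            unfolding V_def by (rule norm_triangle_ineq4)
          also have "\<dots> \<le> a * ((q ^ Suc n) powr H * ?p) + a * ((q ^ n) powr H * (2 * ?p))"
          proof (intro add_mono elim(2))
            have "a * ((q ^ n) powr H * \<phi> (real n * h)) \<le> a * ((q ^ n) powr H * (2 * ?p))"
              using elim(3) a qp unfolding Sn by (intro mult_left_mono) auto
            then show "norm (X (q ^ n) \<omega>) \<le> a * ((q ^ n) powr H * (2 * ?p))" using elim(1) by linarith
          qed
          also have "(q ^ Suc n) powr H = (q ^ n) powr H * q powr H" using q by (simp add: powr_mult)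
          also have "a * ((q ^ n) powr H * q powr H * ?p) + a * ((q ^ n) powr H * (2 * ?p))
            = (q ^ n) powr H * (q powr H * (b * ?p))"
            using d unfolding q(2) b_def by (simp add: field_simps)
          finally show ?case by (simp add: B_def)
        qed
        then show False using elim by (simp add: frequently_def)
      qed
    qed
  next
    case True
    define p where "p n = T\<xi> (b * \<phi> (real (Suc n) * h))" for n
    have p: "summable p" using True unfolding V_prob p_def[abs_def] .
    have diff_meas: "(\<lambda>\<omega>. X q \<omega> - X 1 \<omega>) \<in> borel_measurable M"
      using q by (intro borel_measurable_diff X_meas) auto
    have ev_xi: "{\<omega>\<in>space M. norm (X q \<omega> - X 1 \<omega>) > z} \<in> events" for z using diff_meas by measurable
    have T_antimono: "T\<xi> s \<le> T\<xi> r" if "r \<le> s" for r s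
    proof -
      have "q powr H * r \<le> q powr H * s" using that q(1) by (intro mult_left_mono) auto
      then show ?thesis unfolding T\<xi>_def by (intro finite_measure_mono ev_xi) auto
    qed
    have T_nonneg: "T\<xi> r \<ge> 0" for r by (simp add: T\<xi>_def)
    have "tail_le T\<xi> \<kappa>1"
      using p \<kappa>1_pos \<kappa>1(2) b h unfolding p_def[abs_def]
      by (intro tail_le_of_summable T_antimono T_nonneg) (simp_all add: field_simps)
    then have "tail_le \<mu>_tail \<kappa>"
      unfolding T\<xi>_def[abs_def] using \<kappa>1(1) d
      by (intro tail_le_of_increment_tail[OF d(1,2) q]) (simp_all add: \<kappa>1_pos field_simps)
    with tail show ?thesis by contradiction
  qed
qed

end

section \<open>The rate of decay determines the limit superior\<close>

lemma powr_minus_less_iff: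
  fixes C :: ereal
  assumes "0 \<le> C" "a > 0" "\<alpha> > 0"
  shows powr_minus_greater: "C < ereal a \<Longrightarrow> ereal (a powr (- \<alpha>)) < powr_minus C \<alpha>"
    and powr_minus_less: "ereal a < C \<Longrightarrow> powr_minus C \<alpha> < ereal (a powr (- \<alpha>))"
  using assms by (cases C; auto simp: powr_minus_def intro!: powr_less_mono2_neg)+

lemma powr_minus_eqD:
  assumes "0 \<le> C" "0 \<le> C'" "\<alpha> > 0" "powr_minus C \<alpha> = powr_minus C' \<alpha>"
  shows "C = C'"
proof -
  have False if xy: "0 \<le> x" "x < y" "powr_minus x \<alpha> = powr_minus y \<alpha>" for x y :: ereal
  proof -
    obtain a where a: "x < ereal a" "ereal a < y" using ereal_dense2[OF xy(2)] by blast
    have "0 < ereal a" by (rule le_less_trans[OF xy(1) a(1)])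
    then have "a > 0" by simp
    have "0 \<le> y" using xy by (meson less_imp_le order_trans)
    then have "powr_minus y \<alpha> < ereal (a powr (- \<alpha>))" using \<open>a > 0\<close> assms(3) a(2) by (rule powr_minus_less)
    also have "\<dots> < powr_minus x \<alpha>" using xy(1) \<open>a > 0\<close> assms(3) a(1) by (rule powr_minus_greater)
    finally show False using xy(3) by simp
  qed
  then show ?thesis using assms by (metis linorder_neqE)
qed

text \<open>Turns a rate into the candidate for the almost sure limit superior.\<close>

lemma powr_minus_surj:
  assumes "0 \<le> L" "\<alpha> > 0"
  obtains C where "0 \<le> C" "powr_minus C \<alpha> = L"
proof -
  define C where "C = (if L = 0 then \<infinity> else if L = \<infinity> then 0 else ereal (real_of_ereal L powr (- (1 / \<alpha>))))"
  have "0 \<le> C" using assms by (auto simp: C_def)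
  moreover have "powr_minus C \<alpha> = L" using assms by (cases L) (auto simp: C_def powr_minus_def powr_powr)
  ultimately show ?thesis by (rule that)
qed

context growth_scale
begin

definition rate :: "(real \<Rightarrow> real) \<Rightarrow> ereal"
  where "rate T = Liminf at_top (\<lambda>r. neg_log (T r) / ereal (r powr \<alpha> * f (ln r)))"

lemma rate_ratio_ev:
  "\<forall>\<^sub>F r in at_top. 0 < g r \<and> r powr \<alpha> * f (ln r) = g r"
  using g_pos_ev eventually_ge_at_top[of 1] by eventually_elim (auto simp: g_def max_def)

lemma tail_le_of_rate:
  assumes "ereal \<kappa> < rate T" and nonneg: "\<forall>\<^sub>F r in at_top. 0 \<le> T r"
  shows "tail_le T \<kappa>"
  unfolding tail_le_def using less_LiminfD[OF assms(1)[unfolded rate_def]] nonneg rate_ratio_ev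
proof eventually_elim
  case (elim r)
  show ?case
  proof (cases "T r = 0")
    case False
    then have T: "T r > 0" using elim by simp
    have "\<kappa> < - ln (T r) / g r" using elim False by (simp add: neg_log_def)
    then have "ln (T r) \<le> - \<kappa> * g r" using elim by (simp add: field_simps)
    then show ?thesis using T by (metis exp_le_cancel_iff exp_ln)
  qed simp
qed

lemma rate_ge_of_tail_le:
  assumes "tail_le T \<kappa>" and nonneg: "\<forall>\<^sub>F r in at_top. 0 \<le> T r"
  shows "ereal \<kappa> \<le> rate T"
  unfolding rate_def
proof (rule Liminf_bounded)
  show "\<forall>\<^sub>F r in at_top. ereal \<kappa> \<le> neg_log (T r) / ereal (r powr \<alpha> * f (ln r))"
    using assms(1)[unfolded tail_le_def] nonneg rate_ratio_ev
  proof eventually_elim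
    case (elim r)
    show ?case
    proof (cases "T r = 0")
      case False
      then have T: "T r > 0" using elim by simp
      have "ln (T r) \<le> ln (exp (- \<kappa> * g r))" using T elim by (subst ln_le_cancel_iff) auto
      then have "\<kappa> \<le> - ln (T r) / g r" using elim by (simp add: field_simps)
      then show ?thesis using elim False by (simp add: neg_log_def)
    qed (use elim in \<open>simp add: neg_log_def\<close>)
  qed
qed

text \<open>As \<open>g\<close> tends to infinity, a bounded function is eventually below
  \<open>exp (e * g r)\<close> for every \<open>e > 0\<close>.\<close>

lemma rate_nonneg:
  assumes "\<forall>\<^sub>F r in at_top. T r \<le> A" and nonneg: "\<forall>\<^sub>F r in at_top. 0 \<le> T r"
  shows "0 \<le> rate T"
proof (rule ereal_le_epsilon2)
  fix e :: real assume e: "e > 0"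
  have "\<forall>\<^sub>F r in at_top. g r \<ge> ln (max A 1) / e" using g_at_top by (simp add: filterlim_at_top)
  with assms(1) have "tail_le T (- e)" unfolding tail_le_def
  proof eventually_elim
    case (elim r)
    have "ln (max A 1) \<le> e * g r" using elim(2) e by (simp add: field_simps)
    then have "exp (ln (max A 1)) \<le> exp (e * g r)" by (subst exp_le_cancel_iff)
    then have "max A 1 \<le> exp (e * g r)" by simp
    then show ?case using elim(1) by simp
  qed
  then have "ereal (- e) \<le> rate T" by (rule rate_ge_of_tail_le[OF _ nonneg])
  then show "0 \<le> rate T + ereal e" by (cases "rate T") auto
qed

end

context selfsimilar_growth
begin

definition limsup_ratio :: "'w \<Rightarrow> ereal"
  where "limsup_ratio \<omega> = Limsup at_top (\<lambda>t. ereal (norm (X t \<omega>) / (t powr H * \<phi> (ln t))))"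

lemma scale_pos_ev: "\<forall>\<^sub>F t in at_top. t powr H * \<phi> (ln t) > 0"
  using eventually_gt_at_top[of 0] eventually_compose_filterlim[OF phi_pos_ev ln_at_top]
  by eventually_elim simp

lemma \<mu>_tail_nonneg_ev: "\<forall>\<^sub>F r in at_top. 0 \<le> \<mu>_tail r" by (simp add: \<mu>_tail_nonneg)

lemma rate_\<mu>_nonneg: "0 \<le> rate \<mu>_tail"
  by (rule rate_nonneg[of _ 1]) (auto simp: \<mu>_tail_nonneg \<mu>_tail_def)

lemma limsup_ratio_le:
  assumes a: "a > 0" "ereal (a powr (- \<alpha>)) < rate \<mu>_tail"
  shows "AE \<omega> in M. limsup_ratio \<omega> \<le> ereal a"
proof -
  obtain \<kappa> where \<kappa>: "ereal (a powr (- \<alpha>)) < ereal \<kappa>" "ereal \<kappa> < rate \<mu>_tail"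
    using ereal_dense2[OF a(2)] by blast
  then have \<kappa>': "a powr (- \<alpha>) < \<kappa>" by simp
  moreover have "a powr (- \<alpha>) > 0" using a by simp
  ultimately have "\<kappa> > 0" by linarith
  moreover have "1 < \<kappa> * a powr \<alpha>" using \<kappa>' a by (simp add: powr_minus_divide field_simps)
  ultimately have "AE \<omega> in M. \<forall>\<^sub>F t in at_top. norm (X t \<omega>) \<le> a * (t powr H * \<phi> (ln t))"
    using tail_le_of_rate[OF \<kappa>(2) \<mu>_tail_nonneg_ev] a by (intro upper_bound)
  then show ?thesis
  proof eventually_elim
    case (elim \<omega>)
    show ?case unfolding limsup_ratio_def
    proof (rule Limsup_bounded)
      show "\<forall>\<^sub>F t in at_top. ereal (norm (X t \<omega>) / (t powr H * \<phi> (ln t))) \<le> ereal a"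
        using elim scale_pos_ev by eventually_elim (simp add: pos_divide_le_eq)
    qed
  qed
qed

lemma limsup_ratio_ge:
  assumes a: "a > 0" "rate \<mu>_tail < ereal (a powr (- \<alpha>))"
  shows "AE \<omega> in M. ereal a \<le> limsup_ratio \<omega>"
proof -
  obtain \<kappa> where \<kappa>: "rate \<mu>_tail < ereal \<kappa>" "ereal \<kappa> < ereal (a powr (- \<alpha>))"
    using ereal_dense2[OF a(2)] by blast
  have "0 < ereal \<kappa>" by (rule le_less_trans[OF rate_\<mu>_nonneg \<kappa>(1)])
  then have "\<kappa> > 0" by simp
  moreover have "\<kappa> * a powr \<alpha> < 1" using \<kappa>(2) a by (simp add: powr_minus_divide field_simps)
  moreover have "\<not> tail_le \<mu>_tail \<kappa>" using rate_ge_of_tail_le[OF _ \<mu>_tail_nonneg_ev, of \<kappa>] \<kappa>(1) by auto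
  ultimately have "AE \<omega> in M. \<exists>\<^sub>F t in at_top. norm (X t \<omega>) > a * (t powr H * \<phi> (ln t))"
    using a by (intro lower_bound)
  then show ?thesis
  proof eventually_elim
    case (elim \<omega>)
    show ?case
    proof (rule ccontr)
      assume "\<not> ?thesis"
      then have "Limsup at_top (\<lambda>t. ereal (norm (X t \<omega>) / (t powr H * \<phi> (ln t)))) < ereal a"
        by (simp add: limsup_ratio_def)
      then have "\<forall>\<^sub>F t in at_top. ereal (norm (X t \<omega>) / (t powr H * \<phi> (ln t))) < ereal a" by (rule Limsup_lessD)
      then have "\<forall>\<^sub>F t in at_top. \<not> norm (X t \<omega>) > a * (t powr H * \<phi> (ln t))"
        using scale_pos_ev by eventually_elim (simp add: pos_divide_less_eq)
      then show False using elim by (simp add: frequently_def)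
    qed
  qed
qed

text \<open>One-sided bounds hold almost surely for each fixed level. Restricting to rational levels
  keeps the exceptional sets countable in number, and density of the rationals then pins down the
  value.\<close>

lemma limsup_ratio_eq:
  assumes C: "0 \<le> C" "powr_minus C \<alpha> = rate \<mu>_tail"
  shows "AE \<omega> in M. limsup_ratio \<omega> = C"
proof -
  have "AE \<omega> in M. C < ereal (of_rat a) \<longrightarrow> limsup_ratio \<omega> \<le> ereal (of_rat a)" for a :: rat
  proof (cases "C < ereal (of_rat a)")
    case True
    then have "0 < ereal (of_rat a)" using C(1) by (rule le_less_trans[rotated])
    then have "AE \<omega> in M. limsup_ratio \<omega> \<le> ereal (of_rat a)"
      using powr_minus_greater[OF C(1) _ \<alpha>_pos True] C(2) by (intro limsup_ratio_le) auto
    then show ?thesis by eventually_elim simp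
  qed simp
  then have up: "AE \<omega> in M. \<forall>a :: rat. C < ereal (of_rat a) \<longrightarrow> limsup_ratio \<omega> \<le> ereal (of_rat a)"
    by (simp add: AE_all_countable)
  have "AE \<omega> in M. 0 < a \<longrightarrow> ereal (of_rat a) < C \<longrightarrow> ereal (of_rat a) \<le> limsup_ratio \<omega>" for a :: rat
  proof (cases "0 < a \<and> ereal (of_rat a) < C")
    case True
    then have "AE \<omega> in M. ereal (of_rat a) \<le> limsup_ratio \<omega>"
      using powr_minus_less[OF C(1) _ \<alpha>_pos, of "of_rat a"] C(2) by (intro limsup_ratio_ge) auto
    then show ?thesis by eventually_elim simp
  qed auto
  then have lo: "AE \<omega> in M. \<forall>a :: rat. 0 < a \<longrightarrow> ereal (of_rat a) < C \<longrightarrow> ereal (of_rat a) \<le> limsup_ratio \<omega>"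
    by (simp add: AE_all_countable)
  show ?thesis using up lo
  proof eventually_elim
    case (elim \<omega>)
    \<comment> \<open>Ensures that a rational separating the limit superior from a larger
      \<open>C\<close> is positive, as the lower bound requires; it also settles
      \<open>C = 0\<close>.\<close>
    have nonneg: "0 \<le> limsup_ratio \<omega>"
    proof -
      have "0 \<le> Liminf at_top (\<lambda>t. ereal (norm (X t \<omega>) / (t powr H * \<phi> (ln t))))"
        by (rule Liminf_bounded) (use scale_pos_ev in \<open>auto elim!: eventually_mono\<close>)
      also have "\<dots> \<le> limsup_ratio \<omega>" unfolding limsup_ratio_def by (rule Liminf_le_Limsup) simp
      finally show ?thesis .
    qed
    show ?case
    proof (rule antisym)
      show "limsup_ratio \<omega> \<le> C"
      proof (rule ccontr)
        assume "\<not> limsup_ratio \<omega> \<le> C"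
        then obtain a :: rat where "C < ereal (of_rat a)" "ereal (of_rat a) < limsup_ratio \<omega>"
          using ereal_dense3[of C "limsup_ratio \<omega>"] by (auto simp: not_le)
        then show False using elim(1) by (meson not_le)
      qed
      show "C \<le> limsup_ratio \<omega>"
      proof (rule ccontr)
        assume "\<not> C \<le> limsup_ratio \<omega>"
        then obtain a :: rat where a: "limsup_ratio \<omega> < ereal (of_rat a)" "ereal (of_rat a) < C"
          using ereal_dense3[of "limsup_ratio \<omega>" C] by (auto simp: not_le)
        have "0 < ereal (of_rat a)" using nonneg a(1) by (rule le_less_trans)
        then have "0 < a" by simp
        then show False using elim(2) a by (meson not_le)
      qed
    qed
  qed
qed

text \<open>The rate always produces some almost sure value \<open>C'\<close>. Two constants that
  are both almost sure values on a probability space coincide, so knowing the limit superior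
  recovers the rate.\<close>

lemma limsup_ratio_iff:
  assumes C: "0 \<le> C"
  shows "(AE \<omega> in M. limsup_ratio \<omega> = C) \<longleftrightarrow> rate \<mu>_tail = powr_minus C \<alpha>"
proof
  assume L: "AE \<omega> in M. limsup_ratio \<omega> = C"
  obtain C' where C': "0 \<le> C'" "powr_minus C' \<alpha> = rate \<mu>_tail"
    using powr_minus_surj[OF rate_\<mu>_nonneg \<alpha>_pos] by blast
  have "AE \<omega> in M. C = C'" using L limsup_ratio_eq[OF C'] by eventually_elim simp
  then have "C = C'" by simp
  then show "rate \<mu>_tail = powr_minus C \<alpha>" using C' by simp
qed (use limsup_ratio_eq C in auto)

end

context submultiplicative_scale
begin

text \<open>A rate is a supremum of admissible exponents, so it is enough that tail bounds pass in
  both directions with an arbitrarily small loss. Nonnegativity of both rates restricts this to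
  positive exponents.\<close>

lemma rate_radial_eq:
  fixes \<mu> \<nu> \<sigma> :: "'b::euclidean_space measure"
  assumes \<mu>: "prob_space \<mu>" "sets \<mu> = sets borel" and lk: "levy_khintchine \<mu> A \<nu> \<gamma>"
    and rep: "emeasure \<nu> UNIV \<noteq> 0 \<Longrightarrow> selfdecomposable_representation \<nu> \<sigma> k"
  shows "rate (radial_K \<nu> \<sigma> k) = rate (\<lambda>r. measure \<mu> {x. norm x > r})"
proof -
  interpret prob_space \<mu> by fact
  note \<nu>D = levy_khintchine_levy_measureD[OF lk]
  let ?\<mu> = "\<lambda>r. measure \<mu> {x. norm x > r}" and ?K = "radial_K \<nu> \<sigma> k"
  have radial: "radial_levy \<nu> \<sigma> k" "?K = (\<lambda>r. LINT \<xi>|\<sigma>. k \<xi> r)" if "emeasure \<nu> UNIV \<noteq> 0"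
    using rep[OF that] \<nu>D(4) that by (auto simp: radial_levy_def radial_K_def)
  have \<mu>_nonneg: "\<forall>\<^sub>F r in at_top. 0 \<le> ?\<mu> r" by simp
  have \<mu>0: "0 \<le> rate ?\<mu>" by (rule rate_nonneg[of _ 1]) auto
  have K_ev: "\<forall>\<^sub>F r in at_top. 0 \<le> ?K r"
  proof (cases "emeasure \<nu> UNIV = 0")
    case False
    interpret radial_levy \<nu> \<sigma> k by (rule radial(1)[OF False])
    show ?thesis using eventually_gt_at_top[of 0]
      by eventually_elim (use K_nonneg radial(2)[OF False] in \<open>simp add: K_def\<close>)
  qed (simp add: radial_K_def)
  have K0: "0 \<le> rate ?K"
  proof (cases "emeasure \<nu> UNIV = 0")
    case True
    then show ?thesis by (intro rate_nonneg[of _ 0]) (auto simp: radial_K_def)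
  next
    case False
    interpret radial_levy \<nu> \<sigma> k by (rule radial(1)[OF False])
    have m: "{x::'b. norm x > s} \<in> sets \<nu>" for s
    proof -
      have "{x::'b. norm x > s} \<in> sets borel" by measurable
      then show ?thesis using \<nu>D(1) by simp
    qed
    have "\<forall>\<^sub>F r in at_top. ?K r \<le> measure \<nu> {x. norm x > 1} / ln 2"
      using eventually_ge_at_top[of 2]
    proof eventually_elim
      case (elim r)
      have "K r * ln 2 \<le> measure \<nu> {x. norm x > r / 2}" using shell_lower[of "r / 2" 2] elim by simp
      also have "\<dots> \<le> measure \<nu> {x. norm x > 1}"
      proof (rule measure_mono_fmeasurable[OF _ m])
        show "{x. norm x > 1} \<in> fmeasurable \<nu>" using m tail_fin[of 1] by (intro fmeasurableI) auto
      qed (use elim in auto)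
      finally show ?case unfolding radial(2)[OF False] K_def by (simp add: field_simps)
    qed
    then show ?thesis by (rule rate_nonneg[OF _ K_ev])
  qed
  have to_\<mu>: "tail_le ?\<mu> \<kappa>'" if K: "tail_le ?K \<kappa>" and \<kappa>: "0 < \<kappa>'" "\<kappa>' < \<kappa>" for \<kappa> \<kappa>'
  proof -
    obtain \<kappa>2 where \<kappa>2: "\<kappa>' < \<kappa>2" "\<kappa>2 < \<kappa>" using \<kappa>(2) dense by blast
    have "integrable \<nu> (\<lambda>x. indicator {x. norm x > 1} x * exp (\<kappa>2 * g (norm x)))"
    proof (cases "emeasure \<nu> UNIV = 0")
      \<comment> \<open>With \<nu> = 0 the radial function vanishes and satisfies every tail bound.
        The moment condition is then trivial, and the law decays at every rate by the same argument
        as in the other case.\<close>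
      case True
      have "space \<nu> = UNIV" using sets_eq_imp_space_eq[OF \<nu>D(1)] by simp
      then have "\<nu> = null_measure borel"
        using True \<nu>D(1) by (intro measure_eqI) (auto intro: emeasure_eq_0[of UNIV] simp: sets.sets_into_space[of UNIV])
      have "mono (\<lambda>x. exp (\<kappa>2 * g (max 0 x)))"
        by (rule monoI) (use g_mono \<kappa> \<kappa>2 in simp)
      then have [measurable]: "(\<lambda>x. exp (\<kappa>2 * g (max 0 x))) \<in> borel_measurable borel" by (rule borel_measurable_mono)
      have "(\<lambda>x::'b. indicator {x. norm x > 1} x * exp (\<kappa>2 * g (max 0 (norm x)))) \<in> borel_measurable borel" by measurable
      then show ?thesis unfolding \<open>\<nu> = null_measure borel\<close>
        by (simp add: integrable_iff_bounded)
    next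
      case False
      show ?thesis
        by (rule levy_moment[OF radial(1)[OF False] _ _ \<kappa>2(2) \<nu>D(1)])
          (use K radial(2)[OF False] \<kappa> \<kappa>2 in auto)
    qed
    then show ?thesis using \<kappa> \<kappa>2 by (intro tail_of_levy_moment[OF \<mu> lk, of \<kappa>2]) auto
  qed
  have to_K: "tail_le ?K \<kappa>'" if \<mu>t: "tail_le ?\<mu> \<kappa>" and \<kappa>: "0 < \<kappa>'" "\<kappa>' < \<kappa>" for \<kappa> \<kappa>'
  proof (cases "emeasure \<nu> UNIV = 0")
    case True
    then show ?thesis by (simp add: radial_K_def tail_le_def)
  next
    case False
    obtain \<kappa>2 where \<kappa>2: "\<kappa>' < \<kappa>2" "\<kappa>2 < \<kappa>" using \<kappa>(2) dense by blast
    then have "tail_le (\<lambda>r. measure \<nu> {x. norm x > r}) \<kappa>2"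
      using \<kappa> by (intro levy_tail_of_tail[OF \<mu> lk \<mu>t]) auto
    then show ?thesis unfolding radial(2)[OF False]
      using radial_tail_of_levy_tail[OF radial(1)[OF False] _ \<kappa>(1) \<kappa>2(1)] by blast
  qed
  have le: "rate S \<le> rate T"
    if T: "0 \<le> rate T" "\<forall>\<^sub>F r in at_top. 0 \<le> T r" and S: "\<forall>\<^sub>F r in at_top. 0 \<le> S r"
      and transfer: "\<And>\<kappa> \<kappa>'. tail_le S \<kappa> \<Longrightarrow> 0 < \<kappa>' \<Longrightarrow> \<kappa>' < \<kappa> \<Longrightarrow> tail_le T \<kappa>'" for S T
  proof (rule ccontr)
    assume "\<not> rate S \<le> rate T"
    then have "rate T < rate S" by simp
    then obtain \<kappa>' where \<kappa>': "rate T < ereal \<kappa>'" "ereal \<kappa>' < rate S" using ereal_dense2 by blast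
    obtain \<kappa> where \<kappa>: "ereal \<kappa>' < ereal \<kappa>" "ereal \<kappa> < rate S" using ereal_dense2[OF \<kappa>'(2)] by blast
    have "0 < ereal \<kappa>'" using T(1) \<kappa>'(1) by (rule le_less_trans)
    then have "tail_le T \<kappa>'" using transfer[OF tail_le_of_rate[OF \<kappa>(2) S]] \<kappa>(1) by simp
    then have "ereal \<kappa>' \<le> rate T" by (rule rate_ge_of_tail_le[OF _ T(2)])
    then show False using \<kappa>'(1) by simp
  qed
  show ?thesis
  proof (rule antisym)
    show "rate ?K \<le> rate ?\<mu>" by (rule le[OF \<mu>0 \<mu>_nonneg K_ev to_\<mu>])
    show "rate ?\<mu> \<le> rate ?K" by (rule le[OF K0 K_ev \<mu>_nonneg to_K])
  qed
qed

end

theorem proposition2p24: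
  fixes M :: "'w measure" and X :: "real \<Rightarrow> 'w \<Rightarrow> real ^ 'd"
    and H \<alpha> :: real and C :: ereal and f :: "real \<Rightarrow> real"
  assumes "H > 0"
    and "selfsimilar_additive_process M H X"
    and "\<not> deterministic_process M H X"
    and "0 \<le> C"
    and "0 < \<alpha>" and "\<alpha> \<le> 1"
    and "regularly_varying f"
    and "mono_on {0..} (\<lambda>r. exp (r powr \<alpha> * f (ln (max r 1))))"
    and "submultiplicative (\<lambda>r. exp (r powr \<alpha> * f (ln (max r 1))))"
  defines "\<mu> \<equiv> distr M borel (X 1)"
  shows "(\<forall>\<nu> \<sigma> k. levy_measure \<mu> \<nu> \<and>
             (emeasure \<nu> UNIV \<noteq> 0 \<longrightarrow> selfdecomposable_representation \<nu> \<sigma> k) \<longrightarrow>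
           ((AE \<omega> in M. Limsup at_top (\<lambda>t. ereal (norm (X t \<omega>) /
                (t powr H * ((ln ^^ 2) t) powr (1 / \<alpha>) / f ((ln ^^ 3) t / \<alpha>) powr (1 / \<alpha>)))) = C)
            \<longleftrightarrow> Liminf at_top (\<lambda>r. neg_log (radial_K \<nu> \<sigma> k r) / ereal (r powr \<alpha> * f (ln r)))
                = powr_minus C \<alpha>))
       \<and> ((AE \<omega> in M. Limsup at_top (\<lambda>t. ereal (norm (X t \<omega>) /
                (t powr H * ((ln ^^ 2) t) powr (1 / \<alpha>) / f ((ln ^^ 3) t / \<alpha>) powr (1 / \<alpha>)))) = C)
            \<longleftrightarrow> Liminf at_top (\<lambda>r. neg_log (measure \<mu> {x. norm x > r}) / ereal (r powr \<alpha> * f (ln r)))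
                = powr_minus C \<alpha>)"
proof -
  interpret P: selfsimilar_growth \<alpha> f M H X
    using assms(2,5,7,8) by unfold_locales
  interpret S: submultiplicative_scale \<alpha> f
    using assms(9) by unfold_locales
  have \<mu>_prob: "prob_space \<mu>" "sets \<mu> = sets borel"
    unfolding \<mu>_def using P.X_meas[of 1] by (auto intro: P.prob_space_distr)
  have tail: "P.\<mu>_tail = (\<lambda>r. measure \<mu> {x. norm x > r})"
    unfolding \<mu>_def by (rule ext, rule P.\<mu>_tail_eq)
  have ratio: "Limsup at_top (\<lambda>t. ereal (norm (X t \<omega>) /
      (t powr H * ((ln ^^ 2) t) powr (1 / \<alpha>) / f ((ln ^^ 3) t / \<alpha>) powr (1 / \<alpha>)))) = P.limsup_ratio \<omega>" for \<omega>
    unfolding P.limsup_ratio_def P.\<phi>_def by (simp add: numeral_2_eq_2 numeral_3_eq_3)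
  show ?thesis
  proof (intro conjI allI impI)
    show "(AE \<omega> in M. Limsup at_top (\<lambda>t. ereal (norm (X t \<omega>) /
                (t powr H * ((ln ^^ 2) t) powr (1 / \<alpha>) / f ((ln ^^ 3) t / \<alpha>) powr (1 / \<alpha>)))) = C)
            \<longleftrightarrow> Liminf at_top (\<lambda>r. neg_log (measure \<mu> {x. norm x > r}) / ereal (r powr \<alpha> * f (ln r)))
                = powr_minus C \<alpha>"
      unfolding ratio P.limsup_ratio_iff[OF assms(4)] tail P.rate_def ..
    fix \<nu> \<sigma> k
    assume h: "levy_measure \<mu> \<nu> \<and> (emeasure \<nu> UNIV \<noteq> 0 \<longrightarrow> selfdecomposable_representation \<nu> \<sigma> k)"
    then obtain A \<gamma> where "levy_khintchine \<mu> A \<nu> \<gamma>" by (auto simp: levy_measure_def)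
    from S.rate_radial_eq[OF \<mu>_prob this] h
    have "P.rate (radial_K \<nu> \<sigma> k) = P.rate P.\<mu>_tail" unfolding tail by blast
    then show "(AE \<omega> in M. Limsup at_top (\<lambda>t. ereal (norm (X t \<omega>) /
                (t powr H * ((ln ^^ 2) t) powr (1 / \<alpha>) / f ((ln ^^ 3) t / \<alpha>) powr (1 / \<alpha>)))) = C)
            \<longleftrightarrow> Liminf at_top (\<lambda>r. neg_log (radial_K \<nu> \<sigma> k r) / ereal (r powr \<alpha> * f (ln r)))
                = powr_minus C \<alpha>"
      unfolding ratio P.limsup_ratio_iff[OF assms(4)] P.rate_def by simp
  qed
qed

end
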